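(* Let $G \in \{\mathrm{U}, \mathrm{Sp}, \mathrm{O}, \mathrm{SO(even)}, \mathrm{SO(odd)}\}$ and $\Delta>0$. Let $\mathcal{F}$ range over finite families of automorphic objects with $\#\mathcal{F}\to\infty$, where each family satisfies: for each $f\in\mathcal{F}$ the $L$-function $L(s,f)=\sum_{n\ge1}\lambda_f(n)n^{-s}$ extends to an entire function; there is a completed $L$-function $\Lambda(s,f)=L_\infty(s,f)L(s,f)$ with $\Lambda(s,f)=\varepsilon_f\Lambda(1-s,\bar f)$, $|\varepsilon_f|=1$, where $L(s,\bar f)$ has coefficients $\overline{\lambda_f(n)}$; $L_\infty(s,f)$ has no zeros on $\mathrm{Re}(s)=1/2$; if $f\in\mathcal{F}$ then $\bar f\in\mathcal{F}$; and (GRH) every non-trivial zero $\frac12+i\gamma_f$ of $L(s,f)$ has $\gamma_f\in\mathbb{R}$. Suppose that for every even Schwartz function $\phi:\mathbb{R}\to\mathbb{R}$ with $\mathrm{supp}(\widehat{\phi})\subset(-\Delta,\Delta)$, \[ \lim_{\# \mathcal{F}\to\infty} \frac{1}{\#\mathcal{F}} \sum_{f\in \mathcal{F}} \sum_{\gamma_f} \phi\!\left( \gamma_f \frac{\log c_f}{2\pi}\right) = \int_\mathbb{R} \phi(x)\, W_G(x)\, dx, \] with $c_f$ the analytic conductor and zeros counted with multiplicity. For each $f$ let $\mathcal{Z}(f)$ be a sub-multiset of the zeros of $L(s,f)$ at the central point ($\gamma_f=0$) such that $\lim_{\#\mathcal{F}\to\infty}\frac{1}{\#\mathcal{F}}\sum_{f}\#\mathcal{Z}(f)$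 equals $\frac12$ if $G=\mathrm O$ and $1$ if $G=\mathrm{SO(odd)}$, and $\mathcal{Z}(f)=\emptyset$ if $G\in\{\mathrm U,\mathrm{Sp},\mathrm{SO(even)}\}$. Set $G^\sharp=G$ if $G\in\{\mathrm U,\mathrm{Sp},\mathrm{SO(even)}\}$, $\mathrm O^\sharp=\mathrm U$, $\mathrm{SO(odd)}^\sharp=\mathrm{Sp}$. Let $K=K_{G^\sharp,\pi\Delta}$ and let $\xi_0$ be the smallest positive real zero of $x\mapsto \mathrm{Re}\big((1-ix)K(i,x)\big)$. Then \[ \limsup_{\# \mathcal{F} \to \infty} \ \min_{\substack{ \gamma_f \notin \mathcal{Z}(f) \\ f \in \mathcal{F}}} \left|\frac{\gamma_{f} \,\log c_f}{2\pi}\right| \leq \xi_0. \]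
   Context: Fourier transform $\widehat{F}(y)=\int e^{-2\pi ixy}F(x)dx$. Densities: $W_{\mathrm U}=1$; $W_{\mathrm{Sp}}(x)=1-\frac{\sin 2\pi x}{2\pi x}$; $W_{\mathrm O}(x)=1+\frac12\boldsymbol{\delta}_0(x)$; $W_{\mathrm{SO(even)}}(x)=1+\frac{\sin 2\pi x}{2\pi x}$; $W_{\mathrm{SO(odd)}}(x)=1-\frac{\sin 2\pi x}{2\pi x}+\boldsymbol{\delta}_0(x)$, with $\boldsymbol{\delta}_0$ the Dirac delta at $0$. For $H\in\{\mathrm U,\mathrm{Sp},\mathrm{SO(even)}\}$ and $\Delta>0$, $\mathcal{H}_{H,\pi\Delta}$ is the Hilbert space of entire functions $F$ of exponential type at most $\pi\Delta$ with $\int_{\mathbb{R}}|F|^2W_H<\infty$ and inner product $\int F\overline{G}W_H$; its reproducing kernel $K_{H,\pi\Delta}$ is the unique function on $\mathbb{C}\times\mathbb{C}$ with $K_{H,\pi\Delta}(w,\cdot)$ in the space and $F(w)=\int_{\mathbb{R}}F(x)\overline{K_{H,\pi\Delta}(w,x)}W_H(x)dx$ for all $F$ in the space and all $w\in\mathbb{C}$. *)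

theory Defs
  imports "HOL-Complex_Analysis.Complex_Analysis"
begin

datatype symtype = GU | GSp | GO | GSOeven | GSOodd

definition fourier :: "(real \<Rightarrow> real) \<Rightarrow> real \<Rightarrow> complex" where
  "fourier F y = (LINT x|lborel. cis (- 2 * pi * x * y) * complex_of_real (F x))"

definition schwartz :: "(real \<Rightarrow> real) \<Rightarrow> bool" where
  "schwartz F \<longleftrightarrow>
     (\<forall>k x. ((deriv ^^ k) F) differentiable (at x)) \<and>
     (\<forall>j k. bounded (range (\<lambda>x. x ^ j * (deriv ^^ k) F x)))"

text \<open>Densities without Dirac masses (for U, Sp, SO(even)).\<close>
definition sinc2 :: "real \<Rightarrow> real" where
  "sinc2 x = sin (2 * pi * x) / (2 * pi * x)"

fun Wfun :: "symtype \<Rightarrow> real \<Rightarrow> real" where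
  "Wfun GU x = 1"
| "Wfun GSp x = 1 - sinc2 x"
| "Wfun GSOeven x = 1 + sinc2 x"
| "Wfun GO x = 1"
| "Wfun GSOodd x = 1 - sinc2 x"

text \<open>The integral of phi against W_G, including the Dirac masses at 0.\<close>
definition one_level :: "symtype \<Rightarrow> (real \<Rightarrow> real) \<Rightarrow> real" where
  "one_level G phi =
     (LINT x|lborel. phi x * Wfun G x)
     + (if G = GO then phi 0 / 2 else if G = GSOodd then phi 0 else 0)"

fun sharp :: "symtype \<Rightarrow> symtype" where
  "sharp GO = GU"
| "sharp GSOodd = GSp"
| "sharp G = G"

definition exp_type_le :: "(complex \<Rightarrow> complex) \<Rightarrow> real \<Rightarrow> bool" where
  "exp_type_le F tau \<longleftrightarrow>
     (\<forall>e>0. \<exists>C. \<forall>z. norm (F z) \<le> C * exp ((tau + e) * norm z))"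

definition HSpace :: "(real \<Rightarrow> real) \<Rightarrow> real \<Rightarrow> (complex \<Rightarrow> complex) set" where
  "HSpace W tau = {F. F holomorphic_on UNIV \<and> exp_type_le F tau \<and>
      integrable lborel (\<lambda>x. (norm (F (of_real x)))\<^sup>2 * W x)}"

definition repkernel :: "(real \<Rightarrow> real) \<Rightarrow> real \<Rightarrow> complex \<Rightarrow> complex \<Rightarrow> complex" where
  "repkernel W tau = (THE K. (\<forall>w. K w \<in> HSpace W tau) \<and>
      (\<forall>F\<in>HSpace W tau. \<forall>w. F w =
         (LINT x|lborel. F (of_real x) * cnj (K w (of_real x)) * of_real (W x))))"

definition xi_zeros :: "symtype \<Rightarrow> real \<Rightarrow> real set" where
  "xi_zeros G D = {x. 0 < x \<and>
     Re ((1 - \<i> * of_real x) * repkernel (Wfun (sharp G)) (pi * D) \<i> (of_real x)) = 0}"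

definition zeroset :: "(complex \<Rightarrow> complex) \<Rightarrow> real set" where
  "zeroset Lf = {g. Lf (1/2 + \<i> * of_real g) = 0}"

definition zmult :: "(complex \<Rightarrow> complex) \<Rightarrow> real \<Rightarrow> nat" where
  "zmult Lf g = (if Lf (1/2 + \<i> * of_real g) = 0
                 then nat (zorder Lf (1/2 + \<i> * of_real g)) else 0)"

definition zero_sum :: "(complex \<Rightarrow> complex) \<Rightarrow> real \<Rightarrow> (real \<Rightarrow> real) \<Rightarrow> real" where
  "zero_sum Lf c phi = (\<Sum>\<^sub>\<infinity>g\<in>zeroset Lf. real (zmult Lf g) * phi (g * ln c / (2 * pi)))"

definition zero_summable :: "(complex \<Rightarrow> complex) \<Rightarrow> real \<Rightarrow> (real \<Rightarrow> real) \<Rightarrow> bool" where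
  "zero_summable Lf c phi \<longleftrightarrow>
     (\<lambda>g. real (zmult Lf g) * phi (g * ln c / (2 * pi))) summable_on zeroset Lf"

end

theory Submission
  imports Defs
begin

text \<open>
  Write \<open>k = K(i,\<cdot>)\<close> for the reproducing kernel at \<open>i\<close>, \<open>\<xi>\<close> for \<open>\<xi>0\<close>, and let \<open>A\<close> be the entire function with
  \<open>A(x) = Re ((1 - ix) k(x))\<close> on the real line. It is even, so \<open>F(z) = A(z) / (z\<^sup>2 - \<xi>\<^sup>2)\<close> is entire.
  The function \<open>(1 + iz) F(z)\<close> lies in the space and vanishes at \<open>i\<close>; the reproducing property and a
  real part give \<open>\<integral> (x\<^sup>2 - \<xi>\<^sup>2) F\<^sup>2 W = \<integral> F A W = 0\<close>. Hence for every \<open>r > \<xi>\<close> the function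
  \<open>(r\<^sup>2 - x\<^sup>2) F(x)\<^sup>2\<close> has positive integral against \<open>W\<close> and is nonpositive for \<open>|x| \<ge> r\<close>. After
  a slight dilation and multiplication by a rapidly decaying band-limited factor it is an admissible
  Schwartz test function. If along a subsequence all zeros outside \<open>Z(f)\<close> had normalised
  height above \<open>r\<close>, only the zeros in \<open>Z(f)\<close> could contribute positively to its zero sums, and in
  the limit the integral would be at most \<open>0\<close>.

  Existence of the kernel rests on the pointwise bound \<open>|F(z)| \<le> C \<parallel>F\<parallel> exp (\<tau> |Im z|)\<close>, a
  Plancherel-Polya type consequence of the Phragmen-Lindelof principle.
\<close>

subsection \<open>The Phragmen-Lindelof principle\<close>

text \<open>The main obstacle is the density at the origin: for Sp it tends to 0 to second order
  there. The analysis therefore assumes only W(x) >= kappa x^2 / (1 + x^2), and pointwise bounds are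
  first proved for z F(z) at a distance from the real axis, where division by z is harmless. Since
  \<open>repkernel\<close> is a definite description, nothing is known about it until a kernel is
  shown to exist and to be unique; the pointwise bound supplies both completeness and definiteness.
  Minimality of xi enters as a nonvanishing statement: A(xi/2) is not 0, so F is not identically 0,
  and the integral of (r^2 - x^2) F^2 W equals (r^2 - xi^2) times the squared norm of F. The factor
  F^2 already uses up the whole type 2 pi Delta, while the support has to lie in an open interval:
  dilation by 1 - eps frees type 2 pi Delta eps, half of which is spent on the decaying factor and
  half kept as a margin. The Dirac masses of O and SO(odd) weigh exactly as much as the mean size of
  Z(f), so the two cancel and the density of \<open>sharp G\<close> remains.\<close>

lemma Re_csqrt_cube_ge:
  fixes u :: complex
  assumes "\<bar>Im u\<bar> \<le> Re u"
  shows "Re (csqrt u ^ 3) \<ge> Re (csqrt u) ^ 3 / 4" "norm u \<le> 2 * Re (csqrt u) ^ 2"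
proof -
  note csqrt.simps [simp del]
  define a b where "a = Re (csqrt u)" and "b = Im (csqrt u)"
  have a0: "a \<ge> 0"
    unfolding a_def using csqrt_principal[of u] by (auto simp del: csqrt.simps)
  have sq: "csqrt u ^ 2 = u" by simp
  have w: "csqrt u = Complex a b" by (simp only: a_def b_def complex_surj)
  have Ru: "Re u = a^2 - b^2" and Iu: "Im u = 2 * a * b"
    using sq unfolding w by (auto simp: power2_eq_square complex_eq_iff)
  \<comment> \<open>For the root, the sector condition |arg u| <= pi/4 reads 2a|b| <= a^2 - b^2. It
    yields |b| <= a/2, slightly weaker than |b| <= a tan(pi/8) but enough for a^2 - 3b^2 >=
    a^2/4.\<close>
  have h: "2 * a * \<bar>b\<bar> \<le> a^2 - b^2"
    using assms a0 unfolding Ru Iu by (simp add: abs_mult)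
  have b: "\<bar>b\<bar> \<le> a / 2"
  proof (rule ccontr)
    assume n: "\<not> \<bar>b\<bar> \<le> a / 2"
    have "b^2 \<ge> (a/2)^2"
      using n a0 by (intro abs_le_square_iff[THEN iffD1]) auto
    moreover have "2 * a * \<bar>b\<bar> \<ge> 2 * a * (a/2)"
      using n a0 by (intro mult_left_mono) auto
    ultimately have "a^2 + (a/2)^2 \<le> a^2"
      using h by (simp add: power2_eq_square)
    hence "a^2 \<le> 0" by (simp add: power_divide)
    hence "a = 0" by simp
    thus False using n h by auto
  qed
  have b2: "b^2 \<le> (a/2)^2"
    using b a0 by (intro abs_le_square_iff[THEN iffD1]) auto
  have "Re (csqrt u ^ 3) = a * (a^2 - 3 * b^2)"
    unfolding w by (simp add: power3_eq_cube power2_eq_square algebra_simps)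
  also have "\<dots> \<ge> a * (a^2 / 4)"
    using b2 a0 by (intro mult_left_mono) (auto simp: power2_eq_square)
  finally show "Re (csqrt u ^ 3) \<ge> Re (csqrt u) ^ 3 / 4"
    by (simp add: a_def power3_eq_cube power2_eq_square)
  have "norm u = norm (csqrt u) ^ 2" by (metis sq norm_power)
  also have "\<dots> = a^2 + b^2" unfolding w by (simp add: cmod_power2)
  also have "\<dots> \<le> 2 * a^2" 
  proof -
    have "4 * b^2 \<le> a^2" using b2 by (simp add: power_divide)
    thus ?thesis using zero_le_power2[of a] by linarith
  qed
  finally show "norm u \<le> 2 * Re (csqrt u) ^ 2" by (simp add: a_def)
qed

text \<open>The damping factor is exp(-d u^(3/2)): the exponent 3/2 beats growth of order 1 and
  stays below the critical order 2 of a quadrant, so the real part of u^(3/2) remains positive. The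
  maximum principle on a quarter disc bounds the damped function; then d tends to 0.\<close>

lemma phragmen_lindelof_quadrant:
  fixes f :: "complex \<Rightarrow> complex"
  assumes hol: "f holomorphic_on {z. 0 \<le> Re z \<and> 0 \<le> Im z}"
    and growth: "\<And>z. 0 \<le> Re z \<Longrightarrow> 0 \<le> Im z \<Longrightarrow> norm (f z) \<le> C * exp (A * norm z)"
    and A: "0 < A" and M: "0 < M"
    and edge: "\<And>z. 0 \<le> Re z \<Longrightarrow> 0 \<le> Im z \<Longrightarrow> Re z = 0 \<or> Im z = 0 \<Longrightarrow> norm (f z) \<le> M"
    and z0: "0 \<le> Re z0" "0 \<le> Im z0"
  shows "norm (f z0) \<le> M"
proof -
  note csqrt.simps [simp del]
  define Q where "Q = {z::complex. 0 \<le> Re z \<and> 0 \<le> Im z}"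
  \<comment> \<open>Rotation by -pi/4 centres the quadrant on the positive real axis; the shift by 1
    keeps it off the branch cut of the square root.\<close>
  define u where "u z = cis (- (pi / 4)) * z + 1" for z
  have u_eq: "Re (u z) = sqrt 2 / 2 * (Re z + Im z) + 1" "Im (u z) = sqrt 2 / 2 * (Im z - Re z)" for z
    by (auto simp: u_def cos_45 sin_45 algebra_simps add_divide_distrib diff_divide_distrib)
  have uQ: "\<bar>Im (u z)\<bar> \<le> Re (u z) \<and> Re (u z) \<ge> 1" if "z \<in> Q" for z
  proof -
    have "\<bar>Im z - Re z\<bar> \<le> Re z + Im z" using that by (auto simp: Q_def)
    hence "sqrt 2 / 2 * \<bar>Im z - Re z\<bar> \<le> sqrt 2 / 2 * (Re z + Im z)"
      by (intro mult_left_mono) auto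
    hence "\<bar>sqrt 2 / 2 * (Im z - Re z)\<bar> \<le> sqrt 2 / 2 * (Re z + Im z)" by (simp add: abs_mult)
    moreover have "0 \<le> sqrt 2 / 2 * (Re z + Im z)" using that by (simp add: Q_def)
    ultimately show ?thesis unfolding u_eq by linarith
  qed
  have nu: "norm z \<le> norm (u z) + 1" for z
  proof -
    have "norm z = norm (u z - 1)" by (simp add: u_def norm_mult)
    also have "\<dots> \<le> norm (u z) + 1" using norm_triangle_ineq4[of "u z" 1] by simp
    finally show ?thesis .
  qed
  have C0: "C \<ge> 0"
    using growth[of 0] by (simp add: order_trans[OF norm_ge_zero])
  have main: "norm (f z0) * exp (- (d * Re (csqrt (u z0) ^ 3))) \<le> M" if d: "d > 0" for d
  proof -
    define g where "g z = f z * exp (- (of_real d * csqrt (u z) ^ 3))" for z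
    have ng: "norm (g z) = norm (f z) * exp (- (d * Re (csqrt (u z) ^ 3)))" for z
      by (simp add: g_def norm_mult)
    have ngle: "norm (g z) \<le> norm (f z) * exp (- (d * (Re (csqrt (u z)) ^ 3 / 4)))" if "z \<in> Q" for z
      unfolding ng using Re_csqrt_cube_ge(1)[of "u z"] uQ[OF that] d
      by (intro mult_left_mono) auto
    \<comment> \<open>On the arc the damped function is at most (C+1) exp(A(2a^2 + 1) - d a^3/4),
      with a the real part of the root of u; this is at most M once the exponent is below -l.
      \<open>a0\<close> is a threshold for a. Taking C + 1 keeps the logarithm meaningful when C =
      0.\<close>
    define l where "l = ln ((C + 1) / M)"
    define a0 where "a0 = max 1 (4 / d * (3 * A + \<bar>l\<bar>))"
    have a0: "d * (a ^ 3 / 4) - A * (2 * a ^ 2 + 1) \<ge> l" if a: "a \<ge> a0" for a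
    proof -
      have "a \<ge> 1" "4 / d * (3 * A + \<bar>l\<bar>) \<le> a" using a by (auto simp: a0_def)
      hence da: "3 * A + \<bar>l\<bar> \<le> d * a / 4" using d by (simp add: field_simps)
      have a2: "1 \<le> a ^ 2" using \<open>a \<ge> 1\<close> by simp
      have "l \<le> 1 * \<bar>l\<bar>" by simp
      also have "\<dots> \<le> a ^ 2 * \<bar>l\<bar>" using a2 by (intro mult_right_mono) auto
      also have "\<dots> \<le> a ^ 2 * (d * a / 4 - 3 * A)" using da by (intro mult_left_mono) auto
      also have "\<dots> = d * (a ^ 3 / 4) - A * (2 * a ^ 2 + a ^ 2)"
        by (simp add: algebra_simps power3_eq_cube power2_eq_square)
      also have "\<dots> \<le> d * (a ^ 3 / 4) - A * (2 * a ^ 2 + 1)"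
        using a2 A by (intro diff_left_mono mult_left_mono) auto
      finally show ?thesis .
    qed
    \<comment> \<open>Since norm z <= 2a^2 + 1, a point with norm z = R has a >=
      \<open>a0\<close>.\<close>
    define R where "R = max (norm z0) (2 * (max a0 0) ^ 2 + 1)"
    have big: "norm (g z) \<le> M" if z: "z \<in> Q" and nz: "norm z = R" for z
    proof -
      define a where "a = Re (csqrt (u z))"
      have apos: "a \<ge> 0" unfolding a_def using csqrt_principal[of "u z"] by (auto simp del: csqrt.simps)
      have za: "norm z \<le> 2 * a ^ 2 + 1"
        using nu[of z] Re_csqrt_cube_ge(2)[of "u z"] uQ[OF z] by (simp add: a_def)
      have "2 * (max a0 0) ^ 2 + 1 \<le> 2 * a ^ 2 + 1" using za nz R_def by linarith
      hence "max a0 0 \<le> a" using apos by (simp add: power2_le_iff_abs_le)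
      hence ge: "d * (a ^ 3 / 4) - A * (2 * a ^ 2 + 1) \<ge> ln ((C + 1) / M)" using a0 by (auto simp: l_def)
      have "norm (g z) \<le> norm (f z) * exp (- (d * (a ^ 3 / 4)))"
        using ngle[OF z] by (simp add: a_def)
      also have "\<dots> \<le> (C * exp (A * norm z)) * exp (- (d * (a ^ 3 / 4)))"
        using z growth by (intro mult_right_mono) (auto simp: Q_def)
      also have "\<dots> \<le> ((C + 1) * exp (A * (2 * a ^ 2 + 1))) * exp (- (d * (a ^ 3 / 4)))"
        using za A C0 by (intro mult_right_mono mult_mono) auto
      also have "\<dots> = (C + 1) * exp (- (d * (a ^ 3 / 4) - A * (2 * a ^ 2 + 1)))"
        by (simp add: exp_diff exp_minus field_simps flip: exp_add)
      also have "\<dots> \<le> (C + 1) * exp (- ln ((C + 1) / M))"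
        using ge C0 by (intro mult_left_mono) auto
      also have "\<dots> = M"
        using C0 M by (simp add: exp_minus)
      finally show ?thesis .
    qed
    define S where "S = Q \<inter> cball 0 R"
    have clS: "closed S"
      unfolding S_def Q_def by (intro closed_Int closed_Collect_conj closed_Collect_le continuous_intros) auto
    have holS: "g holomorphic_on Q"
      unfolding g_def u_def
    proof (intro holomorphic_intros)
      show "f holomorphic_on Q" using hol by (simp add: Q_def)
      fix z assume "z \<in> Q"
      from uQ[OF this] show "cis (- (pi / 4)) * z + 1 \<notin> \<real>\<^sub>\<le>\<^sub>0"
        by (auto simp: u_def complex_nonpos_Reals_iff)
    qed
    have "norm (g z0) \<le> M"
    proof (rule maximum_modulus_frontier[of g S])
      show "g holomorphic_on interior S"
        using holS by (rule holomorphic_on_subset) (use interior_subset[of S] in \<open>auto simp: S_def\<close>)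
      show "continuous_on (closure S) g"
        using holS clS by (auto intro!: holomorphic_on_imp_continuous_on holomorphic_on_subset[OF holS] simp: S_def)
      show "bounded S" unfolding S_def by (intro bounded_Int) auto
      show "z0 \<in> S" using z0 by (auto simp: S_def Q_def R_def)
      fix z assume zf: "z \<in> frontier S"
      hence zS: "z \<in> S" using clS frontier_subset_eq by blast
      have "open {z::complex. 0 < Re z \<and> 0 < Im z \<and> norm z < R}"
        by (intro open_Collect_conj open_Collect_less continuous_intros)
      moreover have "{z::complex. 0 < Re z \<and> 0 < Im z \<and> norm z < R} \<subseteq> S"
        by (auto simp: S_def Q_def)
      ultimately have "{z::complex. 0 < Re z \<and> 0 < Im z \<and> norm z < R} \<subseteq> interior S"
        by (rule interior_maximal[rotated])
      hence "\<not> (0 < Re z \<and> 0 < Im z \<and> norm z < R)" using zf by (auto simp: frontier_def)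
      then consider "Re z = 0 \<or> Im z = 0" | "norm z = R" using zS by (force simp: S_def Q_def)
      thus "norm (g z) \<le> M"
      proof cases
        case 1
        have zQ: "z \<in> Q" using zS by (simp add: S_def)
        have "norm (g z) \<le> norm (f z) * exp (- (d * (Re (csqrt (u z)) ^ 3 / 4)))" by (rule ngle[OF zQ])
        also have "\<dots> \<le> M * 1"
          using 1 zQ edge[of z] M d csqrt_principal[of "u z"]
          by (intro mult_mono) (auto simp: Q_def zero_le_mult_iff)
        finally show ?thesis by simp
      qed (use big zS S_def in auto)
    qed
    thus ?thesis by (simp add: ng)
  qed
  have "((\<lambda>d. norm (f z0) * exp (- (d * Re (csqrt (u z0) ^ 3)))) \<longlongrightarrow> norm (f z0) * exp (- (0 * Re (csqrt (u z0) ^ 3)))) (at_right 0)"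
    by (intro tendsto_intros)
  moreover have "eventually (\<lambda>d. norm (f z0) * exp (- (d * Re (csqrt (u z0) ^ 3))) \<le> M) (at_right 0)"
    using main by (auto simp: eventually_at_right_field intro!: exI[of _ 1])
  ultimately show ?thesis
    by (intro tendsto_upperbound[of _ "norm (f z0)" "at_right 0"]) auto
qed

text \<open>Division by 1 - i d z, whose modulus in the upper half-plane is at least 1 and at least
  d |z|, makes the quotient at most M on large arcs. The maximum principle on a half disc applies,
  and d tends to 0.\<close>

lemma bounded_halfplane_max_modulus:
  fixes f :: "complex \<Rightarrow> complex"
  assumes hol: "f holomorphic_on {z. 0 \<le> Im z}"
    and bdd: "\<And>z. 0 \<le> Im z \<Longrightarrow> norm (f z) \<le> B"
    and M: "0 < M" and real_le: "\<And>x. norm (f (of_real x)) \<le> M"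
    and z0: "0 \<le> Im z0"
  shows "norm (f z0) \<le> M"
proof -
  have ge1: "norm (1 - \<i> * of_real d * z) \<ge> max 1 (d * norm z)" if "d > 0" "0 \<le> Im z" for d z
  proof -
    have "norm (1 - \<i> * of_real d * z) ^ 2 = (1 + d * Im z) ^ 2 + (d * Re z) ^ 2"
      by (simp add: cmod_power2)
    also have "\<dots> = 1 + 2 * (d * Im z) + (d * norm z) ^ 2"
      unfolding power_mult_distrib cmod_power2 by (simp add: power2_eq_square algebra_simps)
    finally have eq: "norm (1 - \<i> * of_real d * z) ^ 2 = 1 + 2 * (d * Im z) + (d * norm z) ^ 2" .
    have nn: "0 \<le> d * Im z" using that by simp
    have "1 ^ 2 \<le> norm (1 - \<i> * of_real d * z) ^ 2"
      and "(d * norm z) ^ 2 \<le> norm (1 - \<i> * of_real d * z) ^ 2"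
      unfolding eq using nn by auto
    hence "1 \<le> norm (1 - \<i> * of_real d * z)" "d * norm z \<le> norm (1 - \<i> * of_real d * z)"
      by (metis norm_ge_zero power2_le_imp_le)+
    thus ?thesis by simp
  qed
  have main: "norm (f z0) \<le> M * norm (1 - \<i> * of_real d * z0)" if d: "d > 0" for d
  proof -
    define g where "g z = f z / (1 - \<i> * of_real d * z)" for z
    have nz: "1 - \<i> * of_real d * z \<noteq> 0" if "0 \<le> Im z" for z
      using ge1[OF d that] by auto
    define R where "R = max (norm z0) (B / (M * d))"
    define S where "S = {z. 0 \<le> Im z} \<inter> cball 0 R"
    have clS: "closed S"
      unfolding S_def by (intro closed_Int closed_Collect_le continuous_intros) auto
    have holS: "g holomorphic_on {z. 0 \<le> Im z}"
      unfolding g_def using hol nz by (intro holomorphic_intros) auto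
    have "norm (g z0) \<le> M"
    proof (rule maximum_modulus_frontier[of g S])
      show "g holomorphic_on interior S"
        using holS by (rule holomorphic_on_subset) (use interior_subset[of S] in \<open>auto simp: S_def\<close>)
      show "continuous_on (closure S) g"
        using holS clS by (auto intro!: holomorphic_on_imp_continuous_on holomorphic_on_subset[OF holS] simp: S_def)
      show "bounded S" unfolding S_def by (intro bounded_Int) auto
      show "z0 \<in> S" using z0 by (auto simp: S_def R_def)
      fix z assume zf: "z \<in> frontier S"
      hence zS: "z \<in> S" using clS frontier_subset_eq by blast
      have "open {z::complex. 0 < Im z \<and> norm z < R}"
        by (intro open_Collect_conj open_Collect_less continuous_intros)
      moreover have "{z::complex. 0 < Im z \<and> norm z < R} \<subseteq> S"
        by (auto simp: S_def)
      ultimately have "{z::complex. 0 < Im z \<and> norm z < R} \<subseteq> interior S"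
        by (rule interior_maximal[rotated])
      hence "\<not> (0 < Im z \<and> norm z < R)" using zf by (auto simp: frontier_def)
      then consider "Im z = 0" | "norm z = R" using zS by (force simp: S_def)
      thus "norm (g z) \<le> M"
      proof cases
        case 1
        hence "norm (f z) \<le> M" using real_le[of "Re z"] by (simp add: complex_is_Real_iff)
        moreover have "norm (1 - \<i> * of_real d * z) \<ge> 1" using ge1[OF d, of z] 1 by auto
        ultimately have "norm (f z) / norm (1 - \<i> * of_real d * z) \<le> M / 1"
          using M by (intro frac_le) auto
        thus ?thesis by (simp add: g_def norm_divide)
      next
        case 2
        have Im: "0 \<le> Im z" using zS by (simp add: S_def)
        have pos: "0 < norm (1 - \<i> * of_real d * z)" using ge1[OF d Im] by linarith
        have "norm (f z) \<le> B" by (rule bdd[OF Im])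
        also have "B = M * (d * (B / (M * d)))" using M d by simp
        also have "\<dots> \<le> M * (d * norm z)"
          using 2 M d by (intro mult_left_mono) (auto simp: R_def)
        also have "\<dots> \<le> M * norm (1 - \<i> * of_real d * z)"
          using ge1[OF d Im] M by (intro mult_left_mono) auto
        finally show ?thesis using pos by (simp add: g_def norm_divide field_simps)
      qed
    qed
    thus ?thesis using nz[OF z0] by (simp add: g_def norm_divide field_simps)
  qed
  have "((\<lambda>d. M * norm (1 - \<i> * of_real d * z0)) \<longlongrightarrow> M * norm (1 - \<i> * of_real 0 * z0)) (at_right 0)"
    by (intro tendsto_intros)
  moreover have "eventually (\<lambda>d. norm (f z0) \<le> M * norm (1 - \<i> * of_real d * z0)) (at_right 0)"
    using main by (auto simp: eventually_at_right_field intro!: exI[of _ 1])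
  ultimately show ?thesis
    by (intro tendsto_lowerbound[of _ M "at_right 0"]) auto
qed

text \<open>The factor exp(i (tau + e) z) has modulus 1 on the real axis and cancels the growth on
  the positive imaginary axis. Each of the two quadrants then has bounded edges, so the product is
  bounded and the bounded case sharpens the constant to M.\<close>

lemma phragmen_lindelof_halfplane:
  fixes f :: "complex \<Rightarrow> complex"
  assumes hol: "f holomorphic_on {z. 0 \<le> Im z}"
    and growth: "\<And>e. e > 0 \<Longrightarrow> \<exists>C. \<forall>z. 0 \<le> Im z \<longrightarrow> norm (f z) \<le> C * exp ((\<tau> + e) * norm z)"
    and tau: "0 \<le> \<tau>" and M: "0 < M"
    and real_le: "\<And>x. norm (f (of_real x)) \<le> M"
    and z0: "0 \<le> Im z0"
  shows "norm (f z0) \<le> M * exp (\<tau> * Im z0)"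
proof -
  have main: "norm (f z0) \<le> M * exp ((\<tau> + e) * Im z0)" if e: "e > 0" for e
  proof -
    obtain C where C: "\<And>z. 0 \<le> Im z \<Longrightarrow> norm (f z) \<le> C * exp ((\<tau> + e) * norm z)"
      using growth[OF e] by blast
    define h where "h z = f z * exp (\<i> * of_real (\<tau> + e) * z)" for z
    have nh: "norm (h z) = norm (f z) * exp (- ((\<tau> + e) * Im z))" for z
      by (simp add: h_def norm_mult)
    have C0: "C \<ge> 0"
      using C[of 0] by (simp add: order_trans[OF norm_ge_zero])
    have holh: "h holomorphic_on {z. 0 \<le> Im z}"
      unfolding h_def using hol by (intro holomorphic_intros)
    have hgrowth: "norm (h z) \<le> C * exp ((\<tau> + e) * norm z)" if "0 \<le> Im z" for z
    proof -
      have "norm (h z) \<le> norm (f z) * 1"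
        unfolding nh using that e tau by (intro mult_left_mono) auto
      thus ?thesis using C[OF that] by simp
    qed
    \<comment> \<open>\<open>B\<close> may depend on e: it only has to be finite, as it is replaced
      by \<open>M\<close> afterwards.\<close>
    define B where "B = max M C"
    have hreal: "norm (h (of_real x)) \<le> M" for x
      using real_le[of x] by (simp add: nh)
    have himag: "norm (h z) \<le> B" if "0 \<le> Im z" "Re z = 0 \<or> Im z = 0" for z
    proof (cases "Im z = 0")
      case True
      thus ?thesis using hreal[of "Re z"] by (auto simp: B_def complex_is_Real_iff)
    next
      case False
      hence "norm z = Im z" using that by (auto simp: cmod_def)
      hence "norm (h z) \<le> (C * exp ((\<tau> + e) * Im z)) * exp (- ((\<tau> + e) * Im z))"
        unfolding nh using C[OF that(1)] by (intro mult_right_mono) auto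
      also have "\<dots> = C" by (simp add: exp_minus)
      finally show ?thesis by (simp add: B_def)
    qed
    have Bpos: "B > 0" using M by (simp add: B_def)
    have hB: "norm (h z) \<le> B" if z: "0 \<le> Im z" for z
    proof (cases "0 \<le> Re z")
      case True
      show ?thesis
        by (rule phragmen_lindelof_quadrant[of h C "\<tau> + e" B z])
          (use True z tau e Bpos hgrowth himag in \<open>auto intro: holomorphic_on_subset[OF holh]\<close>)
    next
      case False
      \<comment> \<open>Multiplication by i carries the first quadrant to the second.\<close>
      have "norm ((h \<circ> (\<lambda>z. \<i> * z)) (- \<i> * z)) \<le> B"
      proof (rule phragmen_lindelof_quadrant[of "h \<circ> (\<lambda>z. \<i> * z)" C "\<tau> + e" B "- \<i> * z"])
        show "(h \<circ> (\<lambda>z. \<i> * z)) holomorphic_on {z. 0 \<le> Re z \<and> 0 \<le> Im z}"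
          by (intro holomorphic_on_compose_gen[OF _ holh] holomorphic_intros) auto
        show "norm ((h \<circ> (\<lambda>z. \<i> * z)) w) \<le> C * exp ((\<tau> + e) * norm w)" if "0 \<le> Re w" for w
          using hgrowth[of "\<i> * w"] that by (simp add: norm_mult)
        show "norm ((h \<circ> (\<lambda>z. \<i> * z)) w) \<le> B" if "0 \<le> Re w" "Re w = 0 \<or> Im w = 0" for w
          using himag[of "\<i> * w"] that by auto
      qed (use False z tau e Bpos in auto)
      thus ?thesis by (simp flip: mult.assoc)
    qed
    have "norm (h z0) \<le> M"
      by (rule bounded_halfplane_max_modulus[OF holh hB M hreal z0])
    hence "norm (f z0) * exp (- ((\<tau> + e) * Im z0)) * exp ((\<tau> + e) * Im z0) \<le> M * exp ((\<tau> + e) * Im z0)"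
      unfolding nh by (intro mult_right_mono) auto
    thus ?thesis by (simp only: mult.assoc exp_add[symmetric]) simp
  qed
  have "((\<lambda>e. M * exp ((\<tau> + e) * Im z0)) \<longlongrightarrow> M * exp ((\<tau> + 0) * Im z0)) (at_right 0)"
    by (intro tendsto_intros)
  moreover have "eventually (\<lambda>e. norm (f z0) \<le> M * exp ((\<tau> + e) * Im z0)) (at_right 0)"
    using main by (auto simp: eventually_at_right_field intro!: exI[of _ 1])
  ultimately show ?thesis
    by (intro tendsto_lowerbound[of _ "M * exp (\<tau> * Im z0)" "at_right 0"]) auto
qed

subsection \<open>Pointwise bounds in the weighted space\<close>

text \<open>The lower bound is quadratic at 0 and constant at infinity, so that it covers 1 - sin(2
  pi x)/(2 pi x). The upper bound 2 makes plain square integrability imply weighted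
  integrability.\<close>

locale even_weight =
  fixes W :: "real \<Rightarrow> real" and \<kappa> :: real
  assumes W_measurable [measurable]: "W \<in> borel_measurable borel"
    and W_even: "W (- x) = W x"
    and W_le: "W x \<le> 2"
    and kappa_pos: "0 < \<kappa>"
    and W_ge: "\<kappa> * (x\<^sup>2 / (1 + x\<^sup>2)) \<le> W x"
begin

lemma W_nonneg: "0 \<le> W x"
  using W_ge[of x] kappa_pos by (smt (verit) divide_nonneg_nonneg mult_nonneg_nonneg zero_le_power2)

definition sqnorm :: "(complex \<Rightarrow> complex) \<Rightarrow> real" where
  "sqnorm F = (LINT x|lborel. (norm (F (of_real x)))\<^sup>2 * W x)"

text \<open>
  Averaging over unit intervals turns the \<open>L\<^sup>2\<close> bound on the real line into a pointwise one. The
  extra factor \<open>z\<close> compensates for a possible zero of \<open>W\<close> at the origin.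
\<close>

lemma average_growth:
  fixes g :: "real \<Rightarrow> complex"
  assumes F: "F \<in> HSpace W \<tau>" "sqnorm F \<le> 1" and tau: "0 \<le> \<tau>"
    and holI: "I holomorphic_on UNIV"
    and I: "\<And>z. ((\<lambda>t. g t * ((z + of_real t) * F (z + of_real t))) has_integral I z) {0..1}"
    and g: "\<And>t. t \<in> {0..1} \<Longrightarrow> norm (g t) \<le> 1"
    and z: "0 \<le> Im z"
  shows "norm (I z) \<le> 2 * (1 + 1 / \<kappa>) * norm (z + 2 * \<i>) * exp (\<tau> * Im z)"
proof -
  define \<psi> where "\<psi> x = (norm (F (of_real x)))\<^sup>2 * W x" for x
  have int: "integrable lborel \<psi>" using F(1) by (simp add: HSpace_def \<psi>_def[abs_def])
  have psi0: "\<psi> x \<ge> 0" for x by (simp add: \<psi>_def W_nonneg)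
  have ge: "norm (w + 2 * \<i>) \<ge> norm w \<and> norm (w + 2 * \<i>) \<ge> 2" if "0 \<le> Im w" for w
  proof -
    have "norm (w + 2 * \<i>) ^ 2 = norm w ^ 2 + 4 * Im w + 4"
      unfolding cmod_power2 by (simp add: power2_eq_square algebra_simps)
    hence "norm w ^ 2 \<le> norm (w + 2 * \<i>) ^ 2" "2 ^ 2 \<le> norm (w + 2 * \<i>) ^ 2" using that by auto
    thus ?thesis by (metis norm_ge_zero power2_le_imp_le)
  qed
  have real_bd: "norm (I (of_real x)) \<le> (2 + \<bar>x\<bar>) * (1 + 1 / \<kappa>)" for x
  proof -
    have intx: "integrable lborel (\<lambda>t. \<psi> (x + 1 * t))"
      using int by (rule lborel_integrable_real_affine) auto
    have eqx: "(LINT t|lborel. \<psi> (x + 1 * t)) = (LINT t|lborel. \<psi> t)"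
      using lborel_integral_real_affine[of 1 \<psi> x] by simp
    have hi: "((\<lambda>t. \<psi> (x + t)) has_integral (LINT t|lborel. \<psi> t)) UNIV"
      using has_integral_integral_lborel[OF intx] eqx by simp
    have on01: "(\<lambda>t. \<psi> (x + t)) integrable_on {0..1}"
      using hi integrable_on_subcbox[of "\<lambda>t. \<psi> (x + t)" UNIV 0 1] by auto
    have le1: "integral {0..1} (\<lambda>t. \<psi> (x + t)) \<le> 1"
    proof -
      have "integral {0..1} (\<lambda>t. \<psi> (x + t)) \<le> integral UNIV (\<lambda>t. \<psi> (x + t))"
        using hi on01 psi0 by (intro integral_subset_le) auto
      also have "\<dots> = (LINT t|lborel. \<psi> t)" using hi by (rule integral_unique)
      also have "\<dots> \<le> 1" using F(2) by (simp add: sqnorm_def \<psi>_def)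
      finally show ?thesis .
    qed
    have rhs: "((\<lambda>t. (2 + \<bar>x\<bar>) * (1 + \<psi> (x + t) / \<kappa>)) has_integral
        (2 + \<bar>x\<bar>) * (1 + integral {0..1} (\<lambda>t. \<psi> (x + t)) / \<kappa>)) {0..1}"
      using has_integral_const_real[of "1::real" 0 1]
      by (intro has_integral_mult_right has_integral_add has_integral_divide integrable_integral[OF on01]) auto
    have "norm (I (of_real x)) = norm (integral {0..1} (\<lambda>t. g t * ((of_real x + of_real t) * F (of_real x + of_real t))))"
      using integral_unique[OF I[of "of_real x"]] by simp
    also have "\<dots> \<le> integral {0..1} (\<lambda>t. (2 + \<bar>x\<bar>) * (1 + \<psi> (x + t) / \<kappa>))"
    proof (rule integral_norm_bound_integral)
      show "(\<lambda>t. g t * ((of_real x + of_real t) * F (of_real x + of_real t))) integrable_on {0..1}"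
        using I[of "of_real x"] by auto
      show "(\<lambda>t. (2 + \<bar>x\<bar>) * (1 + \<psi> (x + t) / \<kappa>)) integrable_on {0..1}" using rhs by auto
      fix t :: real assume t: "t \<in> {0..1}"
      define y where "y = x + t"
      \<comment> \<open>The weight bound turns y^2 |F(y)|^2 / (1 + y^2) into \<psi> y / \<kappa>,
        and a <= 1 + a^2 passes from the square to the first power. The divisor 2 + |x| dominates
        the root of 1 + y^2 for all y in [x, x + 1].\<close>
      define a where "a = \<bar>y\<bar> * norm (F (of_real y)) / (2 + \<bar>x\<bar>)"
      have "1 + y\<^sup>2 \<le> (2 + \<bar>x\<bar>)\<^sup>2"
      proof -
        have "\<bar>y\<bar> \<le> 1 + \<bar>x\<bar>" using t by (auto simp: y_def)
        hence "y\<^sup>2 \<le> (1 + \<bar>x\<bar>)\<^sup>2" by (intro abs_le_square_iff[THEN iffD1]) auto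
        thus ?thesis by (simp add: power2_eq_square algebra_simps)
      qed
      hence "a\<^sup>2 \<le> y\<^sup>2 * (norm (F (of_real y)))\<^sup>2 / (1 + y\<^sup>2)"
        unfolding a_def power_divide power_mult_distrib
        by (simp add: power2_eq_square) (intro divide_left_mono, auto intro!: mult_pos_pos add_pos_nonneg)
      also have "\<dots> = (norm (F (of_real y)))\<^sup>2 * (\<kappa> * (y\<^sup>2 / (1 + y\<^sup>2))) / \<kappa>" using kappa_pos by simp
      also have "\<dots> \<le> \<psi> y / \<kappa>"
        unfolding \<psi>_def using W_ge[of y] kappa_pos by (intro divide_right_mono mult_left_mono) auto
      finally have a2: "a\<^sup>2 \<le> \<psi> y / \<kappa>" .
      have "a \<le> 1 + a\<^sup>2"
        using sum_squares_ge_zero[of "a - 1/2" 0] by (simp add: power2_eq_square algebra_simps)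
      hence "a \<le> 1 + \<psi> y / \<kappa>" using a2 by linarith
      hence "\<bar>y\<bar> * norm (F (of_real y)) \<le> (2 + \<bar>x\<bar>) * (1 + \<psi> y / \<kappa>)"
        unfolding a_def by (simp add: pos_divide_le_eq mult.commute)
      moreover have "norm (g t * ((of_real x + of_real t) * F (of_real x + of_real t)))
          \<le> 1 * (\<bar>y\<bar> * norm (F (of_real y)))"
        using mult_right_mono[OF g[OF t], of "\<bar>y\<bar> * norm (F (of_real y))"]
        by (simp add: norm_mult y_def flip: of_real_add)
      ultimately show "norm (g t * ((of_real x + of_real t) * F (of_real x + of_real t)))
          \<le> (2 + \<bar>x\<bar>) * (1 + \<psi> (x + t) / \<kappa>)" by (simp add: y_def)
    qed
    also have "\<dots> = (2 + \<bar>x\<bar>) * (1 + integral {0..1} (\<lambda>t. \<psi> (x + t)) / \<kappa>)"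
      using rhs by (rule integral_unique)
    also have "\<dots> \<le> (2 + \<bar>x\<bar>) * (1 + 1 / \<kappa>)"
      using le1 kappa_pos by (intro mult_left_mono add_left_mono divide_right_mono) auto
    finally show ?thesis .
  qed
  \<comment> \<open>The divisor w + 2i removes the linear growth on the real line and has no zero in
    the closed half-plane.\<close>
  define f where "f w = I w / (w + 2 * \<i>)" for w
  have nz: "w + 2 * \<i> \<noteq> 0" if "0 \<le> Im w" for w using ge[OF that] by auto
  have "norm (f z) \<le> 2 * (1 + 1 / \<kappa>) * exp (\<tau> * Im z)"
  proof (rule phragmen_lindelof_halfplane[OF _ _ tau _ _ z])
    show "f holomorphic_on {z. 0 \<le> Im z}"
      unfolding f_def using nz by (intro holomorphic_intros holomorphic_on_subset[OF holI]) auto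
    show "0 < 2 * (1 + 1 / \<kappa>)" using kappa_pos by (simp add: add_pos_pos)
    show "norm (f (of_real x)) \<le> 2 * (1 + 1 / \<kappa>)" for x
    proof -
      have "norm (I (of_real x)) \<le> (2 + \<bar>x\<bar>) * (1 + 1 / \<kappa>)" by (rule real_bd)
      also have "\<dots> \<le> (2 * norm (of_real x + 2 * \<i>)) * (1 + 1 / \<kappa>)"
        using ge[of "of_real x"] kappa_pos by (intro mult_right_mono) auto
      finally show ?thesis
        using nz[of "of_real x"] by (simp add: f_def norm_divide pos_divide_le_eq algebra_simps)
    qed
    fix e :: real assume e: "e > 0"
    then obtain C where C: "\<And>z. norm (F z) \<le> C * exp ((\<tau> + e) * norm z)"
      using F(1) by (auto simp: HSpace_def exp_type_le_def)
    have C0: "C \<ge> 0" using C[of 0] by (simp add: order_trans[OF norm_ge_zero])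
    have "norm (f w) \<le> (2 * C * exp (\<tau> + e)) * exp ((\<tau> + e) * norm w)" if w: "0 \<le> Im w" for w
    proof -
      define B where "B = (norm w + 1) * (C * exp ((\<tau> + e) * (norm w + 1)))"
      have B0: "B \<ge> 0" using C0 by (simp add: B_def)
      have "norm (I w) \<le> B * measure lborel (cbox (0::real) 1)"
      proof (rule has_integral_bound[OF B0])
        show "((\<lambda>t. g t * ((w + of_real t) * F (w + of_real t))) has_integral I w) (cbox 0 1)"
          using I[of w] by simp
        fix t :: real assume "t \<in> cbox 0 1"
        hence t: "t \<in> {0..1}" by simp
        have nwt: "norm (w + of_real t) \<le> norm w + 1"
          using norm_triangle_ineq[of w "of_real t"] t by simp
        have "norm (F (w + of_real t)) \<le> C * exp ((\<tau> + e) * norm (w + of_real t))" by (rule C)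
        also have "\<dots> \<le> C * exp ((\<tau> + e) * (norm w + 1))"
          using nwt C0 tau e by (intro mult_left_mono) auto
        finally have "norm (g t) * (norm (w + of_real t) * norm (F (w + of_real t))) \<le> 1 * B"
          unfolding B_def using g[OF t] nwt C0 by (intro mult_mono) auto
        thus "norm (g t * ((w + of_real t) * F (w + of_real t))) \<le> B" by (simp add: norm_mult)
      qed
      hence "norm (I w) \<le> B" by simp
      also have "B \<le> (2 * norm (w + 2 * \<i>)) * (C * exp ((\<tau> + e) * (norm w + 1)))"
        unfolding B_def using ge[OF w] C0 by (intro mult_right_mono) auto
      finally show ?thesis
        using nz[OF w] by (simp add: f_def norm_divide pos_divide_le_eq algebra_simps exp_add)
    qed
    thus "\<exists>C. \<forall>z. 0 \<le> Im z \<longrightarrow> norm (f z) \<le> C * exp ((\<tau> + e) * norm z)" by blast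
  qed
  thus ?thesis
    using nz[OF z] by (simp add: f_def norm_divide pos_divide_le_eq algebra_simps)
qed


lemma HSpace_reflect:
  assumes "F \<in> HSpace W \<tau>"
  shows "(\<lambda>z. F (- z)) \<in> HSpace W \<tau>" "sqnorm (\<lambda>z. F (- z)) = sqnorm F"
proof -
  have "integrable lborel (\<lambda>x. (norm (F (of_real x)))\<^sup>2 * W x)" using assms by (simp add: HSpace_def)
  from lborel_integrable_real_affine[OF this, of "-1" 0]
  have int: "integrable lborel (\<lambda>x. (norm (F (- of_real x)))\<^sup>2 * W x)" by (simp add: W_even)
  have "((\<lambda>z. F z) \<circ> uminus) holomorphic_on UNIV"
    using assms by (intro holomorphic_on_compose_gen[where t = UNIV] holomorphic_intros) (auto simp: HSpace_def)
  moreover have "exp_type_le (\<lambda>z. F (- z)) \<tau>"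
    unfolding exp_type_le_def
  proof safe
    fix e :: real assume "e > 0"
    then obtain C where C: "\<And>z. norm (F z) \<le> C * exp ((\<tau> + e) * norm z)"
      using assms by (auto simp: HSpace_def exp_type_le_def)
    have "norm (F (- z)) \<le> C * exp ((\<tau> + e) * norm z)" for z using C[of "- z"] by simp
    thus "\<exists>C. \<forall>z. norm (F (- z)) \<le> C * exp ((\<tau> + e) * norm z)" by blast
  qed
  ultimately show "(\<lambda>z. F (- z)) \<in> HSpace W \<tau>" using int by (simp add: HSpace_def o_def)
  show "sqnorm (\<lambda>z. F (- z)) = sqnorm F"
    unfolding sqnorm_def
    using lborel_integral_real_affine[of "-1" "\<lambda>x. (norm (F (of_real x)))\<^sup>2 * W x" 0] by (simp add: W_even)
qed

text \<open>Averages of h = z F are under control, h itself is not. Two averages with different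
  weights allow h to be recovered from one of them and the derivative of the other, which Cauchy's
  inequality bounds. Its unit circle must stay in the upper half-plane, hence 1 <= Im z, and it
  costs a factor exp tau.\<close>

lemma HSpace_upper_bound:
  assumes F: "F \<in> HSpace W \<tau>" "sqnorm F \<le> 1" and tau: "0 \<le> \<tau>" and z: "1 \<le> Im z"
  shows "norm (F z) \<le> 16 * (1 + 1 / \<kappa>) * exp \<tau> * exp (\<tau> * Im z)"
proof -
  define h where "h z = z * F z" for z
  have holh: "h holomorphic_on UNIV"
    using F(1) unfolding h_def HSpace_def by (auto intro!: holomorphic_intros)
  obtain P where P: "\<And>x. (P has_field_derivative h x) (at x)"
    using holomorphic_convex_primitive'[OF convex_UNIV open_UNIV holh] by auto
  have holP: "P holomorphic_on UNIV" using P by (auto simp: holomorphic_on_def field_differentiable_def)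
  obtain Q where Q: "\<And>x. (Q has_field_derivative P x) (at x)"
    using holomorphic_convex_primitive'[OF convex_UNIV open_UNIV holP] by auto
  have P': "(P has_field_derivative h (x + of_real t)) (at (x + of_real t))"
   and Q': "(Q has_field_derivative P (x + of_real t)) (at (x + of_real t))" for x t by (rule P Q)+
  have Pt: "((\<lambda>t. P (x + of_real t)) has_vector_derivative h (x + of_real t)) (at t within S)" for x t S
    using field_vector_diff_chain_within[of "\<lambda>t. x + of_real t" 1 t S P "h (x + of_real t)"]
      has_field_derivative_at_within[OF P'] by (force intro!: derivative_eq_intros simp: o_def)
  have Qt: "((\<lambda>t. Q (x + of_real t)) has_vector_derivative P (x + of_real t)) (at t within S)" for x t S
    using field_vector_diff_chain_within[of "\<lambda>t. x + of_real t" 1 t S Q "P (x + of_real t)"]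
      has_field_derivative_at_within[OF Q'] by (force intro!: derivative_eq_intros simp: o_def)
  \<comment> \<open>\<open>G1\<close> and \<open>G0\<close> are the averages of \<open>h\<close> with weights \<open>1\<close> and \<open>1 - t\<close>, and \<open>h = G1 - G0'\<close>.\<close>
  define G1 where "G1 z = P (z + 1) - P z" for z
  define G0 where "G0 z = Q (z + 1) - (P z + Q z)" for z
  have I1: "((\<lambda>t. 1 * ((w + of_real t) * F (w + of_real t))) has_integral G1 w) {0..1}" for w
    using fundamental_theorem_of_calculus[of 0 1 "\<lambda>t. P (w + of_real t)" "\<lambda>t. h (w + of_real t)"] Pt
    by (simp add: G1_def h_def)
  have I0: "((\<lambda>t. of_real (1 - t) * ((w + of_real t) * F (w + of_real t))) has_integral G0 w) {0..1}" for w
  proof -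
    have "((\<lambda>t. of_real (1 - t) * P (w + of_real t) + Q (w + of_real t)) has_vector_derivative
        of_real (1 - t) * h (w + of_real t)) (at t within {0..1})" for t
      by (rule derivative_eq_intros Pt Qt refl has_vector_derivative_of_real | simp)+
    from fundamental_theorem_of_calculus[of 0 1, OF _ this] show ?thesis
      by (simp add: G0_def h_def)
  qed
  have QS: "((\<lambda>z. Q (z + 1)) has_field_derivative P (x + 1)) (at x)"
   and PS: "((\<lambda>z. P (z + 1)) has_field_derivative h (x + 1)) (at x)" for x
    using Q P by (simp_all flip: DERIV_shift)
  have dG0: "(G0 has_field_derivative (G1 x - h x)) (at x)" for x
    unfolding G0_def G1_def by (rule derivative_eq_intros QS Q P | simp)+
  have holG0: "G0 holomorphic_on UNIV"
    using dG0 by (auto simp: holomorphic_on_def field_differentiable_def)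
  have dG1: "(G1 has_field_derivative (h (x + 1) - h x)) (at x)" for x
    unfolding G1_def by (rule derivative_eq_intros PS P | simp)+
  have holG1: "G1 holomorphic_on UNIV"
    using dG1 by (auto simp: holomorphic_on_def field_differentiable_def)
  define K where "K = 2 * (1 + 1 / \<kappa>)"
  have Kpos: "K > 0" using kappa_pos by (simp add: K_def add_pos_pos)
  have b1: "norm (G1 w) \<le> K * norm (w + 2 * \<i>) * exp (\<tau> * Im w)" if "0 \<le> Im w" for w
    unfolding K_def by (rule average_growth[OF F tau holG1 I1 _ that]) auto
  have b0: "norm (G0 w) \<le> K * norm (w + 2 * \<i>) * exp (\<tau> * Im w)" if "0 \<le> Im w" for w
    unfolding K_def by (rule average_growth[OF F tau holG0 I0 _ that]) (auto simp del: of_real_diff)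
  define B where "B = K * (norm z + 3) * exp (\<tau> * (Im z + 1))"
  have bB: "K * norm (w + 2 * \<i>) * exp (\<tau> * Im w) \<le> B" if "norm (z - w) \<le> 1" for w
  proof -
    have "Im w \<le> Im z + 1" using abs_Im_le_cmod[of "z - w"] that by auto
    moreover have "norm (w + 2 * \<i>) \<le> norm z + 3"
    proof -
      have "norm (w + 2 * \<i>) \<le> norm w + 2" using norm_triangle_ineq[of w "2 * \<i>"] by (simp add: norm_mult)
      moreover have "norm w \<le> norm z + 1" using norm_triangle_ineq2[of w z] that by (simp add: norm_minus_commute)
      ultimately show ?thesis by simp
    qed
    ultimately show ?thesis unfolding B_def using Kpos tau by (intro mult_mono) (auto intro: mult_left_mono)
  qed
  have "norm ((deriv ^^ 1) G0 z) \<le> fact 1 * B / 1 ^ 1"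
  proof (rule Cauchy_inequality)
    fix w assume w: "norm (z - w) = 1"
    hence "0 \<le> Im w" using abs_Im_le_cmod[of "z - w"] z by auto
    thus "norm (G0 w) \<le> B" using b0[of w] bB[of w] w by linarith
  qed (auto intro!: holomorphic_on_imp_continuous_on holomorphic_on_subset[OF holG0])
  hence "norm (G1 z - h z) \<le> B" using DERIV_imp_deriv[OF dG0] by simp
  moreover have "norm (G1 z) \<le> B" using b1[of z] bB[of z] z by auto
  ultimately have hB: "norm (h z) \<le> 2 * B" using norm_triangle_ineq4[of "G1 z" "G1 z - h z"] by simp
  have nz1: "1 \<le> norm z" using abs_Im_le_cmod[of z] z by linarith
  have "norm z * norm (F z) \<le> 2 * K * (norm z + 3) * exp (\<tau> * (Im z + 1))"
    using hB by (simp add: h_def B_def norm_mult algebra_simps)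
  \<comment> \<open>Here 1 <= norm z absorbs the 3 and then permits the division by norm z. The 16
    of the bound is the product of this 4, the 2 of 2B and the 2 in \<open>K\<close>.\<close>
  also have "\<dots> \<le> 2 * K * (4 * norm z) * exp (\<tau> * (Im z + 1))"
    using nz1 Kpos by (intro mult_right_mono mult_left_mono) auto
  also have "\<dots> = norm z * (8 * K * exp (\<tau> * (Im z + 1)))" by simp
  finally have "norm (F z) \<le> 8 * K * exp (\<tau> * (Im z + 1))"
    using nz1 by (auto simp: mult_le_cancel_left)
  thus ?thesis by (simp add: K_def algebra_simps exp_add)
qed

lemma HSpace_scale:
  assumes "F \<in> HSpace W \<tau>"
  shows "(\<lambda>z. a * F z) \<in> HSpace W \<tau>" "sqnorm (\<lambda>z. a * F z) = (norm a)\<^sup>2 * sqnorm F"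
proof -
  have "exp_type_le (\<lambda>z. a * F z) \<tau>"
    unfolding exp_type_le_def
  proof safe
    fix e :: real assume "e > 0"
    then obtain C where "\<And>z. norm (F z) \<le> C * exp ((\<tau> + e) * norm z)"
      using assms by (auto simp: HSpace_def exp_type_le_def)
    hence "norm (a * F z) \<le> (norm a * C) * exp ((\<tau> + e) * norm z)" for z
      unfolding norm_mult mult.assoc by (intro mult_left_mono) auto
    thus "\<exists>C. \<forall>z. norm (a * F z) \<le> C * exp ((\<tau> + e) * norm z)" by blast
  qed
  thus "(\<lambda>z. a * F z) \<in> HSpace W \<tau>"
    using assms by (auto simp: HSpace_def norm_mult power_mult_distrib mult.assoc intro!: holomorphic_intros)
  show "sqnorm (\<lambda>z. a * F z) = (norm a)\<^sup>2 * sqnorm F"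
    by (simp add: sqnorm_def norm_mult power_mult_distrib mult.assoc)
qed

text \<open>The constant of the pointwise bound. Of its three factors exp tau, one comes from the
  Cauchy circle, one from evaluation at height 1 and one from shifting the half-plane by i.\<close>

definition evbound :: "real \<Rightarrow> real" where
  "evbound \<tau> = 16 * (1 + 1 / \<kappa>) * exp (3 * \<tau>)"

lemma evbound_pos: "0 < evbound \<tau>"
  using kappa_pos by (simp add: evbound_def add_pos_pos)

text \<open>The previous lemma leaves out Im z < 1, which includes the real line. Reflection gives
  its bound at Im z = -1, and the Phragmen-Lindelof principle carries it upwards across the
  strip.\<close>

lemma HSpace_unit_bound:
  assumes F: "F \<in> HSpace W \<tau>" "sqnorm F \<le> 1" and tau: "0 \<le> \<tau>"
  shows "norm (F z) \<le> evbound \<tau> * exp (\<tau> * \<bar>Im z\<bar>)"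
proof -
  define M where "M = 16 * (1 + 1 / \<kappa>) * exp \<tau> * exp \<tau>"
  have Mpos: "M > 0" using kappa_pos by (simp add: M_def add_pos_pos)
  \<comment> \<open>The previous bound on the line \<open>Im z = -1\<close> serves as boundary value for the half-plane above it.\<close>
  have half: "norm (G w) \<le> M * exp (\<tau> * (Im w + 1))"
    if G: "G \<in> HSpace W \<tau>" "sqnorm G \<le> 1" and w: "0 \<le> Im w" for G w
  proof -
    have "norm ((\<lambda>v. G (v - \<i>)) (w + \<i>)) \<le> M * exp (\<tau> * Im (w + \<i>))"
    proof (rule phragmen_lindelof_halfplane[OF _ _ tau Mpos])
      have "(G \<circ> (\<lambda>v. v - \<i>)) holomorphic_on {z. 0 \<le> Im z}"
        using G by (intro holomorphic_on_compose_gen[where t = UNIV] holomorphic_intros) (auto simp: HSpace_def)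
      thus "(\<lambda>v. G (v - \<i>)) holomorphic_on {z. 0 \<le> Im z}" by (simp add: o_def)
      show "norm (G (of_real x - \<i>)) \<le> M" for x
        using HSpace_upper_bound[OF HSpace_reflect(1)[OF G(1)] _ tau, of "- of_real x + \<i>"] G
        by (simp add: HSpace_reflect(2) M_def)
      fix e :: real assume e: "e > 0"
      then obtain C where C: "\<And>z. norm (G z) \<le> C * exp ((\<tau> + e) * norm z)"
        using G by (auto simp: HSpace_def exp_type_le_def)
      have C0: "C \<ge> 0" using C[of 0] by (simp add: order_trans[OF norm_ge_zero])
      have "norm (G (v - \<i>)) \<le> (C * exp (\<tau> + e)) * exp ((\<tau> + e) * norm v)" for v
      proof -
        have "norm (G (v - \<i>)) \<le> C * exp ((\<tau> + e) * norm (v - \<i>))" by (rule C)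
        also have "\<dots> \<le> C * exp ((\<tau> + e) * (norm v + 1))"
          using norm_triangle_ineq4[of v \<i>] C0 tau e by (intro mult_left_mono) auto
        finally show ?thesis by (simp add: algebra_simps exp_add)
      qed
      thus "\<exists>C. \<forall>z. 0 \<le> Im z \<longrightarrow> norm (G (z - \<i>)) \<le> C * exp ((\<tau> + e) * norm z)" by blast
    qed (use w in auto)
    thus ?thesis by simp
  qed
  have eq: "M * exp (\<tau> * (y + 1)) = evbound \<tau> * exp (\<tau> * y)" for y
  proof -
    have "exp \<tau> * exp \<tau> * exp (\<tau> * (y + 1)) = exp (3 * \<tau>) * exp (\<tau> * y)"
      unfolding exp_add[symmetric] by (simp add: algebra_simps)
    thus ?thesis by (simp add: M_def evbound_def mult.assoc)
  qed
  show ?thesis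
  proof (cases "0 \<le> Im z")
    case True
    thus ?thesis using half[OF F, of z] by (simp add: eq)
  next
    case False
    thus ?thesis using half[OF HSpace_reflect(1)[OF F(1)], of "-z"] F eq[of "- Im z"] by (simp add: HSpace_reflect(2))
  qed
qed

lemma HSpace_bound:
  assumes F: "F \<in> HSpace W \<tau>" "sqnorm F \<le> s\<^sup>2" and s: "0 < s" and tau: "0 \<le> \<tau>"
  shows "norm (F z) \<le> evbound \<tau> * s * exp (\<tau> * \<bar>Im z\<bar>)"
proof -
  have "sqnorm (\<lambda>z. of_real (1 / s) * F z) = (1 / s)\<^sup>2 * sqnorm F"
    using HSpace_scale(2)[OF F(1), of "of_real (1 / s)"] s by (simp add: norm_divide)
  also have "\<dots> \<le> (1 / s)\<^sup>2 * s\<^sup>2" using F(2) by (intro mult_left_mono) auto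
  also have "\<dots> = 1" using s by (simp add: power_divide)
  finally have "norm (of_real (1 / s) * F z) \<le> evbound \<tau> * exp (\<tau> * \<bar>Im z\<bar>)"
    by (intro HSpace_unit_bound HSpace_scale F tau)
  thus ?thesis using s by (simp add: norm_mult norm_divide field_simps)
qed

end

subsection \<open>The reproducing kernel\<close>

lemma exp_type_leI:
  assumes "\<And>z. norm (F z) \<le> C * exp (\<tau> * \<bar>Im z\<bar>)" "0 \<le> \<tau>"
  shows "exp_type_le F \<tau>"
  unfolding exp_type_le_def
proof safe
  fix e :: real assume e: "e > 0"
  have C0: "C \<ge> 0" using assms(1)[of 0] by (simp add: order_trans[OF norm_ge_zero])
  have "norm (F z) \<le> C * exp ((\<tau> + e) * norm z)" for z
  proof -
    have "\<tau> * \<bar>Im z\<bar> \<le> (\<tau> + e) * norm z"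
      using e assms(2) abs_Im_le_cmod[of z] by (intro mult_mono) auto
    hence "C * exp (\<tau> * \<bar>Im z\<bar>) \<le> C * exp ((\<tau> + e) * norm z)"
      using C0 by (intro mult_left_mono) auto
    thus ?thesis using assms(1)[of z] by linarith
  qed
  thus "\<exists>C. \<forall>z. norm (F z) \<le> C * exp ((\<tau> + e) * norm z)" by blast
qed

lemma HSpace_continuous:
  assumes "F \<in> HSpace W \<tau>"
  shows "continuous_on S (\<lambda>x. F (of_real x))"
proof -
  have "continuous_on UNIV F" using assms by (auto simp: HSpace_def intro: holomorphic_on_imp_continuous_on)
  thus ?thesis by (rule continuous_on_compose2) (auto intro: continuous_intros)
qed

lemma HSpace_measurable:
  "F \<in> HSpace W \<tau> \<Longrightarrow> (\<lambda>x. F (of_real x)) \<in> borel_measurable borel"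
  using HSpace_continuous by (intro borel_measurable_continuous_onI) auto

context even_weight begin

text \<open>Spelled exactly like the integral in \<open>repkernel\<close>, so that the two are
  identified by unfolding.\<close>

definition ip :: "(complex \<Rightarrow> complex) \<Rightarrow> (complex \<Rightarrow> complex) \<Rightarrow> complex" where
  "ip F G = (LINT x|lborel. F (of_real x) * cnj (G (of_real x)) * of_real (W x))"

lemma sqnorm_nonneg: "0 \<le> sqnorm F"
  unfolding sqnorm_def by (intro integral_nonneg_AE) (auto simp: W_nonneg)

lemma ip_integrable:
  assumes F: "F \<in> HSpace W \<tau>" and G: "G \<in> HSpace W \<tau>'"
  shows "integrable lborel (\<lambda>x. F (of_real x) * cnj (G (of_real x)) * of_real (W x))"
proof (rule Bochner_Integration.integrable_bound)
  show "integrable lborel (\<lambda>x. (norm (F (of_real x)))\<^sup>2 * W x + (norm (G (of_real x)))\<^sup>2 * W x)"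
    using F G by (auto simp: HSpace_def)
  note [measurable] = HSpace_measurable[OF F]
  have [measurable]: "(\<lambda>x. cnj (G (of_real x))) \<in> borel_measurable borel"
    by (intro borel_measurable_continuous_onI continuous_on_cnj HSpace_continuous[OF G])
  have [measurable]: "(\<lambda>x. complex_of_real (W x)) \<in> borel_measurable borel"
    by (rule measurable_compose[OF W_measurable])
      (intro borel_measurable_continuous_onI continuous_intros)
  show "(\<lambda>x. F (of_real x) * cnj (G (of_real x)) * of_real (W x)) \<in> borel_measurable lborel"
    by measurable
  have "norm (F (of_real x)) * norm (G (of_real x)) * W x \<le> (norm (F (of_real x)))\<^sup>2 * W x + (norm (G (of_real x)))\<^sup>2 * W x" for x
  proof -
    have "norm (F (of_real x)) * norm (G (of_real x)) \<le> (norm (F (of_real x)))\<^sup>2 + (norm (G (of_real x)))\<^sup>2"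
      using sum_squares_bound[of "norm (F (of_real x))" "norm (G (of_real x))"]
        mult_nonneg_nonneg[OF norm_ge_zero norm_ge_zero, of "F (of_real x)" "G (of_real x)"] by argo
    from mult_right_mono[OF this W_nonneg[of x]] show ?thesis by (simp add: algebra_simps)
  qed
  thus "AE x in lborel. norm (F (of_real x) * cnj (G (of_real x)) * of_real (W x))
      \<le> norm ((norm (F (of_real x)))\<^sup>2 * W x + (norm (G (of_real x)))\<^sup>2 * W x)"
    by (intro AE_I2) (auto simp: norm_mult W_nonneg)
qed

lemma ip_self: "F \<in> HSpace W \<tau> \<Longrightarrow> ip F F = of_real (sqnorm F)"
  unfolding ip_def sqnorm_def
  by (simp flip: complex_norm_square of_real_mult of_real_power)

lemma ip_scale_left: "ip (\<lambda>z. a * F z) G = a * ip F G"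
  by (simp add: ip_def mult.assoc)

lemma ip_scale_right: "ip F (\<lambda>z. a * G z) = cnj a * ip F G"
proof -
  have "ip F (\<lambda>z. a * G z) = (LINT x|lborel. cnj a * (F (of_real x) * cnj (G (of_real x)) * of_real (W x)))"
    unfolding ip_def by (intro Bochner_Integration.integral_cong) auto
  thus ?thesis by (simp add: ip_def)
qed

lemma ip_add_left:
  assumes "F \<in> HSpace W \<tau>" "G \<in> HSpace W \<tau>" "K \<in> HSpace W \<tau>"
  shows "ip (\<lambda>z. F z + G z) K = ip F K + ip G K"
  using assms unfolding ip_def
  by (simp add: ring_distribs ip_integrable Bochner_Integration.integral_add)

lemma ip_cnj: "cnj (ip F G) = ip G F"
proof -
  have "cnj (ip F G) = (LINT x|lborel. cnj (F (of_real x) * cnj (G (of_real x)) * of_real (W x)))"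
    unfolding ip_def by (rule Bochner_Integration.integral_cnj[symmetric])
  also have "\<dots> = ip G F" unfolding ip_def by (intro Bochner_Integration.integral_cong) auto
  finally show ?thesis .
qed

lemma HSpace_add:
  assumes F: "F \<in> HSpace W \<tau>" and G: "G \<in> HSpace W \<tau>"
  shows "(\<lambda>z. F z + G z) \<in> HSpace W \<tau>"
    "sqnorm (\<lambda>z. F z + G z) = sqnorm F + 2 * Re (ip F G) + sqnorm G"
proof -
  have alg: "(norm (a + b))\<^sup>2 * v = (norm a)\<^sup>2 * v + 2 * Re (a * cnj b * of_real v) + (norm b)\<^sup>2 * v"
    for a b :: complex and v :: real
    unfolding cmod_power2 by (simp add: power2_eq_square algebra_simps)
  have eq: "(norm (F (of_real x) + G (of_real x)))\<^sup>2 * W x =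
      (norm (F (of_real x)))\<^sup>2 * W x + 2 * Re (F (of_real x) * cnj (G (of_real x)) * of_real (W x))
      + (norm (G (of_real x)))\<^sup>2 * W x" for x
    by (rule alg)
  have intF: "integrable lborel (\<lambda>x. (norm (F (of_real x)))\<^sup>2 * W x)"
    and intG: "integrable lborel (\<lambda>x. (norm (G (of_real x)))\<^sup>2 * W x)"
    using F G by (auto simp: HSpace_def)
  note intFG = ip_integrable[OF F G]
  have intRe: "integrable lborel (\<lambda>x. 2 * Re (F (of_real x) * cnj (G (of_real x)) * of_real (W x)))"
    by (rule integrable_mult_right, rule integrable_Re[OF intFG])
  have "exp_type_le (\<lambda>z. F z + G z) \<tau>"
    unfolding exp_type_le_def
  proof safe
    fix e :: real assume e: "e > 0"
    obtain C where C: "\<And>z. norm (F z) \<le> C * exp ((\<tau> + e) * norm z)"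
      using F e by (auto simp: HSpace_def exp_type_le_def)
    obtain D where D: "\<And>z. norm (G z) \<le> D * exp ((\<tau> + e) * norm z)"
      using G e by (auto simp: HSpace_def exp_type_le_def)
    have "norm (F z + G z) \<le> (C + D) * exp ((\<tau> + e) * norm z)" for z
      using norm_triangle_mono[OF C[of z] D[of z]] by (simp add: ring_distribs)
    thus "\<exists>C. \<forall>z. norm (F z + G z) \<le> C * exp ((\<tau> + e) * norm z)" by blast
  qed
  moreover have "integrable lborel (\<lambda>x. (norm (F (of_real x) + G (of_real x)))\<^sup>2 * W x)"
    unfolding eq using intF intG intRe by auto
  ultimately show "(\<lambda>z. F z + G z) \<in> HSpace W \<tau>"
    using F G by (auto simp: HSpace_def intro!: holomorphic_intros)
  have "sqnorm (\<lambda>z. F z + G z) = sqnorm F + (LINT x|lborel. 2 * Re (F (of_real x) * cnj (G (of_real x)) * of_real (W x))) + sqnorm G"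
    unfolding sqnorm_def eq using intF intG intRe by simp
  also have "(LINT x|lborel. 2 * Re (F (of_real x) * cnj (G (of_real x)) * of_real (W x))) = 2 * Re (ip F G)"
    unfolding ip_def using integral_Re[OF intFG] by (simp only: integral_mult_right_zero)
  finally show "sqnorm (\<lambda>z. F z + G z) = sqnorm F + 2 * Re (ip F G) + sqnorm G" .
qed

lemma HSpace_diff:
  assumes F: "F \<in> HSpace W \<tau>" and G: "G \<in> HSpace W \<tau>"
  shows "(\<lambda>z. F z - G z) \<in> HSpace W \<tau>"
    "sqnorm (\<lambda>z. F z - G z) = sqnorm F - 2 * Re (ip F G) + sqnorm G"
  using HSpace_add[OF F HSpace_scale(1)[OF G, of "-1"]] HSpace_scale(2)[OF G, of "-1"] ip_scale_right[of F "-1" G]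
  by auto

text \<open>Definiteness follows by letting s tend to 0 in the pointwise bound; no passage through
  almost everywhere vanishing is made.\<close>

lemma HSpace_eq_0:
  assumes F: "F \<in> HSpace W \<tau>" and "sqnorm F = 0" and tau: "0 \<le> \<tau>"
  shows "F z = 0"
proof -
  have "eventually (\<lambda>s. norm (F z) \<le> evbound \<tau> * s * exp (\<tau> * \<bar>Im z\<bar>)) (at_right 0)"
    using HSpace_bound[OF F _ _ tau] assms(2) by (auto simp: eventually_at_right_field intro!: exI[of _ 1])
  moreover have "((\<lambda>s. evbound \<tau> * s * exp (\<tau> * \<bar>Im z\<bar>)) \<longlongrightarrow> evbound \<tau> * 0 * exp (\<tau> * \<bar>Im z\<bar>)) (at_right 0)"
    by (intro tendsto_intros)
  ultimately have "norm (F z) \<le> 0"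
    by (intro tendsto_lowerbound[of _ 0 "at_right 0"]) auto
  thus ?thesis by simp
qed

text \<open>The pointwise bound turns a norm-Cauchy sequence into a locally uniformly Cauchy one, so
  the limit is entire and inherits the exponential bound. Fatou's lemma gives its integrability and
  the inequality for the norm, which is all that a minimising sequence requires.\<close>

lemma HSpace_cauchy_limit:
  assumes X: "\<And>n. X n \<in> HSpace W \<tau>" and tau: "0 \<le> \<tau>"
    and cauchy: "\<And>e. e > 0 \<Longrightarrow> \<exists>N. \<forall>m\<ge>N. \<forall>n\<ge>N. sqnorm (\<lambda>z. X m z - X n z) \<le> e\<^sup>2"
    and lim: "(\<lambda>n. sqnorm (X n)) \<longlonglongrightarrow> d"
  obtains F where "F \<in> HSpace W \<tau>" "\<And>z. (\<lambda>n. X n z) \<longlonglongrightarrow> F z" "sqnorm F \<le> d"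
proof -
  define F where "F z = lim (\<lambda>n. X n z)" for z
  have unif: "uniform_limit (cball 0 R) X F sequentially" for R
  proof -
    have "uniformly_Cauchy_on (cball 0 R) X"
      unfolding uniformly_Cauchy_on_def
    proof (intro allI impI)
      fix e :: real assume e: "e > 0"
      define c where "c = evbound \<tau> * exp (\<tau> * \<bar>R\<bar>)"
      have c: "c > 0" using evbound_pos by (simp add: c_def)
      obtain N where N: "\<And>m n. m \<ge> N \<Longrightarrow> n \<ge> N \<Longrightarrow> sqnorm (\<lambda>z. X m z - X n z) \<le> (e / (2 * c))\<^sup>2"
        using cauchy[of "e / (2 * c)"] e c by auto
      have "dist (X m z) (X n z) < e" if z: "z \<in> cball 0 R" and m: "m \<ge> N" and n: "n \<ge> N" for z m n
      proof -
        have "norm (X m z - X n z) \<le> evbound \<tau> * (e / (2 * c)) * exp (\<tau> * \<bar>Im z\<bar>)"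
          using e c tau by (intro HSpace_bound HSpace_diff X N m n) auto
        also have "\<dots> \<le> evbound \<tau> * (e / (2 * c)) * exp (\<tau> * \<bar>R\<bar>)"
          using e c tau evbound_pos[of \<tau>] z abs_Im_le_cmod[of z]
          by (intro mult_left_mono exp_le_cancel_iff[THEN iffD2]) auto
        also have "\<dots> = c * (e / (2 * c))" by (simp add: c_def)
        also have "\<dots> = e / 2" using c by simp
        also have "\<dots> < e" using e by simp
        finally show ?thesis by (simp add: dist_norm)
      qed
      thus "\<exists>M. \<forall>x\<in>cball 0 R. \<forall>m\<ge>M. \<forall>n\<ge>M. dist (X m x) (X n x) < e" by blast
    qed
    hence "uniformly_convergent_on (cball 0 R) X" by (rule Cauchy_uniformly_convergent)
    thus ?thesis unfolding uniformly_convergent_uniform_limit_iff F_def[abs_def] .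
  qed
  have ptw: "(\<lambda>n. X n z) \<longlonglongrightarrow> F z" for z
    using tendsto_uniform_limitI[OF unif[of "norm z"], of z] by simp
  have hol: "F holomorphic_on UNIV"
  proof (rule holomorphic_uniform_sequence[OF open_UNIV])
    show "X n holomorphic_on UNIV" for n using X by (simp add: HSpace_def)
    fix x :: complex
    have "cball x 1 \<subseteq> cball 0 (norm x + 1)" by (auto simp: dist_norm) (metis add.commute add_le_cancel_left norm_minus_commute norm_triangle_sub order_trans)
    hence "uniform_limit (cball x 1) X F sequentially" using unif uniform_limit_on_subset by blast
    thus "\<exists>d. 0 < d \<and> cball x d \<subseteq> UNIV \<and> uniform_limit (cball x d) X F sequentially"
      by (intro exI[of _ 1]) auto
  qed
  obtain B where B: "\<And>n. norm (sqnorm (X n)) \<le> B"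
    using convergent_imp_Bseq[OF convergentI[OF lim]] by (auto simp: Bseq_def)
  define s where "s = B + 1"
  have s: "s > 0" "sqnorm (X n) \<le> s\<^sup>2" for n
  proof -
    have B0: "0 \<le> B" using B[of 0] by (smt (verit) norm_ge_zero)
    thus "s > 0" by (simp add: s_def)
    have "sqnorm (X n) \<le> B" using B[of n] by simp
    also have "B \<le> s\<^sup>2" using B0 by (simp add: s_def power2_eq_square algebra_simps)
    finally show "sqnorm (X n) \<le> s\<^sup>2" .
  qed
  have bd: "norm (F z) \<le> (evbound \<tau> * s) * exp (\<tau> * \<bar>Im z\<bar>)" for z
  proof (rule tendsto_upperbound)
    show "(\<lambda>n. norm (X n z)) \<longlonglongrightarrow> norm (F z)" by (intro tendsto_norm ptw)
    show "\<forall>\<^sub>F n in sequentially. norm (X n z) \<le> evbound \<tau> * s * exp (\<tau> * \<bar>Im z\<bar>)"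
      using HSpace_bound[OF X s(2) s(1) tau] by simp
  qed auto
  have [measurable]: "(\<lambda>x. X n (of_real x)) \<in> borel_measurable borel" for n
    by (rule HSpace_measurable[OF X])
  have [measurable]: "(\<lambda>x. F (of_real x)) \<in> borel_measurable borel"
    by (rule borel_measurable_LIMSEQ_metric[OF _ ptw]) auto
  have "(\<integral>\<^sup>+x. ennreal ((norm (F (of_real x)))\<^sup>2 * W x) \<partial>lborel)
      = (\<integral>\<^sup>+x. liminf (\<lambda>n. ennreal ((norm (X n (of_real x)))\<^sup>2 * W x)) \<partial>lborel)"
  proof (intro nn_integral_cong)
    fix x :: real
    have "(\<lambda>n. ennreal ((norm (X n (of_real x)))\<^sup>2 * W x)) \<longlonglongrightarrow> ennreal ((norm (F (of_real x)))\<^sup>2 * W x)"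
      by (intro tendsto_ennrealI tendsto_intros ptw)
    thus "ennreal ((norm (F (of_real x)))\<^sup>2 * W x) = liminf (\<lambda>n. ennreal ((norm (X n (of_real x)))\<^sup>2 * W x))"
      using lim_imp_Liminf[OF sequentially_bot] by metis
  qed
  also have "\<dots> \<le> liminf (\<lambda>n. \<integral>\<^sup>+x. ennreal ((norm (X n (of_real x)))\<^sup>2 * W x) \<partial>lborel)"
    by (intro nn_integral_liminf) auto
  also have "(\<lambda>n. \<integral>\<^sup>+x. ennreal ((norm (X n (of_real x)))\<^sup>2 * W x) \<partial>lborel) = (\<lambda>n. ennreal (sqnorm (X n)))"
    unfolding sqnorm_def using X
    by (intro ext nn_integral_eq_integral) (auto simp: HSpace_def W_nonneg)
  also have "liminf (\<lambda>n. ennreal (sqnorm (X n))) = ennreal d"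
    by (intro lim_imp_Liminf tendsto_ennrealI lim) auto
  finally have le: "(\<integral>\<^sup>+x. ennreal ((norm (F (of_real x)))\<^sup>2 * W x) \<partial>lborel) \<le> ennreal d" .
  have d0: "d \<ge> 0" by (rule LIMSEQ_le_const[OF lim]) (auto simp: sqnorm_nonneg)
  have int: "integrable lborel (\<lambda>x. (norm (F (of_real x)))\<^sup>2 * W x)"
    using le by (intro integrableI_nonneg) (auto simp: W_nonneg intro: le_less_trans)
  have "sqnorm F \<le> d"
    unfolding sqnorm_def using le d0
    by (subst integral_eq_nn_integral) (auto simp: W_nonneg intro!: enn2real_leI)
  moreover have "F \<in> HSpace W \<tau>"
    using hol int exp_type_leI[OF bd tau] by (simp add: HSpace_def)
  ultimately show thesis using that ptw by blast
qed


lemma HSpace_zero: "(\<lambda>z. 0) \<in> HSpace W \<tau>"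
  by (auto simp: HSpace_def exp_type_le_def intro!: exI[of _ 0])

section \<open>Riesz representation of point evaluations\<close>

text \<open>The set of functions with value 1 at w is convex, so midpoints have squared norm at
  least the infimum d. By the parallelogram law every minimising sequence is then Cauchy.\<close>

lemma minimal_norm_exists:
  assumes tau: "0 \<le> \<tau>" and F1: "F1 \<in> HSpace W \<tau>" "F1 w \<noteq> 0"
  obtains F where "F \<in> HSpace W \<tau>" "F w = 1"
    "\<And>G. G \<in> HSpace W \<tau> \<Longrightarrow> G w = 1 \<Longrightarrow> sqnorm F \<le> sqnorm G"
proof -
  define S where "S = {F \<in> HSpace W \<tau>. F w = 1}"
  define d where "d = Inf (sqnorm ` S)"
  have ne: "S \<noteq> {}"
  proof -
    have "(\<lambda>z. (1 / F1 w) * F1 z) \<in> S"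
      using HSpace_scale(1)[OF F1(1), of "1 / F1 w"] F1(2) by (simp add: S_def)
    thus ?thesis by blast
  qed
  have bdd: "bdd_below (sqnorm ` S)" by (rule bdd_belowI[of _ 0]) (auto simp: sqnorm_nonneg)
  have dle: "d \<le> sqnorm G" if "G \<in> S" for G
    unfolding d_def using that bdd by (intro cInf_lower) auto
  have "\<exists>G\<in>S. sqnorm G < d + 1 / real (Suc n)" for n
    using cInf_lessD[of "sqnorm ` S" "d + 1 / real (Suc n)"] ne by (auto simp: d_def)
  then obtain X where X: "\<And>n. X n \<in> S" "\<And>n. sqnorm (X n) < d + 1 / real (Suc n)" by metis
  have par: "sqnorm (\<lambda>z. G z - K z) \<le> 2 * (sqnorm G - d) + 2 * (sqnorm K - d)" if "G \<in> S" "K \<in> S" for G K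
  proof -
    have GK: "G \<in> HSpace W \<tau>" "K \<in> HSpace W \<tau>" using that by (auto simp: S_def)
    have "(\<lambda>z. (1/2) * (G z + K z)) \<in> S"
      using that HSpace_scale(1)[OF HSpace_add(1)[OF GK], of "1/2"] by (simp add: S_def)
    from dle[OF this] have "4 * d \<le> sqnorm (\<lambda>z. G z + K z)"
      using HSpace_scale(2)[OF HSpace_add(1)[OF GK], of "1/2"] by (simp add: power2_eq_square norm_divide)
    thus ?thesis using HSpace_add(2)[OF GK] HSpace_diff(2)[OF GK] by simp
  qed
  have lim: "(\<lambda>n. sqnorm (X n)) \<longlonglongrightarrow> d"
  proof (rule tendsto_sandwich)
    show "\<forall>\<^sub>F n in sequentially. d \<le> sqnorm (X n)" using dle X(1) by simp
    show "\<forall>\<^sub>F n in sequentially. sqnorm (X n) \<le> d + 1 / real (Suc n)"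
      using X(2) by (simp add: less_imp_le)
    show "(\<lambda>n. d + 1 / real (Suc n)) \<longlonglongrightarrow> d"
      using tendsto_add[OF tendsto_const[of d] LIMSEQ_inverse_real_of_nat] by (simp add: inverse_eq_divide)
  qed auto
  have cauchy: "\<exists>N. \<forall>m\<ge>N. \<forall>n\<ge>N. sqnorm (\<lambda>z. X m z - X n z) \<le> e\<^sup>2" if e: "e > 0" for e
  proof -
    have "e\<^sup>2 / 4 > 0" using e by simp
    then obtain N where N: "\<And>n. n \<ge> N \<Longrightarrow> \<bar>sqnorm (X n) - d\<bar> < e\<^sup>2 / 4"
      using lim unfolding LIMSEQ_iff real_norm_def by meson
    have N': "4 * (sqnorm (X n) - d) \<le> e\<^sup>2" if "n \<ge> N" for n
      using le_less_trans[OF abs_ge_self N[OF that]] by simp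
    have "sqnorm (\<lambda>z. X m z - X n z) \<le> e\<^sup>2" if "m \<ge> N" "n \<ge> N" for m n
      using par[OF X(1)[of m] X(1)[of n]] N'[OF that(1)] N'[OF that(2)] by argo
    thus ?thesis by blast
  qed
  have XH: "X n \<in> HSpace W \<tau>" for n using X(1) by (auto simp: S_def)
  obtain F where F: "F \<in> HSpace W \<tau>" "\<And>z. (\<lambda>n. X n z) \<longlonglongrightarrow> F z" "sqnorm F \<le> d"
    using HSpace_cauchy_limit[OF XH tau cauchy lim] by blast
  have "X n w = 1" for n using X(1)[of n] by (simp add: S_def)
  hence "F w = 1" using F(2)[of w] by (simp add: LIMSEQ_const_iff)
  moreover have "sqnorm F \<le> sqnorm G" if "G \<in> HSpace W \<tau>" "G w = 1" for G
    using dle[of G] that F(3) by (simp add: S_def)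
  ultimately show thesis using that[OF F(1)] by blast
qed

text \<open>If evaluation at w is not the zero functional, the element F of least norm with F(w) = 1
  is orthogonal to everything vanishing at w. Each G - G(w) F is of that kind, so F divided by its
  squared norm represents the evaluation.\<close>

lemma reproducing_element_exists:
  assumes tau: "0 \<le> \<tau>"
  shows "\<exists>k\<in>HSpace W \<tau>. \<forall>G\<in>HSpace W \<tau>. G w = ip G k"
proof (cases "\<forall>G\<in>HSpace W \<tau>. G w = 0")
  case True
  thus ?thesis using HSpace_zero by (intro bexI[of _ "\<lambda>z. 0"]) (auto simp: ip_def)
next
  case False
  then obtain F1 where "F1 \<in> HSpace W \<tau>" "F1 w \<noteq> 0" by blast
  from minimal_norm_exists[OF tau this] obtain F where F: "F \<in> HSpace W \<tau>" "F w = 1"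
    and min: "\<And>G. G \<in> HSpace W \<tau> \<Longrightarrow> G w = 1 \<Longrightarrow> sqnorm F \<le> sqnorm G" by blast
  have Re0: "Re (ip F H) = 0" if H: "H \<in> HSpace W \<tau>" "H w = 0" for H
  proof (rule ccontr)
    assume nz: "Re (ip F H) \<noteq> 0"
    define b where "b = Re (ip F H)"
    \<comment> \<open>The variation F + tH is tested at t = -b/q. The 1 added to the squared norm of
      H avoids division by zero and still gives a strict decrease.\<close>
    define q where "q = sqnorm H + 1"
    have q: "q > 0" using sqnorm_nonneg[of H] by (simp add: q_def)
    define t where "t = - b / q"
    have "sqnorm F \<le> sqnorm (\<lambda>z. F z + of_real t * H z)"
      by (rule min) (use F H HSpace_add(1)[OF F(1) HSpace_scale(1)[OF H(1)]] in auto)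
    also have "\<dots> = sqnorm F + 2 * (t * b) + t\<^sup>2 * sqnorm H"
      using HSpace_add(2)[OF F(1) HSpace_scale(1)[OF H(1), of "of_real t"]] HSpace_scale(2)[OF H(1), of "of_real t"]
        ip_scale_right[of F "of_real t" H] by (simp add: b_def)
    also have "\<dots> \<le> sqnorm F + 2 * (t * b) + t\<^sup>2 * q"
      by (intro add_left_mono mult_left_mono) (auto simp: q_def)
    also have "\<dots> = sqnorm F - b\<^sup>2 / q" using q by (simp add: t_def power2_eq_square field_simps)
    finally have "b\<^sup>2 / q \<le> 0" by simp
    thus False using q nz by (simp add: b_def divide_le_0_iff)
  qed
  have orth: "ip H F = 0" if H: "H \<in> HSpace W \<tau>" "H w = 0" for H
  proof -
    have "Re (ip F H) = 0" by (rule Re0[OF H])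
    \<comment> \<open>Testing with iH supplies the imaginary part.\<close>
    moreover have "Re (ip F (\<lambda>z. \<i> * H z)) = 0" by (rule Re0) (use H HSpace_scale in auto)
    ultimately have "ip F H = 0" by (simp add: ip_scale_right complex_eq_iff)
    thus ?thesis using ip_cnj[of F H] by simp
  qed
  have d: "sqnorm F \<noteq> 0" using HSpace_eq_0[OF F(1) _ tau, of w] F(2) by auto
  have "G w = ip G (\<lambda>z. of_real (1 / sqnorm F) * F z)" if G: "G \<in> HSpace W \<tau>" for G
  proof -
    define H where "H z = G z - G w * F z" for z
    have "H \<in> HSpace W \<tau>"
      unfolding H_def[abs_def] by (intro HSpace_diff G HSpace_scale F)
    hence H: "H \<in> HSpace W \<tau>" "ip H F = 0" using orth F(2) by (auto simp: H_def)
    have "ip G F = ip (\<lambda>z. H z + G w * F z) F" by (simp add: H_def)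
    also have "\<dots> = G w * of_real (sqnorm F)"
      using ip_add_left[OF H(1) HSpace_scale(1)[OF F(1), of "G w"] F(1)] H(2)
      by (simp add: ip_scale_left ip_self[OF F(1)])
    finally have "ip G F = G w * of_real (sqnorm F)" .
    thus ?thesis using d by (simp only: ip_scale_right) simp
  qed
  thus ?thesis using HSpace_scale(1)[OF F(1)] by blast
qed

lemma reproducing_element_unique:
  assumes tau: "0 \<le> \<tau>" and k: "k \<in> HSpace W \<tau>" "k' \<in> HSpace W \<tau>"
    and eq: "\<And>G. G \<in> HSpace W \<tau> \<Longrightarrow> ip G k = ip G k'"
  shows "k = k'"
proof
  fix z
  define H where "H z = k z - k' z" for z
  have H: "H \<in> HSpace W \<tau>" unfolding H_def[abs_def] by (intro HSpace_diff k)
  have "sqnorm H = sqnorm k - 2 * Re (ip k k') + sqnorm k'"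
    unfolding H_def[abs_def] by (rule HSpace_diff(2)[OF k])
  moreover have "ip k k' = of_real (sqnorm k)" using eq[OF k(1)] ip_self[OF k(1)] by simp
  moreover have "ip k' k = of_real (sqnorm k')" using eq[OF k(2)] ip_self[OF k(2)] by simp
  moreover have "Re (ip k k') = Re (ip k' k)" using arg_cong[OF ip_cnj[of k k'], of Re] by simp
  ultimately have "sqnorm H = 0" by simp
  from HSpace_eq_0[OF H this tau, of z] show "k z = k' z" by (simp add: H_def)
qed

text \<open>The description ranges over kernels as functions of w. A choice over all w gives
  existence, and uniqueness of the representing element at each w gives uniqueness of the
  kernel.\<close>

lemma repkernel_reproduces:
  assumes tau: "0 \<le> \<tau>"
  shows "repkernel W \<tau> w \<in> HSpace W \<tau>"
    "G \<in> HSpace W \<tau> \<Longrightarrow> G w = ip G (repkernel W \<tau> w)"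
proof -
  define P where "P K \<longleftrightarrow> (\<forall>w. K w \<in> HSpace W \<tau>) \<and> (\<forall>F\<in>HSpace W \<tau>. \<forall>w. F w = ip F (K w))" for K
  have PD: "K w \<in> HSpace W \<tau>" "G \<in> HSpace W \<tau> \<Longrightarrow> ip G (K w) = G w" if "P K" for K w G
    using that unfolding P_def by metis+
  obtain K where "\<And>w. K w \<in> HSpace W \<tau> \<and> (\<forall>G\<in>HSpace W \<tau>. G w = ip G (K w))"
    using bchoice[of UNIV "\<lambda>w k. k \<in> HSpace W \<tau> \<and> (\<forall>G\<in>HSpace W \<tau>. G w = ip G k)"]
      reproducing_element_exists[OF tau] by blast
  hence PK: "P K" unfolding P_def by blast
  have uniq: "K' = K" if K': "P K'" for K'
  proof
    fix w
    show "K' w = K w"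
      by (rule reproducing_element_unique[OF tau PD(1)[OF K'] PD(1)[OF PK]])
        (simp add: PD(2)[OF K'] PD(2)[OF PK])
  qed
  have "P (THE K. P K)" by (rule theI[of P, OF PK uniq])
  moreover have "repkernel W \<tau> = (THE K. P K)" by (simp only: repkernel_def P_def ip_def)
  ultimately have PR: "P (repkernel W \<tau>)" by (simp only:)
  show "repkernel W \<tau> w \<in> HSpace W \<tau>" "G \<in> HSpace W \<tau> \<Longrightarrow> G w = ip G (repkernel W \<tau> w)"
    by (rule PD(1)[OF PR], rule sym, rule PD(2)[OF PR])
qed

end

subsection \<open>The extremal function\<close>

text \<open>Carries the evenness and the reality of F across the two points where z^2 - xi^2
  vanishes.\<close>

lemma continuous_eq_off_finite:
  fixes f :: "'a::euclidean_space \<Rightarrow> 'b::t1_space"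
  assumes "continuous_on UNIV f" "finite S" "\<And>x. x \<notin> S \<Longrightarrow> f x = a"
  shows "f x = a"
proof -
  have "closure (- S) = UNIV" using assms(2) by (simp add: closure_complement empty_interior_finite)
  thus ?thesis
    using continuous_constant_on_closure[of "- S" f a x] assms by auto
qed

context even_weight begin

text \<open>The involution conjugates the values and reflects in the imaginary axis. It preserves
  the space and conjugates inner products because W is even, and it fixes the point i.\<close>

lemma HSpace_sharp:
  assumes G: "G \<in> HSpace W \<tau>"
  shows "(\<lambda>z. cnj (G (- cnj z))) \<in> HSpace W \<tau>"
    "ip G (\<lambda>z. cnj (K (- cnj z))) = cnj (ip (\<lambda>z. cnj (G (- cnj z))) K)"
proof -
  have "(cnj \<circ> (\<lambda>z. G (- z)) \<circ> cnj) holomorphic_on UNIV"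
  proof -
    have "(\<lambda>z. G (- z)) holomorphic_on cnj ` UNIV"
      using HSpace_reflect(1)[OF G] by (auto simp: HSpace_def intro: holomorphic_on_subset)
    thus ?thesis using holomorphic_on_compose_cnj_cnj[of "\<lambda>z. G (- z)" UNIV] by simp
  qed
  moreover have "exp_type_le (\<lambda>z. cnj (G (- cnj z))) \<tau>"
    unfolding exp_type_le_def
  proof safe
    fix e :: real assume "e > 0"
    then obtain C where C: "\<And>z. norm (G z) \<le> C * exp ((\<tau> + e) * norm z)"
      using G by (auto simp: HSpace_def exp_type_le_def)
    have "norm (cnj (G (- cnj z))) \<le> C * exp ((\<tau> + e) * norm z)" for z using C[of "- cnj z"] by simp
    thus "\<exists>C. \<forall>z. norm (cnj (G (- cnj z))) \<le> C * exp ((\<tau> + e) * norm z)" by blast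
  qed
  moreover have "integrable lborel (\<lambda>x. (norm (G (- of_real x)))\<^sup>2 * W x)"
    using HSpace_reflect(1)[OF G] by (simp add: HSpace_def)
  ultimately show "(\<lambda>z. cnj (G (- cnj z))) \<in> HSpace W \<tau>"
    by (simp add: HSpace_def o_def)
  have "ip G (\<lambda>z. cnj (K (- cnj z))) = (LINT x|lborel. G (of_real x) * K (of_real (- x)) * of_real (W x))"
    by (simp add: ip_def)
  also have "\<dots> = (LINT x|lborel. G (of_real (- x)) * K (of_real x) * of_real (W x))"
    using lborel_integral_real_affine[of "-1" "\<lambda>x. G (of_real x) * K (of_real (- x)) * of_real (W x)" 0]
    by (simp add: W_even)
  also have "\<dots> = (LINT x|lborel. cnj (cnj (G (- of_real x)) * cnj (K (of_real x)) * of_real (W x)))"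
    by simp
  also have "\<dots> = cnj (ip (\<lambda>z. cnj (G (- cnj z))) K)"
    unfolding ip_def Bochner_Integration.integral_cnj by simp
  finally show "ip G (\<lambda>z. cnj (K (- cnj z))) = cnj (ip (\<lambda>z. cnj (G (- cnj z))) K)" .
qed

text \<open>The involution fixes i, so the image of the kernel at i represents the same evaluation
  and coincides with the kernel by uniqueness.\<close>

lemma repkernel_i_symmetric:
  assumes tau: "0 \<le> \<tau>"
  shows "repkernel W \<tau> \<i> (- of_real x) = cnj (repkernel W \<tau> \<i> (of_real x))"
proof -
  define k where "k = repkernel W \<tau> \<i>"
  note k = repkernel_reproduces[OF tau, where w = "\<i>", folded k_def]
  have "(\<lambda>z. cnj (k (- cnj z))) = k"
  proof (rule reproducing_element_unique[OF tau HSpace_sharp(1)[OF k(1)] k(1)])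
    fix G assume G: "G \<in> HSpace W \<tau>"
    have "ip G (\<lambda>z. cnj (k (- cnj z))) = cnj (ip (\<lambda>z. cnj (G (- cnj z))) k)"
      by (rule HSpace_sharp(2)[OF G])
    also have "\<dots> = cnj (cnj (G (- cnj \<i>)))"
      using k(2)[OF HSpace_sharp(1)[OF G]] by simp
    also have "\<dots> = ip G k" using k(2)[OF G] by simp
    finally show "ip G (\<lambda>z. cnj (k (- cnj z))) = ip G k" .
  qed
  from fun_cong[OF this, of "of_real x"] show ?thesis
    unfolding k_def[symmetric] by (metis complex_cnj_cnj complex_cnj_complex_of_real)
qed

text \<open>A is of the size of (1 + |x|) |k(x)|, and division by z^2 - xi^2 gains two powers. One
  power is left over, which is why (1 + iz) F still belongs to the space and why (1 + x^2) F^2 is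
  integrable even without the weight.\<close>

lemma extremal_function_exists:
  fixes \<tau> \<xi> :: real
  defines "a \<equiv> \<lambda>x::real. Re ((1 - \<i> * of_real x) * repkernel W \<tau> \<i> (of_real x))"
  assumes tau: "0 \<le> \<tau>" and xi: "0 < \<xi>" "a \<xi> = 0" and nontriv: "a x0 \<noteq> 0"
  obtains F C where "F holomorphic_on UNIV" "\<And>z. F (- z) = F z" "\<And>x. Im (F (of_real x)) = 0"
    "\<And>z. norm (F z) \<le> C * exp (\<tau> * \<bar>Im z\<bar>)"
    "integrable lborel (\<lambda>x. (1 + x\<^sup>2) * (norm (F (of_real x)))\<^sup>2)"
    "(LINT x|lborel. (x\<^sup>2 - \<xi>\<^sup>2) * (norm (F (of_real x)))\<^sup>2 * W x) = 0"
    "F (of_real x0) \<noteq> 0"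
proof -
  define k where "k = repkernel W \<tau> \<i>"
  note k = repkernel_reproduces[OF tau, where w = "\<i>", folded k_def]
  \<comment> \<open>At real points the second summand is the conjugate of the first by the symmetry
    of the kernel, so the mean is the required real part; as a symmetrisation it is even
    everywhere.\<close>
  define A where "A z = ((1 - \<i> * z) * k z + (1 + \<i> * z) * k (- z)) / 2" for z
  have holk: "k holomorphic_on UNIV" and holkm: "(\<lambda>z. k (- z)) holomorphic_on UNIV"
    using k(1) HSpace_reflect(1)[OF k(1)] by (auto simp: HSpace_def)
  have holA: "A holomorphic_on UNIV"
    unfolding A_def by (intro holomorphic_intros holk holkm) auto
  have A_real: "A (of_real x) = of_real (a x)" for x
  proof -
    have km: "k (- of_real x) = cnj (k (of_real x))"
      unfolding k_def by (rule repkernel_i_symmetric[OF tau])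
    show ?thesis unfolding A_def a_def k_def[symmetric] km by (simp add: complex_eq_iff)
  qed
  have A_even: "A (- z) = A z" for z by (simp add: A_def)
  have A0: "A (of_real \<xi>) = 0" "A (- of_real \<xi>) = 0"
    using xi(2) by (simp_all add: A_real A_even)
  define s where "s = sqnorm k + 1"
  define Ck where "Ck = evbound \<tau> * s"
  have s1: "s \<ge> 1" "sqnorm k \<le> s\<^sup>2"
    using sqnorm_nonneg[of k] by (auto simp: s_def power2_eq_square algebra_simps)
  have Ckpos: "Ck > 0" using evbound_pos s1 by (simp add: Ck_def)
  have kb: "norm (k z) \<le> Ck * exp (\<tau> * \<bar>Im z\<bar>)" for z
    unfolding Ck_def using s1 by (intro HSpace_bound k tau) auto
  have Ab: "norm (A z) \<le> (1 + norm z) * (Ck * exp (\<tau> * \<bar>Im z\<bar>))" for z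
  proof -
    have "norm (1 - \<i> * z) \<le> 1 + norm z" "norm (1 + \<i> * z) \<le> 1 + norm z"
      using norm_triangle_ineq4[of 1 "\<i> * z"] norm_triangle_ineq[of 1 "\<i> * z"] by (auto simp: norm_mult)
    hence "norm ((1 - \<i> * z) * k z) \<le> (1 + norm z) * (Ck * exp (\<tau> * \<bar>Im z\<bar>))"
      "norm ((1 + \<i> * z) * k (- z)) \<le> (1 + norm z) * (Ck * exp (\<tau> * \<bar>Im z\<bar>))"
      unfolding norm_mult using kb[of z] kb[of "- z"] by (auto intro!: mult_mono)
    from norm_triangle_mono[OF this] show ?thesis by (simp add: A_def norm_divide mult_ac)
  qed
  \<comment> \<open>The two zeros are divided out one after the other. The value assigned at the
    zero is the one that removes the singularity; \<open>F1\<close> still vanishes at the second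
    zero because xi and -xi differ.\<close>
  define F1 where "F1 z = (if z = of_real \<xi> then deriv A (of_real \<xi>) else (A z - A (of_real \<xi>)) / (z - of_real \<xi>))" for z
  have holF1: "F1 holomorphic_on UNIV"
    unfolding F1_def by (rule pole_lemma[OF holA]) auto
  have F1m: "F1 (- of_real \<xi>) = 0"
    using xi A0 by (auto simp: F1_def)
  define F where "F z = (if z = - of_real \<xi> then deriv F1 (- of_real \<xi>) else (F1 z - F1 (- of_real \<xi>)) / (z - (- of_real \<xi>)))" for z
  have holF: "F holomorphic_on UNIV"
    unfolding F_def by (rule pole_lemma[OF holF1]) auto
  have contF: "continuous_on UNIV F" by (rule holomorphic_on_imp_continuous_on[OF holF])
  have FA: "(z\<^sup>2 - of_real (\<xi>\<^sup>2)) * F z = A z" for z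
  proof -
    have fac: "z\<^sup>2 - of_real (\<xi>\<^sup>2) = (z - of_real \<xi>) * (z + of_real \<xi>)"
      by (simp add: power2_eq_square algebra_simps)
    have "(z + of_real \<xi>) * F z = F1 z" using F1m by (auto simp: F_def add_eq_0_iff)
    moreover have "(z - of_real \<xi>) * F1 z = A z" using A0 by (auto simp: F1_def)
    ultimately show ?thesis unfolding fac by (simp only: mult.assoc)
  qed
  have nz: "z\<^sup>2 - of_real (\<xi>\<^sup>2) \<noteq> (0::complex)" if "z \<notin> {of_real \<xi>, - of_real \<xi>}" for z
    using that by (auto simp: power2_eq_iff)
  have F_even: "F (- z) = F z" for z
  proof -
    have "F (- z) - F z = 0"
    proof (rule continuous_eq_off_finite[of "\<lambda>z. F (- z) - F z" "{of_real \<xi>, - of_real \<xi>}"])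
      show "continuous_on UNIV (\<lambda>z. F (- z) - F z)"
        by (intro continuous_intros continuous_on_compose2[OF contF]) auto
      fix z :: complex assume z: "z \<notin> {of_real \<xi>, - of_real \<xi>}"
      have "(z\<^sup>2 - of_real (\<xi>\<^sup>2)) * (F (- z) - F z) = 0"
        using FA[of z] FA[of "- z"] by (simp add: A_even right_diff_distrib)
      thus "F (- z) - F z = 0" using nz[OF z] by simp
    qed auto
    thus ?thesis by simp
  qed
  have FR: "(x\<^sup>2 - \<xi>\<^sup>2) * Re (F (of_real x)) = a x" "(x\<^sup>2 - \<xi>\<^sup>2) * Im (F (of_real x)) = 0" for x
  proof -
    have "of_real (x\<^sup>2 - \<xi>\<^sup>2) * F (of_real x) = of_real (a x)"
      using FA[of "of_real x"] by (simp add: A_real)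
    from arg_cong[OF this, of Re] arg_cong[OF this, of Im]
    show "(x\<^sup>2 - \<xi>\<^sup>2) * Re (F (of_real x)) = a x" "(x\<^sup>2 - \<xi>\<^sup>2) * Im (F (of_real x)) = 0"
      by (simp_all only: Re_complex_of_real Im_complex_of_real Re_divide_of_real times_complex.sel)
  qed
  have contFr: "continuous_on UNIV (\<lambda>x::real. F (of_real x))"
    by (intro continuous_on_compose2[OF contF] continuous_intros) auto
  have F_real: "Im (F (of_real x)) = 0" for x
  proof (rule continuous_eq_off_finite[of "\<lambda>x. Im (F (of_real x))" "{\<xi>, - \<xi>}"])
    show "continuous_on UNIV (\<lambda>x. Im (F (of_real x)))" by (intro continuous_intros contFr)
    fix x assume "x \<notin> {\<xi>, - \<xi>}"
    hence "x\<^sup>2 - \<xi>\<^sup>2 \<noteq> 0" by (auto simp: power2_eq_iff)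
    thus "Im (F (of_real x)) = 0" using FR(2)[of x] by simp
  qed auto
  \<comment> \<open>Outside this radius |z^2 - xi^2| >= 3/4 |z|^2 and |z| > 1; inside it,
    compactness bounds F.\<close>
  define R where "R = 2 * \<xi> + 1"
  have R: "R > 1" using xi by (simp add: R_def)
  have far: "3/4 * (norm z)\<^sup>2 \<le> norm (z\<^sup>2 - of_real (\<xi>\<^sup>2))" if "norm z \<ge> R" for z :: complex
  proof -
    have "(2 * \<xi>)\<^sup>2 \<le> (norm z)\<^sup>2" using that xi by (intro power_mono) (auto simp: R_def)
    hence "\<xi>\<^sup>2 \<le> (norm z)\<^sup>2 / 4" by (simp add: power_mult_distrib)
    moreover have "norm (z\<^sup>2 - of_real (\<xi>\<^sup>2)) \<ge> (norm z)\<^sup>2 - \<xi>\<^sup>2"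
      using norm_triangle_ineq2[of "z\<^sup>2" "of_real (\<xi>\<^sup>2)"] by (simp add: norm_power)
    ultimately show ?thesis by linarith
  qed
  have "compact (F ` cball 0 R)"
    by (intro compact_continuous_image continuous_on_subset[OF contF]) auto
  then obtain B where B: "\<And>z. norm z \<le> R \<Longrightarrow> norm (F z) \<le> B"
    by (meson bounded_iff compact_imp_bounded imageI mem_cball_0)
  have B0: "B \<ge> 0" using order_trans[OF norm_ge_zero B[of 0]] R by simp
  have F_bound: "norm (F z) \<le> (B + 4 * Ck) * exp (\<tau> * \<bar>Im z\<bar>)" for z
  proof (cases "norm z \<le> R")
    case True
    have "norm (F z) \<le> B * 1" using B[OF True] by simp
    also have "\<dots> \<le> (B + 4 * Ck) * exp (\<tau> * \<bar>Im z\<bar>)"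
      using B0 Ckpos tau by (intro mult_mono) auto
    finally show ?thesis .
  next
    case False
    hence z1: "norm z > 1" using R by simp
    have "3/4 * (norm z)\<^sup>2 * norm (F z) \<le> norm (z\<^sup>2 - of_real (\<xi>\<^sup>2)) * norm (F z)"
      using far[of z] False by (intro mult_right_mono) auto
    also have "\<dots> = norm (A z)" using FA[of z] by (metis norm_mult)
    also have "\<dots> \<le> (1 + norm z) * (Ck * exp (\<tau> * \<bar>Im z\<bar>))" by (rule Ab)
    also have "\<dots> \<le> (3 * (norm z)\<^sup>2) * (Ck * exp (\<tau> * \<bar>Im z\<bar>))"
    proof (intro mult_right_mono)
      have "norm z * 1 \<le> norm z * norm z" using z1 by (intro mult_left_mono) auto
      thus "1 + norm z \<le> 3 * (norm z)\<^sup>2" using z1 by (simp add: power2_eq_square)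
    qed (use Ckpos in auto)
    finally have "(norm z)\<^sup>2 * norm (F z) \<le> (norm z)\<^sup>2 * (4 * Ck * exp (\<tau> * \<bar>Im z\<bar>))" by (simp add: mult_ac)
    hence "norm (F z) \<le> 4 * Ck * exp (\<tau> * \<bar>Im z\<bar>)" using z1 by (auto simp: mult_le_cancel_left)
    also have "\<dots> \<le> (B + 4 * Ck) * exp (\<tau> * \<bar>Im z\<bar>)" using B0 by (intro mult_right_mono) auto
    finally show ?thesis .
  qed
  have [measurable]: "(\<lambda>x. F (of_real x)) \<in> borel_measurable borel"
    by (rule borel_measurable_continuous_onI[OF contFr])
  have intF: "integrable lborel (\<lambda>x. (1 + x\<^sup>2) * (norm (F (of_real x)))\<^sup>2)"
  proof (rule Bochner_Integration.integrable_bound)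
    \<comment> \<open>For |x| > R the division leaves at most 8 |k|^2, and W >= \<kappa>/2 there
      because |x| >= 1; this gives 16/\<kappa>. The indicator term covers the bounded range.\<close>
    define b where "b x = 16 / \<kappa> * ((norm (k (of_real x)))\<^sup>2 * W x) + (1 + R\<^sup>2) * B\<^sup>2 * indicator {-R..R} x" for x
    have b0: "0 \<le> (1 + R\<^sup>2) * B\<^sup>2 * indicator {-R..R} x" "0 \<le> 16 / \<kappa> * ((norm (k (of_real x)))\<^sup>2 * W x)" for x :: real
      using kappa_pos W_nonneg[of x] by auto
    show "integrable lborel b"
    proof -
      have "integrable lborel (indicat_real {-R..R})"
        by (rule integrable_real_indicator) (auto simp: emeasure_lborel_Icc_eq)
      thus ?thesis unfolding b_def using k(1)
        by (intro Bochner_Integration.integrable_add integrable_mult_right) (auto simp: HSpace_def)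
    qed
    show "(\<lambda>x. (1 + x\<^sup>2) * (norm (F (of_real x)))\<^sup>2) \<in> borel_measurable lborel" by measurable
    have "(1 + x\<^sup>2) * (norm (F (of_real x)))\<^sup>2 \<le> b x" for x
    proof (cases "\<bar>x\<bar> \<le> R")
      case True
      have "x\<^sup>2 \<le> R\<^sup>2" using True R by (intro abs_le_square_iff[THEN iffD1]) auto
      hence "(1 + x\<^sup>2) * (norm (F (of_real x)))\<^sup>2 \<le> (1 + R\<^sup>2) * B\<^sup>2"
        using B[of "of_real x"] True by (intro mult_mono power_mono) auto
      moreover have "indicator {-R..R} x = (1::real)" using True by (auto simp: indicator_def abs_le_iff)
      ultimately show ?thesis using b0(2)[of x] by (simp add: b_def)
    next
      case False
      define q where "q = (norm (k (of_real x)))\<^sup>2"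
      have x1: "1 \<le> x\<^sup>2" using False R by (simp add: abs_le_square_iff[of 1 x, simplified, symmetric])
      have "(3/4 * x\<^sup>2) * norm (F (of_real x)) \<le> norm ((of_real x)\<^sup>2 - of_real (\<xi>\<^sup>2) :: complex) * norm (F (of_real x))"
        using far[of "of_real x"] False by (intro mult_right_mono) (auto simp del: of_real_power)
      also have "\<dots> = norm (A (of_real x))" using FA[of "of_real x"] by (metis norm_mult)
      also have "\<dots> \<le> norm ((1 - \<i> * of_real x) * k (of_real x))"
        unfolding A_real a_def k_def[symmetric] norm_of_real by (rule abs_Re_le_cmod)
      finally have "((3/4 * x\<^sup>2) * norm (F (of_real x)))\<^sup>2 \<le> (norm ((1 - \<i> * of_real x) * k (of_real x)))\<^sup>2"
        by (intro power_mono) auto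
      also have "\<dots> = (1 + x\<^sup>2) * q"
        by (simp add: norm_mult power_mult_distrib q_def cmod_power2)
      also have "\<dots> \<le> (2 * x\<^sup>2) * q" using x1 by (intro mult_right_mono) (auto simp: q_def)
      finally have "x\<^sup>2 * (9/16 * x\<^sup>2 * (norm (F (of_real x)))\<^sup>2) \<le> x\<^sup>2 * (2 * q)"
        by (simp add: power_mult_distrib power2_eq_square algebra_simps)
      hence le: "9/16 * x\<^sup>2 * (norm (F (of_real x)))\<^sup>2 \<le> 2 * q"
        by (rule mult_left_le_imp_le) (use x1 in linarith)
      have "(1 + x\<^sup>2) * (norm (F (of_real x)))\<^sup>2 \<le> (2 * x\<^sup>2) * (norm (F (of_real x)))\<^sup>2"
        using x1 by (intro mult_right_mono) auto
      also have "\<dots> \<le> 8 * q"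
      proof -
        define v where "v = x\<^sup>2 * (norm (F (of_real x)))\<^sup>2"
        have "9/16 * v \<le> 2 * q" "q \<ge> 0" using le by (simp_all add: v_def q_def)
        hence "2 * v \<le> 8 * q" by linarith
        thus ?thesis by (simp add: v_def)
      qed
      also have "\<dots> \<le> 16 / \<kappa> * (q * W x)"
      proof -
        have "\<kappa> * (1/2) \<le> \<kappa> * (x\<^sup>2 / (1 + x\<^sup>2))"
          using x1 kappa_pos by (intro mult_left_mono) (auto simp: field_simps)
        also have "\<dots> \<le> W x" by (rule W_ge)
        finally have "q * \<kappa> \<le> q * (2 * W x)" by (intro mult_left_mono) (auto simp: q_def)
        thus ?thesis using kappa_pos by (simp add: field_simps)
      qed
      also have "\<dots> \<le> b x" using b0(1)[of x] by (simp add: b_def q_def)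
      finally show ?thesis .
    qed
    moreover have "0 \<le> (1 + x\<^sup>2) * (norm (F (of_real x)))\<^sup>2" for x by simp
    ultimately show "AE x in lborel. norm ((1 + x\<^sup>2) * (norm (F (of_real x)))\<^sup>2) \<le> norm (b x)"
      by (intro AE_I2) (smt (verit) real_norm_def)
  qed
  define U where "U z = (1 + \<i> * z) * F z" for z
  have U: "U \<in> HSpace W \<tau>"
  proof -
    have "exp_type_le U \<tau>"
      unfolding exp_type_le_def
    proof safe
      fix e :: real assume e: "e > 0"
      \<comment> \<open>The linear factor is absorbed by the slack e that exponential type permits:
        1 + |z| <= (1 + 1/e) exp(e |z|).\<close>
      have "norm (U z) \<le> ((1 + 1 / e) * (B + 4 * Ck)) * exp ((\<tau> + e) * norm z)" for z
      proof -
        have "norm (1 + \<i> * z) \<le> 1 + norm z"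
          using norm_triangle_ineq[of 1 "\<i> * z"] by (auto simp: norm_mult)
        also have "\<dots> \<le> (1 + 1 / e) * exp (e * norm z)"
        proof -
          have "(1 + e * norm z) / e \<le> exp (e * norm z) / e"
            using e by (intro divide_right_mono exp_ge_add_one_self) auto
          hence "1 / e + norm z \<le> exp (e * norm z) / e" using e by (simp add: add_divide_distrib)
          moreover have "1 \<le> exp (e * norm z)" using e by simp
          moreover have "1 / e > 0" using e by simp
          moreover have "(1 + 1 / e) * exp (e * norm z) = exp (e * norm z) + exp (e * norm z) / e"
            by (simp add: ring_distribs)
          ultimately show ?thesis by linarith
        qed
        finally have n1: "norm (1 + \<i> * z) \<le> (1 + 1 / e) * exp (e * norm z)" .
        have "\<tau> * \<bar>Im z\<bar> \<le> \<tau> * norm z" using tau abs_Im_le_cmod by (intro mult_left_mono) auto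
        hence "(B + 4 * Ck) * exp (\<tau> * \<bar>Im z\<bar>) \<le> (B + 4 * Ck) * exp (\<tau> * norm z)"
          using B0 Ckpos by (intro mult_left_mono) auto
        hence n2: "norm (F z) \<le> (B + 4 * Ck) * exp (\<tau> * norm z)" using F_bound[of z] by linarith
        have "norm (U z) \<le> ((1 + 1 / e) * exp (e * norm z)) * ((B + 4 * Ck) * exp (\<tau> * norm z))"
          unfolding U_def norm_mult using n1 n2 e by (intro mult_mono) (auto intro: add_nonneg_nonneg)
        also have "\<dots> = ((1 + 1 / e) * (B + 4 * Ck)) * exp ((\<tau> + e) * norm z)"
          by (simp add: ring_distribs exp_add mult_ac)
        finally show ?thesis .
      qed
      thus "\<exists>C. \<forall>z. norm (U z) \<le> C * exp ((\<tau> + e) * norm z)" by blast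
    qed
    moreover have "integrable lborel (\<lambda>x. (norm (U (of_real x)))\<^sup>2 * W x)"
    proof (rule Bochner_Integration.integrable_bound)
      show "integrable lborel (\<lambda>x. 2 * ((1 + x\<^sup>2) * (norm (F (of_real x)))\<^sup>2))"
        using intF by (rule integrable_mult_right)
      have Usq: "(norm (U (of_real x)))\<^sup>2 = (1 + x\<^sup>2) * (norm (F (of_real x)))\<^sup>2" for x
        by (simp add: U_def norm_mult power_mult_distrib cmod_power2[of "1 + \<i> * of_real x"])
      show "(\<lambda>x. (norm (U (of_real x)))\<^sup>2 * W x) \<in> borel_measurable lborel"
        unfolding Usq by measurable
      have "(norm (U (of_real x)))\<^sup>2 * W x \<le> 2 * ((1 + x\<^sup>2) * (norm (F (of_real x)))\<^sup>2)" for x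
        unfolding Usq using mult_left_mono[OF W_le[of x], of "(1 + x\<^sup>2) * (norm (F (of_real x)))\<^sup>2"] by simp
      thus "AE x in lborel. norm ((norm (U (of_real x)))\<^sup>2 * W x) \<le> norm (2 * ((1 + x\<^sup>2) * (norm (F (of_real x)))\<^sup>2))"
        using W_nonneg by (intro AE_I2) (simp add: abs_mult)
    qed
    moreover have "U holomorphic_on UNIV" unfolding U_def by (intro holomorphic_intros holF)
    ultimately show ?thesis by (simp add: HSpace_def)
  qed
  have "ip U k = 0" using k(2)[OF U] by (simp add: U_def)
  hence "0 = Re (ip U k)" by simp
  also have "\<dots> = (LINT x|lborel. Re (U (of_real x) * cnj (k (of_real x)) * of_real (W x)))"
    unfolding ip_def using integral_Re[OF ip_integrable[OF U k(1)]] by simp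
  also have "\<dots> = (LINT x|lborel. (x\<^sup>2 - \<xi>\<^sup>2) * (norm (F (of_real x)))\<^sup>2 * W x)"
  proof (rule Bochner_Integration.integral_cong[OF refl])
    fix x :: real
    have "F (of_real x) = of_real (Re (F (of_real x)))" using F_real[of x] by (simp add: complex_eq_iff)
    then obtain f where f: "F (of_real x) = of_real f" by blast
    have "(x\<^sup>2 - \<xi>\<^sup>2) * (norm (F (of_real x)))\<^sup>2 = f * a x"
      using FR(1)[of x] by (simp add: f power2_eq_square algebra_simps)
    \<comment> \<open>As 1 + ix is the conjugate of 1 - ix and F is real, U times the conjugate of k
      is F times the conjugate of (1 - ix) k.\<close>
    also have "\<dots> = Re (U (of_real x) * cnj (k (of_real x)))"
      unfolding U_def f a_def k_def[symmetric] by (simp add: algebra_simps)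
    finally show "Re (U (of_real x) * cnj (k (of_real x)) * of_real (W x)) = (x\<^sup>2 - \<xi>\<^sup>2) * (norm (F (of_real x)))\<^sup>2 * W x"
      by simp
  qed
  finally have int0: "(LINT x|lborel. (x\<^sup>2 - \<xi>\<^sup>2) * (norm (F (of_real x)))\<^sup>2 * W x) = 0" by simp
  have "F (of_real x0) \<noteq> 0" using FR(1)[of x0] nontriv by auto
  thus thesis using that[OF holF F_even F_real F_bound intF int0] by blast
qed

end

subsection \<open>Rapidly decaying band-limited functions\<close>

definition csinc :: "complex \<Rightarrow> complex" where
  "csinc z = (if z = 0 then 1 else sin z / z)"

lemma holomorphic_csinc: "csinc holomorphic_on UNIV"
proof -
  have "deriv sin (0::complex) = 1" by (rule DERIV_imp_deriv) (auto intro!: derivative_eq_intros)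
  hence "csinc = (\<lambda>z. if z = 0 then deriv sin 0 else (sin z - sin 0) / (z - 0))"
    by (auto simp: csinc_def)
  thus ?thesis using pole_lemma[of sin UNIV 0, OF holomorphic_on_sin] by simp
qed

lemma csinc_minus: "csinc (- z) = csinc z"
  by (simp add: csinc_def)

text \<open>The mean value inequality for sin along the segment from 0 to w, where the derivative
  cos is at most exp |Im w|.\<close>

lemma norm_csinc_le: "norm (csinc w) \<le> exp \<bar>Im w\<bar>"
proof (cases "w = 0")
  case False
  have "norm (sin w - sin 0) \<le> exp \<bar>Im w\<bar> * norm (w - 0)"
  proof (rule field_differentiable_bound[of "closed_segment 0 w" sin cos])
    show "(sin has_field_derivative cos z) (at z within closed_segment 0 w)" for z
      by (auto intro!: derivative_eq_intros)
    show "norm (cos z) \<le> exp \<bar>Im w\<bar>" if "z \<in> closed_segment 0 w" for z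
      using that by (auto simp: closed_segment_def cmod_cos_le_exp)
  qed auto
  thus ?thesis using False by (simp add: csinc_def norm_divide field_simps)
qed (simp add: csinc_def)

lemma norm_mult_csinc_le: "norm w * norm (csinc w) \<le> exp \<bar>Im w\<bar>"
  using cmod_sin_le_exp[of 1 w] by (simp add: csinc_def norm_divide)

definition etapart :: "nat \<Rightarrow> complex \<Rightarrow> complex" where
  "etapart N z = (\<Prod>n<N. csinc (z / 2 ^ Suc n))"

text \<open>The infinite product of sin(z/2^n) / (z/2^n) over n >= 1 is the Fourier transform of
  Rvachev's up function, a smooth bump on [-1, 1]. The types 1/2, 1/4, ... of the factors add up to
  1.\<close>

definition eta :: "complex \<Rightarrow> complex" where
  "eta z = lim (\<lambda>N. etapart N z)"

text \<open>\<open>csinc\<close> differs from 1 by O(|w|) on bounded sets, so the deviations of the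
  factors are dominated by a geometric series.\<close>

lemma eta_uniform_limit: "uniform_limit (cball 0 R) etapart eta sequentially"
proof -
  define R' where "R' = \<bar>R\<bar>"
  have cont: "continuous_on S csinc" for S
    by (intro holomorphic_on_imp_continuous_on holomorphic_on_subset[OF holomorphic_csinc]) auto
  have "continuous_on (cball 0 R') (deriv csinc)"
    by (intro holomorphic_on_imp_continuous_on holomorphic_on_subset[OF holomorphic_deriv[OF holomorphic_csinc]]) auto
  hence "compact (deriv csinc ` cball 0 R')" by (intro compact_continuous_image) auto
  then obtain B where B: "\<And>z. norm z \<le> R' \<Longrightarrow> norm (deriv csinc z) \<le> B"
    by (meson bounded_iff compact_imp_bounded imageI mem_cball_0)
  have lip: "norm (csinc z - 1) \<le> B * norm z" if "norm z \<le> R'" for z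
  proof -
    have "norm (csinc z - csinc 0) \<le> B * norm (z - 0)"
    proof (rule field_differentiable_bound[of "cball 0 R'"])
      show "(csinc has_field_derivative deriv csinc w) (at w within cball 0 R')" for w
        using holomorphic_derivI[OF holomorphic_csinc open_UNIV] by (auto intro: has_field_derivative_at_within)
    qed (use that B R'_def in auto)
    thus ?thesis by (simp add: csinc_def)
  qed
  have B0: "B \<ge> 0" using order_trans[OF norm_ge_zero B[of 0]] by (simp add: R'_def)
  have "uniformly_convergent_on (cball 0 R') (\<lambda>N z. \<Prod>n<N. csinc (z / 2 ^ Suc n))"
  proof (rule Infinite_Products.uniformly_convergent_on_prod')
    show "continuous_on (cball 0 R') (\<lambda>z. csinc (z / 2 ^ Suc n))" for n
      by (rule continuous_on_compose2[OF cont[of UNIV]]) (auto intro!: continuous_intros)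
    show "uniformly_convergent_on (cball 0 R') (\<lambda>N z. \<Sum>n<N. norm (csinc (z / 2 ^ Suc n) - 1))"
    proof (rule Weierstrass_m_test'[where M = "\<lambda>n. B * R' * (1/2) ^ Suc n"])
      fix n and z :: complex assume z: "z \<in> cball 0 R'"
      have nz: "norm (z / 2 ^ Suc n) = norm z * (1/2) ^ Suc n"
        by (simp add: norm_divide norm_power power_divide)
      have "(1/2::real) ^ Suc n \<le> 1" by (rule power_le_one) auto
      hence "norm (z / 2 ^ Suc n) \<le> R' * 1" unfolding nz using z by (intro mult_mono) (auto simp: R'_def)
      hence "norm (csinc (z / 2 ^ Suc n) - 1) \<le> B * (norm z * (1/2) ^ Suc n)"
        using lip[of "z / 2 ^ Suc n"] unfolding nz by simp
      also have "\<dots> \<le> B * (R' * (1/2) ^ Suc n)"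
        using z B0 by (intro mult_left_mono mult_right_mono) auto
      finally show "norm (norm (csinc (z / 2 ^ Suc n) - 1)) \<le> B * R' * (1/2) ^ Suc n" by (simp add: mult_ac)
    next
      have "summable (\<lambda>n. (B * R' * (1/2)) * (1/2) ^ n :: real)"
        by (intro summable_mult summable_geometric) auto
      thus "summable (\<lambda>n. B * R' * (1/2) ^ Suc n)" by (simp add: mult_ac)
    qed
  qed auto
  hence "uniformly_convergent_on (cball 0 R') etapart" by (simp add: etapart_def[abs_def])
  hence "uniform_limit (cball 0 R') etapart eta sequentially"
    unfolding uniformly_convergent_uniform_limit_iff eta_def[abs_def] .
  thus ?thesis by (rule uniform_limit_on_subset) (auto simp: R'_def)
qed

lemma eta_tendsto: "(\<lambda>N. etapart N z) \<longlonglongrightarrow> eta z"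
  using tendsto_uniform_limitI[OF eta_uniform_limit[of "norm z"], of z] by simp

lemma holomorphic_eta: "eta holomorphic_on UNIV"
proof (rule holomorphic_uniform_sequence[OF open_UNIV])
  show "etapart n holomorphic_on UNIV" for n
  proof -
    have "(csinc \<circ> (\<lambda>z. z / 2 ^ Suc m)) holomorphic_on UNIV" for m
      by (intro holomorphic_on_compose_gen[OF _ holomorphic_csinc] holomorphic_intros) auto
    thus ?thesis unfolding etapart_def[abs_def] by (intro holomorphic_intros) (simp add: o_def)
  qed
  fix x :: complex
  have "cball x 1 \<subseteq> cball 0 (norm x + 1)"
  proof
    fix y assume "y \<in> cball x 1"
    thus "y \<in> cball 0 (norm x + 1)"
      using norm_triangle_ineq2[of y x] by (simp add: dist_norm norm_minus_commute)
  qed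
  hence "uniform_limit (cball x 1) etapart eta sequentially"
    using eta_uniform_limit uniform_limit_on_subset by blast
  thus "\<exists>d. 0 < d \<and> cball x d \<subseteq> UNIV \<and> uniform_limit (cball x d) etapart eta sequentially"
    by (intro exI[of _ 1]) auto
qed

lemma eta_even: "eta (- z) = eta z"
  by (simp add: eta_def etapart_def csinc_minus)

lemma eta_0: "eta 0 = 1"
  by (simp add: eta_def etapart_def csinc_def)

lemma Im_eta_of_real: "Im (eta (of_real x)) = 0"
proof -
  have "csinc (of_real y) \<in> \<real>" for y :: real
    by (auto simp: csinc_def simp flip: sin_of_real)
  hence "csinc (of_real x / 2 ^ Suc n) \<in> \<real>" for n
    by (metis of_real_divide of_real_numeral of_real_power)
  hence "etapart N (of_real x) \<in> \<real>" for N
    unfolding etapart_def by (intro prod_in_Reals) auto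
  hence "Im (etapart N (of_real x)) = 0" for N by (simp add: complex_is_Real_iff)
  thus ?thesis using tendsto_Im[OF eta_tendsto[of "of_real x"]] by (simp add: LIMSEQ_const_iff)
qed

text \<open>Each of the first N factors trades one power of norm z for a constant 2^(n+1); the
  remaining ones are bounded by exponentials. All exponents together stay below |Im z|, so decay of
  any order costs no additional type.\<close>

lemma eta_power_bound: "norm (eta z) * norm z ^ N \<le> 2 ^ (\<Sum>n<N. Suc n) * exp \<bar>Im z\<bar>"
proof (rule tendsto_upperbound)
  show "(\<lambda>M. norm (etapart M z) * norm z ^ N) \<longlonglongrightarrow> norm (eta z) * norm z ^ N"
    by (intro tendsto_intros eta_tendsto)
  have "norm (etapart M z) * norm z ^ N \<le> 2 ^ (\<Sum>n<N. Suc n) * exp \<bar>Im z\<bar>" if M: "M \<ge> N" for M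
  proof -
    define q where "q n = \<bar>Im z\<bar> * (1/2) ^ Suc n" for n
    have Imq: "\<bar>Im (z / 2 ^ Suc n)\<bar> = q n" for n
    proof -
      have "z / 2 ^ Suc n = of_real ((1/2) ^ Suc n) * z" by (simp add: power_divide)
      thus ?thesis by (simp only: Im_complex_of_real times_complex.sel q_def) (simp add: abs_mult)
    qed
    have one: "(\<Prod>n<M. if n < N then a n else 1) = (\<Prod>n<N. a n)" for a :: "nat \<Rightarrow> real"
      by (rule prod.mono_neutral_cong_right) (use M in auto)
    have "norm (etapart M z) * norm z ^ N = (\<Prod>n<M. norm (csinc (z / 2 ^ Suc n))) * (\<Prod>n<M. if n < N then norm z else 1)"
      unfolding one by (simp add: etapart_def prod_norm)
    also have "\<dots> = (\<Prod>n<M. norm (csinc (z / 2 ^ Suc n)) * (if n < N then norm z else 1))"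
      by (simp add: prod.distrib)
    also have "\<dots> \<le> (\<Prod>n<M. (if n < N then 2 ^ Suc n else 1) * exp (q n))"
    proof (rule prod_mono, safe)
      fix n
      show "0 \<le> norm (csinc (z / 2 ^ Suc n)) * (if n < N then norm z else 1)" by auto
      show "norm (csinc (z / 2 ^ Suc n)) * (if n < N then norm z else 1) \<le> (if n < N then 2 ^ Suc n else 1) * exp (q n)"
      proof (cases "n < N")
        case True
        have "norm z = 2 ^ Suc n * norm (z / 2 ^ Suc n)" by (simp add: norm_divide norm_power)
        hence "norm (csinc (z / 2 ^ Suc n)) * norm z = 2 ^ Suc n * (norm (z / 2 ^ Suc n) * norm (csinc (z / 2 ^ Suc n)))"
          by (simp only: mult_ac)
        also have "\<dots> \<le> 2 ^ Suc n * exp (q n)"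
          using norm_mult_csinc_le[of "z / 2 ^ Suc n"] unfolding Imq by (intro mult_left_mono) auto
        finally show ?thesis using True by simp
      next
        case False
        thus ?thesis using norm_csinc_le[of "z / 2 ^ Suc n"] unfolding Imq by simp
      qed
    qed
    also have "\<dots> = (\<Prod>n<N. 2 ^ Suc n) * exp (\<Sum>n<M. q n)"
      unfolding prod.distrib one by (simp add: exp_sum)
    also have "(\<Prod>n<N. 2 ^ Suc n) = (2::real) ^ (\<Sum>n<N. Suc n)" by (rule power_sum[symmetric])
    also have "(\<Sum>n<M. q n) = \<bar>Im z\<bar> * (1 - (1/2) ^ M)"
    proof -
      have "(\<Sum>n<M. (1/2::real) ^ Suc n) = 1 - (1/2) ^ M" by (induction M) auto
      thus ?thesis unfolding q_def sum_distrib_left[symmetric] by simp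
    qed
    also have "2 ^ (\<Sum>n<N. Suc n) * exp (\<bar>Im z\<bar> * (1 - (1/2) ^ M)) \<le> 2 ^ (\<Sum>n<N. Suc n) * exp \<bar>Im z\<bar>"
    proof (intro mult_left_mono exp_le_cancel_iff[THEN iffD2])
      show "\<bar>Im z\<bar> * (1 - (1/2) ^ M) \<le> \<bar>Im z\<bar>" using mult_left_mono[of "1 - (1/2) ^ M" 1 "\<bar>Im z\<bar>"] by simp
    qed auto
    finally show ?thesis .
  qed
  thus "\<forall>\<^sub>F M in sequentially. norm (etapart M z) * norm z ^ N \<le> 2 ^ (\<Sum>n<N. Suc n) * exp \<bar>Im z\<bar>"
    by (auto simp: eventually_sequentially)
qed auto

lemma norm_eta_le: "norm (eta z) \<le> exp \<bar>Im z\<bar>"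
  using eta_power_bound[of z 0] by simp

text \<open>The Paley-Wiener class of Fourier transforms of smooth functions supported in \<open>[-\<sigma>, \<sigma>]\<close>.\<close>

definition rapid_type :: "(complex \<Rightarrow> complex) \<Rightarrow> real \<Rightarrow> bool" where
  "rapid_type \<Phi> \<sigma> \<longleftrightarrow> \<Phi> holomorphic_on UNIV \<and>
     (\<forall>N::nat. \<exists>C. \<forall>z. norm (\<Phi> z) * (1 + norm z) ^ N \<le> C * exp (\<sigma> * \<bar>Im z\<bar>))"

lemma eta_rapid: "rapid_type eta 1"
  unfolding rapid_type_def
proof (intro conjI allI holomorphic_eta)
  fix N :: nat
  define c :: real where "c = 2 ^ (\<Sum>n<N. Suc n)"
  have "norm (eta z) * (1 + norm z) ^ N \<le> (2 ^ N * (1 + c)) * exp (1 * \<bar>Im z\<bar>)" for z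
  proof -
    have "(1 + norm z) ^ N \<le> (2 * max 1 (norm z)) ^ N" by (intro power_mono) auto
    also have "\<dots> = 2 ^ N * max 1 (norm z) ^ N" by (simp add: power_mult_distrib)
    also have "\<dots> \<le> 2 ^ N * (1 + norm z ^ N)" by (intro mult_left_mono) (auto simp: max_def)
    finally have "norm (eta z) * (1 + norm z) ^ N \<le> norm (eta z) * (2 ^ N * (1 + norm z ^ N))"
      by (intro mult_left_mono) auto
    also have "\<dots> = 2 ^ N * (norm (eta z) + norm (eta z) * norm z ^ N)" by (simp add: algebra_simps)
    also have "\<dots> \<le> 2 ^ N * (exp \<bar>Im z\<bar> + c * exp \<bar>Im z\<bar>)"
      using norm_eta_le[of z] eta_power_bound[of z N] by (intro mult_left_mono add_mono) (auto simp: c_def)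
    finally show ?thesis by (simp add: algebra_simps)
  qed
  thus "\<exists>C. \<forall>z. norm (eta z) * (1 + norm z) ^ N \<le> C * exp (1 * \<bar>Im z\<bar>)" by blast
qed

section \<open>Restriction to the real line: Schwartz decay and Fourier support\<close>

lemma has_real_derivative_Re_of_real:
  assumes "g holomorphic_on UNIV"
  shows "((\<lambda>x. Re (g (of_real x))) has_real_derivative Re (deriv g (of_real x))) (at x)"
proof -
  have "(g has_field_derivative deriv g (of_real x)) (at (of_real x))"
    using holomorphic_derivI[OF assms open_UNIV] by simp
  hence "((g \<circ> of_real) has_vector_derivative 1 * deriv g (of_real x)) (at x)"
    by (intro field_vector_diff_chain_at) (auto intro!: derivative_eq_intros)
  hence "((\<lambda>x. Re ((g \<circ> of_real) x)) has_vector_derivative Re (deriv g (of_real x))) (at x)"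
    using bounded_linear.has_vector_derivative[OF bounded_linear_Re] by fastforce
  thus ?thesis by (simp add: has_real_derivative_iff_has_vector_derivative o_def)
qed

lemma higher_deriv_Re_of_real:
  assumes "g holomorphic_on UNIV"
  shows "(deriv ^^ n) (\<lambda>x. Re (g (of_real x))) = (\<lambda>x. Re ((deriv ^^ n) g (of_real x)))"
proof (induction n)
  case (Suc n)
  have "(deriv ^^ Suc n) (\<lambda>x. Re (g (of_real x))) = deriv (\<lambda>x. Re ((deriv ^^ n) g (of_real x)))"
    by (simp add: Suc.IH)
  also have "\<dots> = (\<lambda>x. Re (deriv ((deriv ^^ n) g) (of_real x)))"
    by (intro ext DERIV_imp_deriv has_real_derivative_Re_of_real holomorphic_higher_deriv assms open_UNIV)
  finally show ?case by simp
qed auto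

text \<open>Cauchy's inequality on the unit circle around x passes the decay to all derivatives:
  there |Im w| <= 1, so the exponential factor is at most exp \<sigma>.\<close>

lemma rapid_type_schwartz:
  assumes "rapid_type \<Phi> \<sigma>" "0 \<le> \<sigma>"
  shows "schwartz (\<lambda>x. Re (\<Phi> (of_real x)))"
  unfolding schwartz_def
proof (intro conjI allI)
  have hol: "\<Phi> holomorphic_on UNIV" using assms(1) by (simp add: rapid_type_def)
  note hd = higher_deriv_Re_of_real[OF hol]
  show "((deriv ^^ k) (\<lambda>x. Re (\<Phi> (of_real x)))) differentiable (at x)" for k x
    unfolding hd using has_real_derivative_Re_of_real[OF holomorphic_higher_deriv[OF hol open_UNIV]]
    real_differentiable_def by blast
  fix j k :: nat
  obtain C where C: "\<And>z. norm (\<Phi> z) * (1 + norm z) ^ j \<le> C * exp (\<sigma> * \<bar>Im z\<bar>)"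
    using assms(1) unfolding rapid_type_def by blast
  have C0: "C \<ge> 0" using order_trans[OF _ C[of 0]] by simp
  have bd: "\<bar>x\<bar> ^ j * norm ((deriv ^^ k) \<Phi> (of_real x)) \<le> fact k * (C * exp \<sigma>)" for x :: real
  \<comment> \<open>This case is trivial and is set apart because the Cauchy estimate divides by
    |x|^j.\<close>
  proof (cases "x = 0 \<and> j > 0")
    case True
    thus ?thesis using C0 by (auto simp: power_0_left)
  next
    case False
    hence pos: "\<bar>x\<bar> ^ j > 0" by (cases "j = 0") auto
    have "norm ((deriv ^^ k) \<Phi> (of_real x)) \<le> fact k * (C * exp \<sigma> / \<bar>x\<bar> ^ j) / 1 ^ k"
    proof (rule Cauchy_inequality)
      fix w :: complex assume w: "norm (of_real x - w) = 1"
      have "\<bar>x\<bar> \<le> 1 + norm w" using norm_triangle_ineq2[of "of_real x" w] w by simp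
      hence "norm (\<Phi> w) * \<bar>x\<bar> ^ j \<le> norm (\<Phi> w) * (1 + norm w) ^ j"
        by (intro mult_left_mono power_mono) auto
      also have "\<dots> \<le> C * exp (\<sigma> * \<bar>Im w\<bar>)" by (rule C)
      also have "\<dots> \<le> C * exp (\<sigma> * 1)"
        using abs_Im_le_cmod[of "of_real x - w"] w assms(2) C0
        by (intro mult_left_mono exp_le_cancel_iff[THEN iffD2]) auto
      finally show "norm (\<Phi> w) \<le> C * exp \<sigma> / \<bar>x\<bar> ^ j" using pos by (simp add: field_simps)
    qed (auto intro!: holomorphic_on_imp_continuous_on holomorphic_on_subset[OF hol])
    thus ?thesis using pos by (simp add: field_simps)
  qed
  show "bounded (range (\<lambda>x. x ^ j * (deriv ^^ k) (\<lambda>x. Re (\<Phi> (of_real x))) x))"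
  proof (rule boundedI[where B = "fact k * (C * exp \<sigma>)"], safe)
    fix x :: real
    have "norm (x ^ j * (deriv ^^ k) (\<lambda>x. Re (\<Phi> (of_real x))) x) = \<bar>x\<bar> ^ j * \<bar>Re ((deriv ^^ k) \<Phi> (of_real x))\<bar>"
      unfolding hd by (simp add: abs_mult power_abs)
    also have "\<dots> \<le> \<bar>x\<bar> ^ j * norm ((deriv ^^ k) \<Phi> (of_real x))"
      by (intro mult_left_mono abs_Re_le_cmod) auto
    also note bd
    finally show "norm (x ^ j * (deriv ^^ k) (\<lambda>x. Re (\<Phi> (of_real x))) x) \<le> fact k * (C * exp \<sigma>)" .
  qed
qed

lemma integrable_inverse_one_plus_square: "integrable lborel (\<lambda>x::real. 1 / (1 + x\<^sup>2))"
proof -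
  define h where "h x = 1 / (1 + x\<^sup>2) * indicator {0..} x" for x :: real
  have h: "integrable lborel h"
  proof (rule integrableI_nonneg)
    show "h \<in> borel_measurable lborel" unfolding h_def by measurable
    have "(\<integral>\<^sup>+x. ennreal (h x) \<partial>lborel) = (\<integral>\<^sup>+x. ennreal (1 / (1 + x\<^sup>2)) * indicator {0..} x \<partial>lborel)"
      by (intro nn_integral_cong) (auto simp: h_def indicator_def)
    also have "\<dots> = ennreal (pi / 2 - arctan 0)"
    proof (rule nn_integral_FTC_atLeast)
      show "(arctan has_real_derivative 1 / (1 + x\<^sup>2)) (at x)" for x
        by (auto intro!: derivative_eq_intros simp: inverse_eq_divide)
    qed (auto intro: tendsto_arctan_at_top)
    finally show "(\<integral>\<^sup>+x. ennreal (h x) \<partial>lborel) < \<infinity>" by simp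
    show "AE x in lborel. 0 \<le> h x" by (auto simp: h_def)
  qed
  have hm: "integrable lborel (\<lambda>x. h (- x))"
    using lborel_integrable_real_affine[OF h, of "-1" 0] by simp
  show ?thesis
  proof (rule Bochner_Integration.integrable_bound[OF Bochner_Integration.integrable_add[OF h hm]])
    show "AE x in lborel. norm (1 / (1 + x\<^sup>2)) \<le> norm (h x + h (- x))"
      by (intro AE_I2) (auto simp: h_def indicator_def)
  qed measurable
qed

text \<open>One direction of Paley-Wiener by a contour shift: the integral over [-n, n] equals the
  one over the other three sides of a rectangle of depth n. The condition on y makes the decay of
  the exponential offset the growth exp(\<sigma> t), so the integrand is at most C / (1 + n)^2 on a
  path of length 4n.\<close>

lemma rapid_type_fourier_zero:
  assumes rapid: "rapid_type \<Phi> \<sigma>" and re: "\<And>x. Im (\<Phi> (of_real x)) = 0"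
    and y: "\<sigma> \<le> 2 * pi * \<bar>y\<bar>"
  shows "fourier (\<lambda>x. Re (\<Phi> (of_real x))) y = 0"
proof -
  have hol: "\<Phi> holomorphic_on UNIV" using rapid by (simp add: rapid_type_def)
  obtain C where C: "\<And>z. norm (\<Phi> z) * (1 + norm z) ^ 2 \<le> C * exp (\<sigma> * \<bar>Im z\<bar>)"
    using rapid unfolding rapid_type_def by blast
  have C0: "C \<ge> 0" using order_trans[OF _ C[of 0]] by simp
  \<comment> \<open>The sign of y selects the half-plane into which the contour is moved: downwards
    for y >= 0.\<close>
  define s :: real where "s = (if y \<ge> 0 then 1 else -1)"
  have sy: "s * y = \<bar>y\<bar>" "\<bar>s\<bar> = 1" by (auto simp: s_def)
  define g where "g w = \<Phi> w * exp (- (2 * pi * \<i> * of_real y) * w)" for w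
  have holg: "g holomorphic_on UNIV" unfolding g_def by (intro holomorphic_intros hol)
  have gb: "norm (g w) \<le> C / (1 + norm w)\<^sup>2" if "Im w = - s * t" "t \<ge> 0" for w t
  proof -
    have pos: "(1 + norm w)\<^sup>2 > 0" by (intro zero_less_power add_pos_nonneg) auto
    have "Re (- (2 * pi * \<i> * of_real y) * w) = - (2 * pi * \<bar>y\<bar>) * t"
      using that(1) sy(1) by (simp add: algebra_simps)
    hence "norm (g w) * (1 + norm w)\<^sup>2 = (norm (\<Phi> w) * (1 + norm w)\<^sup>2) * exp (- (2 * pi * \<bar>y\<bar>) * t)"
      by (simp add: g_def norm_mult)
    also have "\<dots> \<le> (C * exp (\<sigma> * \<bar>Im w\<bar>)) * exp (- (2 * pi * \<bar>y\<bar>) * t)"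
      by (intro mult_right_mono C) auto
    also have "\<bar>Im w\<bar> = t" using that sy(2) by (simp add: abs_mult)
    also have "(C * exp (\<sigma> * t)) * exp (- (2 * pi * \<bar>y\<bar>) * t) = C * exp ((\<sigma> - 2 * pi * \<bar>y\<bar>) * t)"
      by (simp add: algebra_simps flip: exp_add)
    also have "\<dots> \<le> C * 1"
      using C0 that(2) y by (intro mult_left_mono) (auto simp: mult_nonpos_nonneg)
    finally show ?thesis using pos by (simp add: field_simps)
  qed
  have gr: "norm (g (of_real x)) \<le> C * (1 / (1 + x\<^sup>2))" for x
  proof -
    have "norm (g (of_real x)) \<le> C / (1 + \<bar>x\<bar>)\<^sup>2" using gb[of "of_real x" 0] by simp
    also have "\<dots> \<le> C / (1 + x\<^sup>2)"
    proof (rule divide_left_mono[OF _ C0])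
      show "1 + x\<^sup>2 \<le> (1 + \<bar>x\<bar>)\<^sup>2" by (simp add: power2_eq_square algebra_simps)
      show "0 < (1 + \<bar>x\<bar>)\<^sup>2 * (1 + x\<^sup>2)" by (intro mult_pos_pos zero_less_power add_pos_nonneg) auto
    qed
    finally show ?thesis by simp
  qed
  have contg: "continuous_on UNIV (\<lambda>x::real. g (of_real x))"
    by (rule continuous_on_compose2[OF holomorphic_on_imp_continuous_on[OF holg]]) (auto intro: continuous_intros)
  have [measurable]: "(\<lambda>x::real. g (of_real x)) \<in> borel_measurable borel"
    by (rule borel_measurable_continuous_onI[OF contg])
  have dom: "integrable lborel (\<lambda>x. C * (1 / (1 + x\<^sup>2)))"
    by (intro integrable_mult_right integrable_inverse_one_plus_square)
  have intg: "integrable lborel (\<lambda>x. g (of_real x))"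
    by (rule Bochner_Integration.integrable_bound[OF dom]) (use gr C0 in \<open>auto intro!: AE_I2\<close>)
  obtain P where P: "\<And>x. (P has_field_derivative g x) (at x)"
    using holomorphic_convex_primitive'[OF convex_UNIV open_UNIV holg] by auto
  have seg: "norm (P a - P b) \<le> C / (1 + real n)\<^sup>2 * norm (a - b)"
    if "\<And>w. w \<in> closed_segment a b \<Longrightarrow> real n \<le> norm w \<and> (\<exists>t\<ge>0. Im w = - s * t)" for a b n
  proof (rule field_differentiable_bound[of "closed_segment a b" P g])
    show "(P has_field_derivative g z) (at z within closed_segment a b)" for z
      by (rule has_field_derivative_at_within[OF P])
    show "norm (g w) \<le> C / (1 + real n)\<^sup>2" if w: "w \<in> closed_segment a b" for w
    proof -
      from \<open>\<And>w. w \<in> closed_segment a b \<Longrightarrow> _\<close>[OF w] obtain t where t: "t \<ge> 0" "Im w = - s * t" "real n \<le> norm w" by blast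
      have "norm (g w) \<le> C / (1 + norm w)\<^sup>2" by (rule gb[OF t(2,1)])
      also have "\<dots> \<le> C / (1 + real n)\<^sup>2"
        using C0 t(3) by (intro divide_left_mono power_mono) (auto intro!: mult_pos_pos add_pos_nonneg)
      finally show ?thesis .
    qed
  qed auto
  define I where "I n = (LINT x|lborel. indicator {- real n..real n} x *\<^sub>R g (of_real x))" for n :: nat
  have I_eq: "I n = P (of_nat n) - P (- of_nat n)" for n
  proof -
    have "((\<lambda>x. g (of_real x)) has_integral P (of_real (real n)) - P (of_real (- real n))) {- real n..real n}"
    proof (rule fundamental_theorem_of_calculus)
      fix x
      have "((P \<circ> of_real) has_vector_derivative 1 * g (of_real x)) (at x within {- real n..real n})"
        by (intro field_vector_diff_chain_within has_field_derivative_at_within[OF P])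
          (auto intro!: derivative_eq_intros)
      thus "((\<lambda>x. P (of_real x)) has_vector_derivative g (of_real x)) (at x within {- real n..real n})"
        by (simp add: o_def)
    qed auto
    moreover have "set_integrable lborel {- real n..real n} (\<lambda>x. g (of_real x))"
      unfolding set_integrable_def using intg by (intro integrable_mult_indicator) auto
    ultimately show ?thesis
      using set_borel_integral_eq_integral(2)[of "{- real n..real n}" "\<lambda>x. g (of_real x)"]
      by (simp add: I_def set_lebesgue_integral_def integral_unique)
  qed
  have I_le: "norm (I n) \<le> 4 * C / (real n + 1)" for n
  proof -
    define N :: complex where "N = of_nat n"
    \<comment> \<open>The rectangle has corners N, -N, N + D and -N + D. Every point on its three
      new sides has modulus at least n.\<close>
    define D :: complex where "D = of_real (- s * real n) * \<i>"
    have re_part: "real n \<le> norm w" if "\<bar>Re w\<bar> = real n \<or> \<bar>Im w\<bar> = real n" for w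
      using that abs_Re_le_cmod[of w] abs_Im_le_cmod[of w] by auto
    have segs: "closed_segment N (N + D) = {N + of_real u * D | u. 0 \<le> u \<and> u \<le> 1}"
      "closed_segment (- N) (- N + D) = {- N + of_real u * D | u. 0 \<le> u \<and> u \<le> 1}"
      by (auto simp: closed_segment_def scaleR_conv_of_real algebra_simps)
    have a1: "norm (P N - P (N + D)) \<le> C / (1 + real n)\<^sup>2 * norm (N - (N + D))"
    proof (rule seg)
      fix w assume "w \<in> closed_segment N (N + D)"
      then obtain u where u: "0 \<le> u" "u \<le> 1" "w = N + of_real u * D" unfolding segs by blast
      have "Im w = - s * (u * real n)" "Re w = real n" unfolding u D_def N_def by simp_all
      thus "real n \<le> norm w \<and> (\<exists>t\<ge>0. Im w = - s * t)" using u re_part[of w] by (auto intro!: exI[of _ "u * real n"])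
    qed
    have a2: "norm (P (- N) - P (- N + D)) \<le> C / (1 + real n)\<^sup>2 * norm (- N - (- N + D))"
    proof (rule seg)
      fix w assume "w \<in> closed_segment (- N) (- N + D)"
      then obtain u where u: "0 \<le> u" "u \<le> 1" "w = - N + of_real u * D" unfolding segs by blast
      have "Im w = - s * (u * real n)" "Re w = - real n" unfolding u D_def N_def by simp_all
      thus "real n \<le> norm w \<and> (\<exists>t\<ge>0. Im w = - s * t)" using u re_part[of w] by (auto intro!: exI[of _ "u * real n"])
    qed
    have a3: "norm (P (N + D) - P (- N + D)) \<le> C / (1 + real n)\<^sup>2 * norm ((N + D) - (- N + D))"
    proof (rule seg)
      fix w assume "w \<in> closed_segment (N + D) (- N + D)"
      then obtain u where u: "w = (1 - u) *\<^sub>R (N + D) + u *\<^sub>R (- N + D)" unfolding closed_segment_def by blast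
      have "Im w = - s * real n" unfolding u D_def N_def by (simp add: algebra_simps)
      moreover have "\<bar>- s * real n\<bar> = real n" using sy(2) by (simp add: abs_mult)
      ultimately show "real n \<le> norm w \<and> (\<exists>t\<ge>0. Im w = - s * t)" using re_part[of w] by (auto intro!: exI[of _ "real n"])
    qed
    have nD: "norm D = real n" using sy(2) by (simp add: D_def norm_mult abs_mult)
    have a4: "norm (N - (N + D)) = real n" "norm (- N - (- N + D)) = real n" using nD by simp_all
    have a5: "norm ((N + D) - (- N + D)) = 2 * real n"
      by (simp add: N_def norm_mult flip: mult_2)
    have a6: "norm (I n) \<le> norm (P N - P (N + D)) + norm (P (N + D) - P (- N + D)) + norm (P (- N) - P (- N + D))"
    proof -
      have eq: "I n = (P N - P (N + D)) + (P (N + D) - P (- N + D)) - (P (- N) - P (- N + D))"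
        by (simp add: I_eq N_def)
      show ?thesis
        unfolding eq using norm_triangle_ineq4[of "(P N - P (N + D)) + (P (N + D) - P (- N + D))" "P (- N) - P (- N + D)"]
          norm_triangle_ineq[of "P N - P (N + D)" "P (N + D) - P (- N + D)"] by linarith
    qed
    have "norm (I n) \<le> C / (1 + real n)\<^sup>2 * real n + C / (1 + real n)\<^sup>2 * (2 * real n) + C / (1 + real n)\<^sup>2 * real n"
      using a6 a1[unfolded a4] a2[unfolded a4] a3[unfolded a5] by linarith
    also have "\<dots> = C / (1 + real n)\<^sup>2 * (4 * real n)" by simp
    finally have "norm (I n) \<le> C / (1 + real n)\<^sup>2 * (4 * real n)" .
    also have "\<dots> \<le> C / (1 + real n)\<^sup>2 * (4 * (1 + real n))"
      using C0 by (intro mult_left_mono) auto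
    also have "\<dots> = 4 * C / (real n + 1)"
    proof -
      have "C / m\<^sup>2 * (4 * m) = 4 * C / m" if "m \<noteq> 0" for m
        using that by (simp add: power2_eq_square)
      from this[of "1 + real n"] show ?thesis by (simp add: add.commute)
    qed
    finally show ?thesis .
  qed
  have "I \<longlonglongrightarrow> 0"
  proof (rule Lim_null_comparison)
    show "\<forall>\<^sub>F n in sequentially. norm (I n) \<le> 4 * C / (real n + 1)" using I_le by simp
    show "(\<lambda>n. 4 * C / (real n + 1)) \<longlonglongrightarrow> 0"
      using tendsto_mult[OF tendsto_const[of "4 * C"] LIMSEQ_inverse_real_of_nat]
      by (simp add: inverse_eq_divide add.commute)
  qed
  moreover have "I \<longlonglongrightarrow> (LINT x|lborel. g (of_real x))"
    unfolding I_def
  proof (rule integral_dominated_convergence[OF _ _ dom])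
    show "AE x in lborel. (\<lambda>n. indicator {- real n..real n} x *\<^sub>R g (of_real x)) \<longlonglongrightarrow> g (of_real x)"
    proof (rule AE_I2)
      fix x :: real
      obtain n0 where n0: "\<bar>x\<bar> \<le> real n0" using real_arch_simple by blast
      have "\<forall>\<^sub>F n in sequentially. indicator {- real n..real n} x *\<^sub>R g (of_real x) = g (of_real x)"
        unfolding eventually_sequentially using n0 by (intro exI[of _ n0]) (auto simp: indicator_def)
      thus "(\<lambda>n. indicator {- real n..real n} x *\<^sub>R g (of_real x)) \<longlonglongrightarrow> g (of_real x)"
        by (rule tendsto_eventually)
    qed
    show "AE x in lborel. norm (indicator {- real n..real n} x *\<^sub>R g (of_real x)) \<le> C * (1 / (1 + x\<^sup>2))" for n
      using gr C0 by (intro AE_I2) (auto simp: indicator_def)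
  qed measurable
  ultimately have "(LINT x|lborel. g (of_real x)) = 0" using LIMSEQ_unique by blast
  moreover have "g (of_real x) = cis (- 2 * pi * x * y) * of_real (Re (\<Phi> (of_real x)))" for x
  proof -
    have "of_real (Re (\<Phi> (of_real x))) = \<Phi> (of_real x)" using re[of x] by (simp add: complex_eq_iff)
    moreover have "cis (- 2 * pi * x * y) = exp (- (2 * pi * \<i> * of_real y) * of_real x)"
      by (simp add: cis_conv_exp mult_ac)
    ultimately show ?thesis by (simp add: g_def mult.commute)
  qed
  ultimately show ?thesis by (simp add: fourier_def)
qed

subsection \<open>Test functions\<close>

lemma borel_measurable_holomorphic_of_real:
  assumes "f holomorphic_on UNIV" "g \<in> borel_measurable borel"
  shows "(\<lambda>x::real. f (of_real (g x))) \<in> borel_measurable borel"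
proof -
  have "continuous_on UNIV (\<lambda>x::real. f (of_real x))"
    by (rule continuous_on_compose2[OF holomorphic_on_imp_continuous_on[OF assms(1)]]) (auto intro: continuous_intros)
  from measurable_compose[OF assms(2) borel_measurable_continuous_onI[OF this]] show ?thesis .
qed

text \<open>The squares double the types of F and \<open>eta\<close>. One factor \<open>eta\<close>
  pays for all polynomial growth, the other is merely bounded by its exponential.\<close>

lemma rapid_type_test_function:
  fixes r \<rho> \<delta> \<tau> C :: real
  assumes holF: "F holomorphic_on UNIV" and Fb: "\<And>z. norm (F z) \<le> C * exp (\<tau> * \<bar>Im z\<bar>)"
    and rho: "0 < \<rho>" and d: "0 < \<delta>"
  shows "rapid_type (\<lambda>z. (of_real (r\<^sup>2) - z\<^sup>2) * (F (of_real \<rho> * z))\<^sup>2 * (eta (of_real \<delta> * z))\<^sup>2) (2 * (\<tau> * \<rho> + \<delta>))"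
  unfolding rapid_type_def
proof (intro conjI allI)
  have "(F \<circ> (\<lambda>z. of_real \<rho> * z)) holomorphic_on UNIV" "(eta \<circ> (\<lambda>z. of_real \<delta> * z)) holomorphic_on UNIV"
    by (intro holomorphic_on_compose_gen[OF _ holF] holomorphic_on_compose_gen[OF _ holomorphic_eta] holomorphic_intros; auto)+
  thus "(\<lambda>z. (of_real (r\<^sup>2) - z\<^sup>2) * (F (of_real \<rho> * z))\<^sup>2 * (eta (of_real \<delta> * z))\<^sup>2) holomorphic_on UNIV"
    by (intro holomorphic_intros) (auto simp: o_def)
  fix N :: nat
  \<comment> \<open>Two powers beyond N absorb the quadratic factor r^2 - z^2.\<close>
  obtain D where D: "\<And>z. norm (eta z) * (1 + norm z) ^ (N + 2) \<le> D * exp (1 * \<bar>Im z\<bar>)"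
    using eta_rapid unfolding rapid_type_def by blast
  have D0: "D \<ge> 0" using order_trans[OF _ D[of 0]] by simp
  have C0: "C \<ge> 0" using order_trans[OF norm_ge_zero Fb[of 0]] by simp
  \<comment> \<open>Accounts for the rescaling: 1 + |z| <= m (1 + \<delta> |z|).\<close>
  define m where "m = 1 + 1 / \<delta>"
  have m: "m \<ge> 0" using d by (simp add: m_def)
  have "norm ((of_real (r\<^sup>2) - z\<^sup>2) * (F (of_real \<rho> * z))\<^sup>2 * (eta (of_real \<delta> * z))\<^sup>2) * (1 + norm z) ^ N
      \<le> ((r\<^sup>2 + 1) * C\<^sup>2 * (m ^ (N + 2) * D)) * exp (2 * (\<tau> * \<rho> + \<delta>) * \<bar>Im z\<bar>)" for z
  proof -
    define y where "y = \<bar>Im z\<bar>"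
    have Im: "\<bar>Im (of_real \<rho> * z)\<bar> = \<rho> * y" "\<bar>Im (of_real \<delta> * z)\<bar> = \<delta> * y"
      using rho d by (auto simp: y_def abs_mult)
    have 1: "norm (of_real (r\<^sup>2) - z\<^sup>2) \<le> (r\<^sup>2 + 1) * (1 + norm z) ^ 2"
    proof -
      have "norm (of_real (r\<^sup>2) - z\<^sup>2) \<le> norm (of_real (r\<^sup>2) :: complex) + norm (z\<^sup>2)"
        by (rule norm_triangle_ineq4)
      also have "\<dots> = r\<^sup>2 + (norm z)\<^sup>2" by (simp add: norm_power)
      also have "\<dots> \<le> (r\<^sup>2 + 1) * (1 + norm z) ^ 2"
      proof -
        have "(r\<^sup>2 + 1) * (1 + norm z) ^ 2 = (r\<^sup>2 + (norm z)\<^sup>2) + (1 + 2 * norm z + r\<^sup>2 * (norm z)\<^sup>2 + 2 * r\<^sup>2 * norm z)"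
          by (simp add: power2_eq_square algebra_simps)
        thus ?thesis by (simp add: add_nonneg_nonneg)
      qed
      finally show ?thesis .
    qed
    have 2: "(norm (F (of_real \<rho> * z)))\<^sup>2 \<le> (C * exp (\<tau> * (\<rho> * y)))\<^sup>2"
      using Fb[of "of_real \<rho> * z"] unfolding Im by (intro power_mono) auto
    have 3: "norm (eta (of_real \<delta> * z)) \<le> exp (\<delta> * y)"
      using norm_eta_le[of "of_real \<delta> * z"] unfolding Im .
    have 4: "norm (eta (of_real \<delta> * z)) * (1 + norm z) ^ (N + 2) \<le> m ^ (N + 2) * (D * exp (\<delta> * y))"
    proof -
      have "1 + norm z \<le> m * (1 + norm (of_real \<delta> * z))"
      proof -
        have "m * (1 + norm (of_real \<delta> * z)) = (1 + norm z) + (1 / \<delta> + \<delta> * norm z)"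
          using d by (simp add: m_def norm_mult field_simps)
        thus ?thesis using d by simp
      qed
      hence "(1 + norm z) ^ (N + 2) \<le> (m * (1 + norm (of_real \<delta> * z))) ^ (N + 2)"
        by (intro power_mono) auto
      hence "norm (eta (of_real \<delta> * z)) * (1 + norm z) ^ (N + 2)
          \<le> norm (eta (of_real \<delta> * z)) * (m ^ (N + 2) * (1 + norm (of_real \<delta> * z)) ^ (N + 2))"
        unfolding power_mult_distrib by (intro mult_left_mono) auto
      also have "\<dots> = m ^ (N + 2) * (norm (eta (of_real \<delta> * z)) * (1 + norm (of_real \<delta> * z)) ^ (N + 2))"
        by (simp only: mult_ac)
      also have "\<dots> \<le> m ^ (N + 2) * (D * exp (\<delta> * y))"
        using D[of "of_real \<delta> * z"] m unfolding Im by (intro mult_left_mono) auto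
      finally show ?thesis .
    qed
    have "norm ((of_real (r\<^sup>2) - z\<^sup>2) * (F (of_real \<rho> * z))\<^sup>2 * (eta (of_real \<delta> * z))\<^sup>2) * (1 + norm z) ^ N
      \<le> ((r\<^sup>2 + 1) * (1 + norm z) ^ 2) * (C * exp (\<tau> * (\<rho> * y)))\<^sup>2 * (norm (eta (of_real \<delta> * z)) * exp (\<delta> * y)) * (1 + norm z) ^ N"
      unfolding norm_mult norm_power using 1 2 3
      by (intro mult_right_mono mult_mono) (auto simp: power2_eq_square intro!: mult_left_mono)
    also have "\<dots> = ((r\<^sup>2 + 1) * (C * exp (\<tau> * (\<rho> * y)))\<^sup>2 * exp (\<delta> * y)) * (norm (eta (of_real \<delta> * z)) * (1 + norm z) ^ (N + 2))"
      by (simp add: power_add power2_eq_square mult_ac)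
    also have "\<dots> \<le> ((r\<^sup>2 + 1) * (C * exp (\<tau> * (\<rho> * y)))\<^sup>2 * exp (\<delta> * y)) * (m ^ (N + 2) * (D * exp (\<delta> * y)))"
      by (intro mult_left_mono 4) auto
    also have "\<dots> = ((r\<^sup>2 + 1) * C\<^sup>2 * (m ^ (N + 2) * D)) * (exp (\<tau> * (\<rho> * y)) * exp (\<tau> * (\<rho> * y)) * exp (\<delta> * y) * exp (\<delta> * y))"
      by (simp add: power2_eq_square mult_ac)
    also have "exp (\<tau> * (\<rho> * y)) * exp (\<tau> * (\<rho> * y)) * exp (\<delta> * y) * exp (\<delta> * y) = exp (2 * (\<tau> * \<rho> + \<delta>) * \<bar>Im z\<bar>)"
      unfolding exp_add[symmetric] by (simp add: y_def algebra_simps)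
    finally show ?thesis .
  qed
  thus "\<exists>D. \<forall>z. norm ((of_real (r\<^sup>2) - z\<^sup>2) * (F (of_real \<rho> * z))\<^sup>2 * (eta (of_real \<delta> * z))\<^sup>2) * (1 + norm z) ^ N
      \<le> D * exp (2 * (\<tau> * \<rho> + \<delta>) * \<bar>Im z\<bar>)" by blast
qed

lemma (in even_weight) test_function_exists:
  fixes \<Delta> \<xi> r :: real
  defines "a \<equiv> \<lambda>x::real. Re ((1 - \<i> * of_real x) * repkernel W (pi * \<Delta>) \<i> (of_real x))"
  assumes W_cont: "\<And>x. x \<noteq> 0 \<Longrightarrow> isCont W x" and Delta: "0 < \<Delta>"
    and xi: "0 < \<xi>" "a \<xi> = 0" and nontriv: "a x0 \<noteq> 0" and r: "\<xi> < r"
  obtains \<phi> where "schwartz \<phi>" "\<And>x. \<phi> (- x) = \<phi> x"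
    "closure {y. fourier \<phi> y \<noteq> 0} \<subseteq> {- \<Delta> <..< \<Delta>}"
    "\<And>x. r \<le> \<bar>x\<bar> \<Longrightarrow> \<phi> x \<le> 0" "0 < (LINT x|lborel. \<phi> x * W x)"
proof -
  define \<tau> where "\<tau> = pi * \<Delta>"
  have tau: "0 < \<tau>" using Delta by (simp add: \<tau>_def)
  obtain F C where F: "F holomorphic_on UNIV" "\<And>z. F (- z) = F z" "\<And>x. Im (F (of_real x)) = 0"
    and Fb: "\<And>z. norm (F z) \<le> C * exp (\<tau> * \<bar>Im z\<bar>)"
    and intF: "integrable lborel (\<lambda>x. (1 + x\<^sup>2) * (norm (F (of_real x)))\<^sup>2)"
    and int0: "(LINT x|lborel. (x\<^sup>2 - \<xi>\<^sup>2) * (norm (F (of_real x)))\<^sup>2 * W x) = 0"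
    and Fx0: "F (of_real x0) \<noteq> 0"
    by (rule extremal_function_exists[OF less_imp_le[OF tau] xi(1) xi(2)[unfolded a_def, folded \<tau>_def]
          nontriv[unfolded a_def, folded \<tau>_def]]) (rule that, assumption+)
  define p where "p x = (norm (F (of_real x)))\<^sup>2" for x
  have p_meas [measurable]: "p \<in> borel_measurable borel"
  proof -
    have "(\<lambda>x. F (of_real x)) \<in> borel_measurable borel"
      using borel_measurable_holomorphic_of_real[OF F(1), of "\<lambda>x. x"] by simp
    thus ?thesis unfolding p_def[abs_def] by measurable
  qed
  have p0: "p x \<ge> 0" for x by (simp add: p_def)
  have intw: "integrable lborel (\<lambda>x. q x * p x * W x)"
    if [measurable]: "q \<in> borel_measurable borel" and q: "\<And>x. \<bar>q x\<bar> \<le> 1 + x\<^sup>2" for q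
  proof (rule Bochner_Integration.integrable_bound[OF integrable_mult_right[of 2, OF intF]])
    have "\<bar>q x * p x * W x\<bar> \<le> (1 + x\<^sup>2) * p x * 2" for x
      unfolding abs_mult using q[of x] p0[of x] W_le[of x] W_nonneg[of x] by (intro mult_mono) auto
    thus "AE x in lborel. norm (q x * p x * W x) \<le> norm (2 * ((1 + x\<^sup>2) * (norm (F (of_real x)))\<^sup>2))"
      by (intro AE_I2) (auto simp: p_def abs_mult mult_ac)
  qed measurable
  have int1: "integrable lborel (\<lambda>x. p x * W x)" using intw[of "\<lambda>x. 1"] by simp
  have int2: "integrable lborel (\<lambda>x. x\<^sup>2 * p x * W x)" using intw[of "\<lambda>x. x\<^sup>2"] by simp
  have FH: "F \<in> HSpace W \<tau>"
    using F(1) exp_type_leI[OF Fb] tau int1 by (simp add: HSpace_def p_def[abs_def])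
  have sq: "sqnorm F = (LINT x|lborel. p x * W x)" by (simp add: sqnorm_def p_def)
  have sqpos: "sqnorm F > 0"
  proof -
    have "sqnorm F \<noteq> 0" using HSpace_eq_0[OF FH _ less_imp_le[OF tau], of "of_real x0"] Fx0 by blast
    thus ?thesis using sqnorm_nonneg[of F] by linarith
  qed
  have J0: "(LINT x|lborel. x\<^sup>2 * p x * W x) = \<xi>\<^sup>2 * sqnorm F"
  proof -
    have "0 = (LINT x|lborel. x\<^sup>2 * p x * W x - \<xi>\<^sup>2 * (p x * W x))"
      using int0 by (simp add: p_def algebra_simps)
    also have "\<dots> = (LINT x|lborel. x\<^sup>2 * p x * W x) - \<xi>\<^sup>2 * sqnorm F"
      using int1 int2 by (simp add: sq)
    finally show ?thesis by simp
  qed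
  have J: "(LINT x|lborel. (r\<^sup>2 - x\<^sup>2) * p x * W x) = (r\<^sup>2 - \<xi>\<^sup>2) * sqnorm F"
  proof -
    have "(LINT x|lborel. (r\<^sup>2 - x\<^sup>2) * p x * W x) = (LINT x|lborel. r\<^sup>2 * (p x * W x) - x\<^sup>2 * p x * W x)"
      by (simp add: algebra_simps)
    also have "\<dots> = r\<^sup>2 * sqnorm F - \<xi>\<^sup>2 * sqnorm F" using int1 int2 J0 by (simp add: sq)
    finally show ?thesis by (simp add: algebra_simps)
  qed
  have Jpos: "(r\<^sup>2 - \<xi>\<^sup>2) * sqnorm F > 0"
    using sqpos r xi by (intro mult_pos_pos) (auto intro!: power_strict_mono)
  \<comment> \<open>The offset 2 keeps \<epsilon> n at most 1/2, hence \<rho> n at least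
    1/2.\<close>
  define \<epsilon> where "\<epsilon> n = 1 / real (n + 2)" for n
  have eps: "0 < \<epsilon> n" "\<epsilon> n \<le> 1/2" for n by (auto simp: \<epsilon>_def field_simps)
  have eps_lim: "\<epsilon> \<longlonglongrightarrow> 0"
    using LIMSEQ_ignore_initial_segment[OF lim_1_over_n[where 'a = real], of 2] by (simp add: \<epsilon>_def[abs_def])
  define \<rho> where "\<rho> n = 1 - \<epsilon> n" for n
  \<comment> \<open>With this choice the total type is 2 pi \<Delta> (1 - \<epsilon> n / 2),
    strictly below 2 pi \<Delta>, so the closed support fits into the open interval.\<close>
  define \<delta> where "\<delta> n = \<tau> * \<epsilon> n / 2" for n
  have rho: "1/2 \<le> \<rho> n" "\<rho> n < 1" for n using eps[of n] by (auto simp: \<rho>_def)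
  have del: "0 < \<delta> n" for n using eps[of n] tau by (simp add: \<delta>_def)
  define \<Phi> where "\<Phi> n z = (of_real (r\<^sup>2) - z\<^sup>2) * (F (of_real (\<rho> n) * z))\<^sup>2 * (eta (of_real (\<delta> n) * z))\<^sup>2" for n z
  define e where "e x = (norm (eta (of_real x)))\<^sup>2" for x
  have e_meas [measurable]: "e \<in> borel_measurable borel"
  proof -
    have "(\<lambda>x. eta (of_real x)) \<in> borel_measurable borel"
      using borel_measurable_holomorphic_of_real[OF holomorphic_eta, of "\<lambda>x. x"] by simp
    thus ?thesis unfolding e_def[abs_def] by measurable
  qed
  have e01: "0 \<le> e x" "e x \<le> 1" for x
    using norm_eta_le[of "of_real x"] by (auto simp: e_def power_le_one)
  have e_lim: "(\<lambda>n. e (u n)) \<longlonglongrightarrow> 1" if "u \<longlonglongrightarrow> 0" for u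
  proof -
    have "isCont eta 0" using holomorphic_on_imp_continuous_on[OF holomorphic_eta] by (simp add: continuous_on_eq_continuous_at)
    hence "(\<lambda>n. eta (of_real (u n))) \<longlonglongrightarrow> eta 0"
      by (rule isCont_tendsto_compose) (use tendsto_of_real[OF that] in simp)
    from tendsto_power[OF tendsto_norm[OF this], of 2] show ?thesis by (simp add: e_def eta_0)
  qed
  define \<phi> where "\<phi> n x = (r\<^sup>2 - x\<^sup>2) * p (\<rho> n * x) * e (\<delta> n * x)" for n x
  have real_sq: "w\<^sup>2 = of_real ((norm w)\<^sup>2)" if "Im w = 0" for w :: complex
    using that by (simp add: complex_eq_iff power2_eq_square cmod_def)
  have \<Phi>_real: "\<Phi> n (of_real x) = of_real (\<phi> n x)" for n x
    using real_sq[OF F(3)[of "\<rho> n * x"]] real_sq[OF Im_eta_of_real[of "\<delta> n * x"]]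
    by (simp add: \<Phi>_def \<phi>_def p_def e_def)
  have \<phi>_eq: "\<phi> n = (\<lambda>x. Re (\<Phi> n (of_real x)))" for n by (simp add: \<Phi>_real)
  have rapid: "rapid_type (\<Phi> n) (2 * (\<tau> * \<rho> n + \<delta> n))" for n
    unfolding \<Phi>_def using rho[of n] del[of n] by (intro rapid_type_test_function[OF F(1) Fb]) auto
  have schwartz: "schwartz (\<phi> n)" for n
    unfolding \<phi>_eq using rho[of n] del[of n] tau by (intro rapid_type_schwartz[OF rapid]) auto
  have even: "\<phi> n (- x) = \<phi> n x" for n x
    by (simp add: \<phi>_def p_def e_def F(2) eta_even)
  have neg: "\<phi> n x \<le> 0" if "r \<le> \<bar>x\<bar>" for n x
  proof -
    have "r\<^sup>2 \<le> x\<^sup>2" using that r xi by (intro abs_le_square_iff[THEN iffD1]) auto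
    thus ?thesis using p0 e01(1) by (simp add: \<phi>_def mult_nonpos_nonneg)
  qed
  have supp: "closure {y. fourier (\<phi> n) y \<noteq> 0} \<subseteq> {- \<Delta> <..< \<Delta>}" for n
  proof -
    define b where "b = \<Delta> * (1 - \<epsilon> n / 2)"
    have eq: "2 * (\<tau> * \<rho> n + \<delta> n) = 2 * pi * b" by (simp add: \<rho>_def \<delta>_def \<tau>_def b_def algebra_simps)
    have "{y. fourier (\<phi> n) y \<noteq> 0} \<subseteq> {- b..b}"
    proof safe
      fix y assume nz: "fourier (\<phi> n) y \<noteq> 0"
      have "\<not> 2 * pi * b \<le> 2 * pi * \<bar>y\<bar>"
        using rapid_type_fourier_zero[OF rapid[of n], of y] nz unfolding \<phi>_eq eq by (auto simp: \<Phi>_real)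
      hence "\<bar>y\<bar> < b" by simp
      thus "y \<in> {- b..b}" by auto
    qed
    hence "closure {y. fourier (\<phi> n) y \<noteq> 0} \<subseteq> {- b..b}" by (rule closure_minimal) auto
    moreover have "b < \<Delta>" using Delta eps[of n] by (simp add: b_def)
    ultimately show ?thesis by force
  qed
  \<comment> \<open>The substitution y = \<rho> x moves the dilation from F to the polynomial, the
    cutoff and the weight. Then F(y)^2 is a fixed factor and dominated convergence applies.\<close>
  define s where "s n y = (r\<^sup>2 - (y / \<rho> n)\<^sup>2) * p y * e (\<delta> n / \<rho> n * y) * W (y / \<rho> n)" for n y
  have subst: "(LINT x|lborel. \<phi> n x * W x) = (1 / \<rho> n) * (LINT y|lborel. s n y)" for n
  proof -
    have "(LINT x|lborel. \<phi> n x * W x) = \<bar>1 / \<rho> n\<bar> *\<^sub>R (LINT y|lborel. \<phi> n (0 + 1 / \<rho> n * y) * W (0 + 1 / \<rho> n * y))"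
      using rho[of n] by (intro lborel_integral_real_affine[of "1 / \<rho> n" "\<lambda>x. \<phi> n x * W x" 0]) auto
    moreover have "\<phi> n (0 + 1 / \<rho> n * y) * W (0 + 1 / \<rho> n * y) = s n y" for y
      using rho[of n] by (simp add: \<phi>_def s_def)
    ultimately show ?thesis using rho[of n] by simp
  qed
  have rho_lim: "\<rho> \<longlonglongrightarrow> 1" unfolding \<rho>_def[abs_def] using tendsto_diff[OF tendsto_const[of 1] eps_lim] by simp
  have del_lim: "\<delta> \<longlonglongrightarrow> 0"
    unfolding \<delta>_def[abs_def] using tendsto_mult[OF tendsto_const[of "\<tau> / 2"] eps_lim] by simp
  have "(\<lambda>n. LINT y|lborel. s n y) \<longlonglongrightarrow> (LINT y|lborel. (r\<^sup>2 - y\<^sup>2) * p y * W y)"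
  proof (rule integral_dominated_convergence)
    \<comment> \<open>The 4 comes from \<rho> n >= 1/2, the 2 from W <= 2, and the cutoff is at most
      1.\<close>
    show "integrable lborel (\<lambda>x. (2 * (r\<^sup>2 + 4)) * ((1 + x\<^sup>2) * (norm (F (of_real x)))\<^sup>2))"
      by (rule integrable_mult_right[OF intF])
    show "s n \<in> borel_measurable lborel" for n unfolding s_def by measurable
    show "(\<lambda>y. (r\<^sup>2 - y\<^sup>2) * p y * W y) \<in> borel_measurable lborel" by measurable
    show "AE y in lborel. (\<lambda>n. s n y) \<longlonglongrightarrow> (r\<^sup>2 - y\<^sup>2) * p y * W y"
    \<comment> \<open>Continuity of W is available only off the origin, which is a null set.\<close>
    proof (rule AE_mp[OF AE_lborel_singleton[of 0]], rule AE_I2, rule impI)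
      fix y :: real assume y: "y \<noteq> 0"
      have yl: "(\<lambda>n. y / \<rho> n) \<longlonglongrightarrow> y"
        using tendsto_divide[OF tendsto_const[of y] rho_lim] by simp
      have "(\<lambda>n. \<delta> n / \<rho> n * y) \<longlonglongrightarrow> 0 / 1 * y"
        by (intro tendsto_intros rho_lim del_lim) auto
      hence el: "(\<lambda>n. e (\<delta> n / \<rho> n * y)) \<longlonglongrightarrow> 1" by (intro e_lim) simp
      have Wl: "(\<lambda>n. W (y / \<rho> n)) \<longlonglongrightarrow> W y" by (rule isCont_tendsto_compose[OF W_cont[OF y] yl])
      have "(\<lambda>n. s n y) \<longlonglongrightarrow> (r\<^sup>2 - y\<^sup>2) * p y * 1 * W y"
        unfolding s_def by (intro tendsto_intros yl el Wl)
      thus "(\<lambda>n. s n y) \<longlonglongrightarrow> (r\<^sup>2 - y\<^sup>2) * p y * W y" by simp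
    qed
    fix n
    have "\<bar>s n y\<bar> \<le> ((r\<^sup>2 + 4) * (1 + y\<^sup>2)) * p y * 1 * 2" for y
    proof -
      have "(y / \<rho> n)\<^sup>2 \<le> 4 * y\<^sup>2"
      proof -
        have "\<bar>y / \<rho> n\<bar> \<le> \<bar>2 * y\<bar>"
          using rho(1)[of n] mult_left_mono[of "1/2" "\<rho> n" "2 * \<bar>y\<bar>"] by (simp add: abs_mult field_simps)
        hence "(y / \<rho> n)\<^sup>2 \<le> (2 * y)\<^sup>2" by (rule abs_le_square_iff[THEN iffD1])
        thus ?thesis by (simp add: power_mult_distrib)
      qed
      hence "\<bar>r\<^sup>2 - (y / \<rho> n)\<^sup>2\<bar> \<le> r\<^sup>2 + 4 * y\<^sup>2"
        using zero_le_power2[of r] zero_le_power2[of "y / \<rho> n"] by linarith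
      also have "\<dots> \<le> (r\<^sup>2 + 4) * (1 + y\<^sup>2)" by (simp add: algebra_simps)
      finally show ?thesis
        unfolding s_def abs_mult using p0[of y] e01[of "\<delta> n / \<rho> n * y"] W_le[of "y / \<rho> n"] W_nonneg[of "y / \<rho> n"]
        by (intro mult_mono) auto
    qed
    moreover have "((r\<^sup>2 + 4) * (1 + y\<^sup>2)) * p y * 1 * 2 = (2 * (r\<^sup>2 + 4)) * ((1 + y\<^sup>2) * (norm (F (of_real y)))\<^sup>2)" for y
      unfolding p_def by (simp only: mult_ac mult_1)
    ultimately show "AE y in lborel. norm (s n y) \<le> (2 * (r\<^sup>2 + 4)) * ((1 + y\<^sup>2) * (norm (F (of_real y)))\<^sup>2)"
      by (intro AE_I2) (simp only: real_norm_def)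
  qed
  hence "(\<lambda>n. LINT x|lborel. \<phi> n x * W x) \<longlonglongrightarrow> 1 / 1 * ((r\<^sup>2 - \<xi>\<^sup>2) * sqnorm F)"
    unfolding subst J by (intro tendsto_intros rho_lim) auto
  hence "\<forall>\<^sub>F n in sequentially. (LINT x|lborel. \<phi> n x * W x) > 0"
    using Jpos by (intro order_tendstoD(1)) auto
  then obtain n where "(LINT x|lborel. \<phi> n x * W x) > 0" by (auto simp: eventually_sequentially)
  thus thesis using that[of "\<phi> n"] schwartz even supp neg by blast
qed

subsection \<open>Low-lying zeros\<close>

text \<open>For u <= 2 the Taylor expansion leaves the coefficient 1/6 - u^2/120 >= 2/15 >= 1/10;
  beyond that the quotient is at most 1/2 <= 9/10. So 1/10 serves both ranges.\<close>

lemma abs_sin_div_le: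
  fixes u :: real
  assumes "0 < u"
  shows "\<bar>sin u\<bar> / u \<le> 1 - 1/10 * (u\<^sup>2 / (1 + u\<^sup>2))"
proof (cases "u \<le> 2")
  case True
  have "\<bar>sin u - (\<Sum>m<5. sin_coeff m * u ^ m)\<bar> \<le> inverse (fact 5) * \<bar>u\<bar> ^ 5"
    by (rule Maclaurin_sin_bound)
  moreover have "(\<Sum>m<5. sin_coeff m * u ^ m) = u - u ^ 3 / 6"
    by (simp add: sin_coeff_def lessThan_nat_numeral fact_numeral)
  moreover have "inverse (fact 5) * \<bar>u\<bar> ^ 5 = u ^ 5 / 120"
    using assms by (simp add: fact_numeral)
  ultimately have "sin u \<le> u - u ^ 3 / 6 + u ^ 5 / 120" by linarith
  also have "\<dots> = u * (1 - u\<^sup>2 * (1/6 - u\<^sup>2 / 120))"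
    by (simp add: algebra_simps eval_nat_numeral)
  also have "\<dots> \<le> u * (1 - u\<^sup>2 * (1/10))"
  proof -
    have "u\<^sup>2 \<le> 2\<^sup>2" using True assms by (intro power_mono) auto
    thus ?thesis using assms by (intro mult_left_mono diff_left_mono) auto
  qed
  also have "\<dots> \<le> u * (1 - 1/10 * (u\<^sup>2 / (1 + u\<^sup>2)))"
  proof -
    have "u\<^sup>2 / (1 + u\<^sup>2) \<le> u\<^sup>2 / 1" by (intro divide_left_mono) (auto intro: add_pos_nonneg)
    hence "1 - u\<^sup>2 * (1/10) \<le> 1 - 1/10 * (u\<^sup>2 / (1 + u\<^sup>2))" by linarith
    thus ?thesis using assms by (intro mult_left_mono) auto
  qed
  finally have "sin u \<le> u * (1 - 1/10 * (u\<^sup>2 / (1 + u\<^sup>2)))" .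
  moreover have "sin u \<ge> 0" using True assms pi_gt3 by (intro sin_ge_zero) auto
  ultimately show ?thesis using assms by (simp add: pos_divide_le_eq mult.commute)
next
  case False
  have "\<bar>sin u\<bar> / u \<le> 1 / 2" using False by (intro frac_le) auto
  moreover have "u\<^sup>2 / (1 + u\<^sup>2) \<le> 1" by (simp add: add_pos_nonneg)
  ultimately show ?thesis by linarith
qed

text \<open>Here u = 2 pi |x| >= |x|, and t^2 / (1 + t^2) increases with |t|. At x = 0 the totalised
  division gives \<open>sinc2 0 = 0\<close>.\<close>

lemma abs_sinc2_le: "\<bar>sinc2 x\<bar> \<le> 1 - 1/10 * (x\<^sup>2 / (1 + x\<^sup>2))"
proof (cases "x = 0")
  case False
  define u where "u = 2 * pi * \<bar>x\<bar>"
  have u: "0 < u" "\<bar>x\<bar> \<le> u"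
    using False pi_gt3 mult_right_mono[of 1 "2 * pi" "\<bar>x\<bar>"] by (auto simp: u_def)
  have "\<bar>sinc2 x\<bar> = \<bar>sin u\<bar> / u"
    by (cases "x \<ge> 0") (auto simp: sinc2_def u_def abs_mult)
  also have "\<dots> \<le> 1 - 1/10 * (u\<^sup>2 / (1 + u\<^sup>2))" by (rule abs_sin_div_le[OF u(1)])
  also have "\<dots> \<le> 1 - 1/10 * (x\<^sup>2 / (1 + x\<^sup>2))"
  proof -
    have "x\<^sup>2 \<le> u\<^sup>2" using u by (intro abs_le_square_iff[THEN iffD1]) auto
    moreover have "0 < 1 + x\<^sup>2" "0 < 1 + u\<^sup>2" by (auto intro: add_pos_nonneg)
    ultimately have "x\<^sup>2 / (1 + x\<^sup>2) \<le> u\<^sup>2 / (1 + u\<^sup>2)" by (simp add: field_simps)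
    thus ?thesis by linarith
  qed
  finally show ?thesis .
qed (simp add: sinc2_def)

lemma Wfun_sharp_cases:
  obtains s where "s \<in> {-1, 0, 1::real}" "Wfun (sharp G) = (\<lambda>x. 1 + s * sinc2 x)"
proof (cases G)
  case GU thus thesis using that[of 0] by (auto simp: fun_eq_iff)
next
  case GSp thus thesis using that[of "-1"] by (auto simp: fun_eq_iff)
next
  case GO thus thesis using that[of 0] by (auto simp: fun_eq_iff)
next
  case GSOeven thus thesis using that[of 1] by (auto simp: fun_eq_iff)
next
  case GSOodd thus thesis using that[of "-1"] by (auto simp: fun_eq_iff)
qed

lemma even_weight_Wfun: "even_weight (Wfun (sharp G)) (1/10)"
proof -
  obtain s where s: "s \<in> {-1, 0, 1::real}" and W: "Wfun (sharp G) = (\<lambda>x. 1 + s * sinc2 x)"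
    using Wfun_sharp_cases .
  have bd: "\<bar>s * sinc2 x\<bar> \<le> 1 - 1/10 * (x\<^sup>2 / (1 + x\<^sup>2))" for x
    using mult_right_mono[of "\<bar>s\<bar>" 1 "\<bar>sinc2 x\<bar>"] s abs_sinc2_le[of x] by (auto simp: abs_mult)
  show ?thesis
    unfolding W
  proof
    show "(\<lambda>x. 1 + s * sinc2 x) \<in> borel_measurable borel"
      unfolding sinc2_def by measurable
    show "1 + s * sinc2 (- x) = 1 + s * sinc2 x" for x by (simp add: sinc2_def)
    have nn: "0 \<le> x\<^sup>2 / (1 + x\<^sup>2)" for x :: real by (simp add: add_nonneg_nonneg)
    show "1 + s * sinc2 x \<le> 2" for x
      using order_trans[OF abs_ge_self bd[of x]] nn[of x] by linarith
    show "1/10 * (x\<^sup>2 / (1 + x\<^sup>2)) \<le> 1 + s * sinc2 x" for x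
      using order_trans[OF abs_ge_minus_self bd[of x]] by linarith
  qed auto
qed

text \<open>The origin is excluded because \<open>sinc2 0\<close> is 0 by division by zero while the
  limit is 1: the weights of Sp and SO(even) jump at that point.\<close>

lemma isCont_Wfun:
  assumes "x \<noteq> 0"
  shows "isCont (Wfun (sharp G)) x"
proof -
  obtain s where W: "Wfun (sharp G) = (\<lambda>x. 1 + s * sinc2 x)"
    using Wfun_sharp_cases by metis
  show ?thesis unfolding W sinc2_def using assms by (intro continuous_intros) auto
qed

text \<open>Termwise comparison with a summand supported at the centre. The hypotheses force k to be
  the full central multiplicity whenever there is a central zero, so the sign of
  \<open>\<phi> 0\<close> does not matter.\<close>

lemma zero_sum_le_central:
  assumes sum: "zero_summable Lf c \<phi>" and k: "k \<le> zmult Lf 0"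
    and central: "0 \<in> zeroset Lf \<Longrightarrow> zmult Lf 0 \<le> k"
    and neg: "\<And>g. g \<in> zeroset Lf \<Longrightarrow> g \<noteq> 0 \<Longrightarrow> \<phi> (g * ln c / (2 * pi)) \<le> 0"
  shows "zero_sum Lf c \<phi> \<le> real k * \<phi> 0"
proof -
  define h where "h g = (if g = 0 then real k * \<phi> 0 else 0)" for g :: real
  have sumh: "h summable_on zeroset Lf"
  proof -
    have "h summable_on ({0} \<inter> zeroset Lf)" by (intro summable_on_finite) auto
    thus ?thesis by (subst summable_on_cong_neutral[of "{0} \<inter> zeroset Lf" _ h h]) (auto simp: h_def)
  qed
  have "zero_sum Lf c \<phi> \<le> infsum h (zeroset Lf)"
    unfolding zero_sum_def
  proof (rule infsum_mono[OF _ sumh])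
    show "(\<lambda>g. real (zmult Lf g) * \<phi> (g * ln c / (2 * pi))) summable_on zeroset Lf"
      using sum by (simp add: zero_summable_def)
    fix g assume g: "g \<in> zeroset Lf"
    show "real (zmult Lf g) * \<phi> (g * ln c / (2 * pi)) \<le> h g"
    proof (cases "g = 0")
      case True
      have "zmult Lf 0 = k" using central g k True by auto
      thus ?thesis using True by (simp add: h_def)
    next
      case False
      thus ?thesis using neg[OF g False] by (simp add: h_def mult_nonneg_nonpos)
    qed
  qed
  also have "infsum h (zeroset Lf) = infsum h ({0} \<inter> zeroset Lf)"
    by (rule infsum_cong_neutral) (auto simp: h_def)
  also have "\<dots> = real k * \<phi> 0"
  proof (cases "0 \<in> zeroset Lf")
    case True
    hence "{0} \<inter> zeroset Lf = {0}" by auto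
    thus ?thesis by (simp add: h_def)
  next
    case False
    \<comment> \<open>\<open>zmult\<close> is 0 by definition where \<open>Lf\<close> does not
      vanish.\<close>
    hence "k = 0" using k by (auto simp: zmult_def zeroset_def)
    thus ?thesis using False by simp
  qed
  finally show ?thesis .
qed

text \<open>A sub-multiset of the zeros at one point is determined by its size, so
  \<open>z f\<close> stands for Z(f), and a central zero lies outside it exactly when
  \<open>z f < zmult (L f) 0\<close>. The functional equation is asked for off a sparse set, which
  allows for poles of \<open>Linf\<close>. The minimum is an infimum in the extended reals, with
  value infinity if no zero is left.\<close>

theorem theorem9:
  fixes G :: symtype and \<Delta> :: real
    and F :: "nat \<Rightarrow> 'a set"
    and lam :: "'a \<Rightarrow> nat \<Rightarrow> complex"
    and L Linf :: "'a \<Rightarrow> complex \<Rightarrow> complex"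
    and eps :: "'a \<Rightarrow> complex"
    and bar :: "'a \<Rightarrow> 'a"
    and c :: "'a \<Rightarrow> real"
    and z :: "'a \<Rightarrow> nat"
    and \<xi>0 :: real
  assumes Delta_pos: "\<Delta> > 0"
    and fin: "\<And>n. finite (F n)"
    and card_lim: "filterlim (\<lambda>n. card (F n)) at_top sequentially"
    and dirichlet: "\<And>n f. f \<in> F n \<Longrightarrow> \<exists>\<sigma>::real. \<forall>s. Re s > \<sigma> \<longrightarrow>
          summable (\<lambda>k. norm (lam f (Suc k) / of_nat (Suc k) powr s)) \<and>
          (\<lambda>k. lam f (Suc k) / of_nat (Suc k) powr s) sums L f s"
    and entire: "\<And>n f. f \<in> F n \<Longrightarrow> L f holomorphic_on UNIV"
    and funeq: "\<And>n f. f \<in> F n \<Longrightarrow>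
          \<forall>\<^sub>F s in cosparse UNIV. Linf f s * L f s = eps f * (Linf (bar f) (1 - s) * L (bar f) (1 - s))"
    and eps_norm: "\<And>n f. f \<in> F n \<Longrightarrow> norm (eps f) = 1"
    and bar_coeff: "\<And>n f k. f \<in> F n \<Longrightarrow> lam (bar f) k = cnj (lam f k)"
    and Linf_nonzero: "\<And>n f s. f \<in> F n \<Longrightarrow> Re s = 1/2 \<Longrightarrow> Linf f s \<noteq> 0"
    and bar_closed: "\<And>n f. f \<in> F n \<Longrightarrow> bar f \<in> F n"
    and GRH: "\<And>n f \<rho>. f \<in> F n \<Longrightarrow> L f \<rho> = 0 \<Longrightarrow> 0 < Re \<rho> \<Longrightarrow> Re \<rho> < 1 \<Longrightarrow> Re \<rho> = 1/2"
    and conductor: "\<And>n f. f \<in> F n \<Longrightarrow> c f > 1"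
    and density: "\<And>\<phi>. schwartz \<phi> \<Longrightarrow> (\<forall>x. \<phi> (- x) = \<phi> x) \<Longrightarrow>
          closure {y. fourier \<phi> y \<noteq> 0} \<subseteq> {- \<Delta> <..< \<Delta>} \<Longrightarrow>
          (\<forall>n. \<forall>f\<in>F n. zero_summable (L f) (c f) \<phi>) \<and>
          ((\<lambda>n. (\<Sum>f\<in>F n. zero_sum (L f) (c f) \<phi>) / real (card (F n)))
              \<longlonglongrightarrow> one_level G \<phi>)"
    and Z_sub: "\<And>n f. f \<in> F n \<Longrightarrow> z f \<le> zmult (L f) 0"
    and Z_O: "G = GO \<Longrightarrow> (\<lambda>n. (\<Sum>f\<in>F n. real (z f)) / real (card (F n))) \<longlonglongrightarrow> 1/2"
    and Z_SOodd: "G = GSOodd \<Longrightarrow> (\<lambda>n. (\<Sum>f\<in>F n. real (z f)) / real (card (F n))) \<longlonglongrightarrow> 1"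
    and Z_empty: "G \<in> {GU, GSp, GSOeven} \<Longrightarrow> (\<And>n f. f \<in> F n \<Longrightarrow> z f = 0)"
    and xi0: "\<xi>0 \<in> xi_zeros G \<Delta>" "\<And>x. x \<in> xi_zeros G \<Delta> \<Longrightarrow> \<xi>0 \<le> x"
  shows "limsup (\<lambda>n. INF p \<in> {(f, g). f \<in> F n \<and> g \<in> zeroset (L f) \<and> (g \<noteq> 0 \<or> z f < zmult (L f) 0)}.
            ereal \<bar>snd p * ln (c (fst p)) / (2 * pi)\<bar>) \<le> ereal \<xi>0"
proof (rule ccontr)
  define u where "u n = (INF p \<in> {(f, g). f \<in> F n \<and> g \<in> zeroset (L f) \<and> (g \<noteq> 0 \<or> z f < zmult (L f) 0)}.
            ereal \<bar>snd p * ln (c (fst p)) / (2 * pi)\<bar>)" for n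
  assume "\<not> limsup (\<lambda>n. INF p \<in> {(f, g). f \<in> F n \<and> g \<in> zeroset (L f) \<and> (g \<noteq> 0 \<or> z f < zmult (L f) 0)}.
            ereal \<bar>snd p * ln (c (fst p)) / (2 * pi)\<bar>) \<le> ereal \<xi>0"
  hence "ereal \<xi>0 < limsup u" by (simp add: u_def[abs_def] not_le)
  then obtain r where r: "\<xi>0 < r" "ereal r < limsup u" using ereal_dense2 by force
  have freq: "\<exists>\<^sub>F n in sequentially. ereal r < u n"
  proof (rule ccontr)
    assume "\<not> ?thesis"
    hence "\<forall>\<^sub>F n in sequentially. u n \<le> ereal r" by (simp add: not_frequently not_less)
    hence "limsup u \<le> ereal r" by (rule Limsup_bounded)
    thus False using r(2) by simp
  qed
  define W where "W = Wfun (sharp G)"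
  define a where "a x = Re ((1 - \<i> * of_real x) * repkernel W (pi * \<Delta>) \<i> (of_real x))" for x
  have xi_eq: "xi_zeros G \<Delta> = {x. 0 < x \<and> a x = 0}" by (simp only: xi_zeros_def W_def a_def)
  have xi: "0 < \<xi>0" "a \<xi>0 = 0" using xi0(1) unfolding xi_eq by auto
  \<comment> \<open>Since \<open>\<xi>0\<close> is the least positive zero, its half is not a zero;
    this excludes a vanishing extremal function.\<close>
  have nontriv: "a (\<xi>0 / 2) \<noteq> 0" using xi0(2)[of "\<xi>0 / 2"] xi unfolding xi_eq by auto
  obtain \<phi> where \<phi>: "schwartz \<phi>" "\<And>x. \<phi> (- x) = \<phi> x" "closure {y. fourier \<phi> y \<noteq> 0} \<subseteq> {- \<Delta> <..< \<Delta>}"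
    and neg: "\<And>x. r \<le> \<bar>x\<bar> \<Longrightarrow> \<phi> x \<le> 0" and pos: "0 < (LINT x|lborel. \<phi> x * W x)"
    by (rule even_weight.test_function_exists[OF even_weight_Wfun[of G] isCont_Wfun Delta_pos xi(1)
          xi(2)[unfolded a_def W_def] nontriv[unfolded a_def W_def] r(1), folded W_def]) (assumption | rule that)+
  have dens: "\<And>n f. f \<in> F n \<Longrightarrow> zero_summable (L f) (c f) \<phi>"
    "(\<lambda>n. (\<Sum>f\<in>F n. zero_sum (L f) (c f) \<phi>) / real (card (F n))) \<longlonglongrightarrow> one_level G \<phi>"
    using density[OF \<phi>(1) _ \<phi>(3)] \<phi>(2) by auto
  define \<zeta> :: real where "\<zeta> = (if G = GO then 1/2 else if G = GSOodd then 1 else 0)"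
  have Z: "(\<lambda>n. (\<Sum>f\<in>F n. real (z f)) / real (card (F n))) \<longlonglongrightarrow> \<zeta>"
  proof (cases "G = GO \<or> G = GSOodd")
    case True
    thus ?thesis using Z_O Z_SOodd by (auto simp: \<zeta>_def)
  next
    case False
    hence "G \<in> {GU, GSp, GSOeven}" by (cases G) auto
    hence "(\<Sum>f\<in>F n. real (z f)) = 0" for n using Z_empty by simp
    thus ?thesis using False by (simp add: \<zeta>_def)
  qed
  have ol: "one_level G \<phi> = (LINT x|lborel. \<phi> x * W x) + \<zeta> * \<phi> 0"
  proof -
    have "Wfun G x = W x" for x unfolding W_def by (cases G) auto
    thus ?thesis by (simp add: one_level_def \<zeta>_def)
  qed
  \<comment> \<open>Subtracting the contribution of Z(f) cancels the Dirac mass in the limit and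
    leaves the positive integral against W.\<close>
  have "(\<lambda>n. (\<Sum>f\<in>F n. zero_sum (L f) (c f) \<phi>) / real (card (F n)) - (\<Sum>f\<in>F n. real (z f)) / real (card (F n)) * \<phi> 0)
      \<longlonglongrightarrow> one_level G \<phi> - \<zeta> * \<phi> 0"
    by (intro tendsto_intros dens(2) Z)
  hence "\<forall>\<^sub>F n in sequentially. 0 < (\<Sum>f\<in>F n. zero_sum (L f) (c f) \<phi>) / real (card (F n)) - (\<Sum>f\<in>F n. real (z f)) / real (card (F n)) * \<phi> 0"
    using pos by (intro order_tendstoD(1)) (auto simp: ol)
  from frequently_eventually_frequently[OF freq this]
  obtain n where n: "ereal r < u n"
    "0 < (\<Sum>f\<in>F n. zero_sum (L f) (c f) \<phi>) / real (card (F n)) - (\<Sum>f\<in>F n. real (z f)) / real (card (F n)) * \<phi> 0"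
    by (auto dest!: frequently_ex)
  have far: "r < \<bar>g * ln (c f) / (2 * pi)\<bar>"
    if "f \<in> F n" "g \<in> zeroset (L f)" "g \<noteq> 0 \<or> z f < zmult (L f) 0" for f g
    using less_INF_D[OF n(1)[unfolded u_def], of "(f, g)"] that by simp
  have "(\<Sum>f\<in>F n. zero_sum (L f) (c f) \<phi>) \<le> (\<Sum>f\<in>F n. real (z f) * \<phi> 0)"
  proof (rule sum_mono)
    fix f assume f: "f \<in> F n"
    show "zero_sum (L f) (c f) \<phi> \<le> real (z f) * \<phi> 0"
    proof (rule zero_sum_le_central[OF dens(1)[OF f] Z_sub[OF f]])
      \<comment> \<open>A central zero outside Z(f) would have height 0, contradicting that all
        remaining heights exceed r > 0.\<close>
      show "zmult (L f) 0 \<le> z f" if "0 \<in> zeroset (L f)"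
        using far[OF f that] r(1) xi(1) by (auto simp: not_less[symmetric])
      show "\<phi> (g * ln (c f) / (2 * pi)) \<le> 0" if "g \<in> zeroset (L f)" "g \<noteq> 0" for g
        using far[OF f that(1)] that(2) by (intro neg) auto
    qed
  qed
  hence "(\<Sum>f\<in>F n. zero_sum (L f) (c f) \<phi>) / real (card (F n)) \<le> (\<Sum>f\<in>F n. real (z f)) * \<phi> 0 / real (card (F n))"
    unfolding sum_distrib_right by (intro divide_right_mono) auto
  thus False using n(2) by simp
qed

end
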